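(* Let $N\ge0$, $L=\{k_0,\dots,k_N,k_{N+1}\}$ with $k_{N+1}\ge2$, let $\mathcal F^L$ be the potential of the Hurwitz--Frobenius manifold $\mathcal H_{0;L}$ in its flat coordinates $\mathbf t=(t_{i,\alpha})$, and let $$F^o:=\left.\frac{\partial\mathcal F^L}{\partial t_{N+1,1}}\right|_{t_{N+1,1}=\dots=t_{N+1,k_{N+1}}=0}.$$ Denote $\widetilde\lambda(z,\mathbf t):=\lambda(z,\mathbf t)|_{t_{N+1,a}=0,\ a\ge1}$. Then $$F^o=\left.\left(\int\widetilde\lambda(z,\mathbf t)\,dz\right)\right|_{z=t_{N+1,0}}+\sum_{\substack{\alpha_1,\dots,\alpha_{k_0-1}\ge0\\ \sum_{i=1}^{k_0-1}(k_0+1-i)\alpha_i=k_0+1}}(|\alpha|-2)!\prod_{i=1}^{k_0-1}\frac{t_{0,i}^{\alpha_i}}{\alpha_i!},$$ where $|\alpha|=\sum_{i=1}^{k_0-1}\alpha_i$.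
   Context: **Hurwitz--Frobenius manifold $\mathcal H_{0;L}$** ($k_0\ge2$, $k_i\ge1$). Its underlying space consists of complex parameters $v_{0,a}$ ($1\le a\le k_0-1$), $v_{i,a}$ ($1\le i\le N+1$, $0\le a\le k_i$) with $v_{i,k_i}\ne0$ and $v_{i,0}\ne v_{j,0}$ for $i\ne j$; a point corresponds to $$\lambda(z)=\frac{z^{k_0}}{k_0}+\sum_{a=1}^{k_0-1}v_{0,a}z^{a-1}+\sum_{i=1}^{N+1}\sum_{a=1}^{k_i}\frac{v_{i,a}}{(z-v_{i,0})^a}.$$ With $\mathcal R=\{\infty,v_{1,0},\dots,v_{N+1,0}\}$ and $X\cdot\lambda$ the derivative of $\lambda$ along a vector field $X$, set $$\langle X,Y,Z\rangle=-\sum_{p\in\mathcal R}\mathrm{res}_{z=p}\frac{(X\cdot\lambda)(Y\cdot\lambda)(Z\cdot\lambda)}{\partial\lambda/\partial z}dz.$$ **Flat coordinates.** Let $z_0^{k_0}=k_0\lambda$ with $z_0=z+O(z^{-1})$ near $z=\infty$, and $z_i^{k_i}=\lambda$ near $z=v_{i,0}$. Then $t_{0,\alpha}=-\frac1{k_0-\alpha}\mathrm{res}_{z=\infty}z_0^{k_0-\alpha}dz$ for $1\le\alpha\le k_0-1$, and for $i\ge1$: $t_{i,0}=v_{i,0}$, $t_{i,1}=v_{i,1}$, $t_{i,\alpha}=\frac{k_i}{k_i-\alpha+1}\mathrm{res}_{z=v_{i,0}}z_i^{k_i-\alpha+1}dz$ for $2\le\alpha\le k_i$. The function $\lambda(z,\mathbf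 t)$ is $\lambda(z)$ written in the flat coordinates. **Potential.** $\mathcal F^L$ is the function of the flat coordinates with $\frac{\partial^3\mathcal F^L}{\partial t_a\partial t_b\partial t_c}=\left\langle\frac{\partial}{\partial t_a},\frac{\partial}{\partial t_b},\frac{\partial}{\partial t_c}\right\rangle$. The integral is an antiderivative with respect to $z$. *)

theory Defs
  imports "HOL-Complex_Analysis.Complex_Analysis" "HOL-Library.Landau_Symbols"
begin

section \<open>The Hurwitz space of rational superpotentials\<close>

text \<open>
  The data are \<open>N\<close> and the pole orders \<open>k 0, \<dots>, k (N+1)\<close>. The parameters \<open>v\<^sub>i\<^sub>,\<^sub>a\<close> and the flat
  coordinates \<open>t\<^sub>i\<^sub>,\<^sub>\<alpha>\<close> have the same index set, and in both cases a point is a function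
  \<open>nat \<times> nat \<Rightarrow> complex\<close> vanishing off this finite set. On the space of such functions the product
  topology is the usual topology of a complex coordinate space.
\<close>

type_synonym point = "nat \<times> nat \<Rightarrow> complex"

definition idx :: "nat \<Rightarrow> (nat \<Rightarrow> nat) \<Rightarrow> (nat \<times> nat) set" where
  "idx N k = {(0, a) | a. a \<in> {1..k 0 - 1}} \<union> {(i, a) | i a. i \<in> {1..N+1} \<and> a \<in> {0..k i}}"

definition points :: "nat \<Rightarrow> (nat \<Rightarrow> nat) \<Rightarrow> point set" where
  "points N k = {v. \<forall>x. x \<notin> idx N k \<longrightarrow> v x = 0}"

definition hurwitz_space :: "nat \<Rightarrow> (nat \<Rightarrow> nat) \<Rightarrow> point set" where
  "hurwitz_space N k = {v \<in> points N k.
     (\<forall>i\<in>{1..N+1}. v (i, k i) \<noteq> 0) \<and> (\<forall>i\<in>{1..N+1}. \<forall>j\<in>{1..N+1}. i \<noteq> j \<longrightarrow> v (i, 0) \<noteq> v (j, 0))}"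

definition lam :: "nat \<Rightarrow> (nat \<Rightarrow> nat) \<Rightarrow> point \<Rightarrow> complex \<Rightarrow> complex" where
  "lam N k v z = z ^ k 0 / of_nat (k 0) + (\<Sum>a=1..k 0 - 1. v (0, a) * z ^ (a - 1))
     + (\<Sum>i=1..N+1. \<Sum>a=1..k i. v (i, a) / (z - v (i, 0)) ^ a)"

text \<open>The residue of \<open>f dz\<close> at \<open>z = \<infinity>\<close>: substitute \<open>z = 1/w\<close>, \<open>dz = - dw/w\<^sup>2\<close>.\<close>

definition residue_inf :: "(complex \<Rightarrow> complex) \<Rightarrow> complex" where
  "residue_inf f = - residue (\<lambda>w. f (1 / w) / w ^ 2) 0"

section \<open>Flat coordinates\<close>

text \<open>
  For \<open>i \<ge> 1\<close> the local root \<open>z\<^sub>i\<close> is only determined up to a \<open>k i\<close>-th root of unity, so the flat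
  coordinates are multivalued functions of \<open>v\<close>: \<open>flat_coords N k v t\<close> says that \<open>t\<close> is the system of
  flat coordinates of \<open>v\<close> for some choice of the roots. Conversely \<open>v\<close> is a function of \<open>t\<close>.
\<close>

definition root_inf :: "nat \<Rightarrow> (nat \<Rightarrow> nat) \<Rightarrow> point \<Rightarrow> (complex \<Rightarrow> complex) \<Rightarrow> bool" where
  "root_inf N k v z0 \<longleftrightarrow>
     (\<exists>r. z0 holomorphic_on {z. norm z > r} \<and> (\<forall>z. norm z > r \<longrightarrow> z0 z ^ k 0 = of_nat (k 0) * lam N k v z))
     \<and> (\<lambda>z. z0 z - z) \<in> O[at_infinity](\<lambda>z. 1 / z)"

definition root_at :: "nat \<Rightarrow> (nat \<Rightarrow> nat) \<Rightarrow> point \<Rightarrow> nat \<Rightarrow> (complex \<Rightarrow> complex) \<Rightarrow> bool" where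
  "root_at N k v i zi \<longleftrightarrow>
     (\<exists>r>0. zi holomorphic_on (ball (v (i, 0)) r - {v (i, 0)})
        \<and> (\<forall>z \<in> ball (v (i, 0)) r - {v (i, 0)}. zi z ^ k i = lam N k v z))"

definition flat_coords :: "nat \<Rightarrow> (nat \<Rightarrow> nat) \<Rightarrow> point \<Rightarrow> point \<Rightarrow> bool" where
  "flat_coords N k v t \<longleftrightarrow> v \<in> hurwitz_space N k \<and> t \<in> points N k
     \<and> (\<exists>z0. root_inf N k v z0 \<and>
          (\<forall>\<alpha>\<in>{1..k 0 - 1}. t (0, \<alpha>) = - (1 / of_nat (k 0 - \<alpha>)) * residue_inf (\<lambda>z. z0 z ^ (k 0 - \<alpha>))))
     \<and> (\<forall>i\<in>{1..N+1}. t (i, 0) = v (i, 0) \<and> t (i, 1) = v (i, 1) \<and>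
          (\<exists>zi. root_at N k v i zi \<and>
             (\<forall>\<alpha>\<in>{2..k i}. t (i, \<alpha>) = of_nat (k i) / of_nat (k i - \<alpha> + 1)
                                * residue (\<lambda>z. zi z ^ (k i - \<alpha> + 1)) (v (i, 0)))))"

definition flat_domain :: "nat \<Rightarrow> (nat \<Rightarrow> nat) \<Rightarrow> point set" where
  "flat_domain N k = {t. \<exists>v. flat_coords N k v t}"

definition params :: "nat \<Rightarrow> (nat \<Rightarrow> nat) \<Rightarrow> point \<Rightarrow> point" where
  "params N k t = (THE v. flat_coords N k v t)"

definition lam_flat :: "nat \<Rightarrow> (nat \<Rightarrow> nat) \<Rightarrow> complex \<Rightarrow> point \<Rightarrow> complex" where
  "lam_flat N k z t = lam N k (params N k t) z"

section \<open>The potential\<close>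

definition pd :: "nat \<times> nat \<Rightarrow> (point \<Rightarrow> complex) \<Rightarrow> point \<Rightarrow> complex" where
  "pd x f t = deriv (\<lambda>s. f (t(x := s))) (t x)"

text \<open>\<open>triple N k t x y w\<close> is the three-tensor on \<open>\<partial>/\<partial>t\<^sub>x, \<partial>/\<partial>t\<^sub>y, \<partial>/\<partial>t\<^sub>w\<close> at the point with flat coordinates \<open>t\<close>.\<close>

definition triple :: "nat \<Rightarrow> (nat \<Rightarrow> nat) \<Rightarrow> point \<Rightarrow> nat \<times> nat \<Rightarrow> nat \<times> nat \<Rightarrow> nat \<times> nat \<Rightarrow> complex" where
  "triple N k t x y w =
     (let g = (\<lambda>z. pd x (lam_flat N k z) t * pd y (lam_flat N k z) t * pd w (lam_flat N k z) t
                     / deriv (\<lambda>z. lam_flat N k z t) z)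
      in - (residue_inf g + (\<Sum>i=1..N+1. residue g (params N k t (i, 0)))))"

text \<open>Holomorphic functions of several variables, as continuous, separately holomorphic functions (Osgood).\<close>

definition holo :: "nat \<Rightarrow> (nat \<Rightarrow> nat) \<Rightarrow> point set \<Rightarrow> (point \<Rightarrow> complex) \<Rightarrow> bool" where
  "holo N k U f \<longleftrightarrow> continuous_on U f \<and>
     (\<forall>t\<in>U. \<forall>x\<in>idx N k. (\<lambda>s. f (t(x := s))) field_differentiable at (t x))"

text \<open>
  A branch of the potential on \<open>U\<close>. (The potential is multivalued on the whole of \<open>flat_domain N k\<close>.)
  It is determined by its third derivatives only up to a polynomial of degree at most two in the flat
  coordinates. That the partial derivatives of a holomorphic function are holomorphic is a theorem,
  so the second and third clauses only spell out consequences of the first.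
\<close>

definition potential :: "nat \<Rightarrow> (nat \<Rightarrow> nat) \<Rightarrow> point set \<Rightarrow> (point \<Rightarrow> complex) \<Rightarrow> bool" where
  "potential N k U F \<longleftrightarrow> holo N k U F
     \<and> (\<forall>x\<in>idx N k. holo N k U (pd x F))
     \<and> (\<forall>x\<in>idx N k. \<forall>y\<in>idx N k. holo N k U (pd x (pd y F)))
     \<and> (\<forall>x\<in>idx N k. \<forall>y\<in>idx N k. \<forall>w\<in>idx N k. \<forall>t\<in>U. pd x (pd y (pd w F)) t = triple N k t x y w)"

section \<open>Restriction to \<open>t\<^sub>N\<^sub>+\<^sub>1\<^sub>,\<^sub>a = 0\<close>, \<open>a \<ge> 1\<close>\<close>

text \<open>
  The stratum \<open>t\<^sub>N\<^sub>+\<^sub>1\<^sub>,\<^sub>1 = \<dots> = t\<^sub>N\<^sub>+\<^sub>1\<^sub>,\<^sub>k = 0\<close> lies on the boundary of \<open>flat_domain N k\<close>, where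
  \<open>t\<^sub>i\<^sub>,\<^sub>k \<noteq> 0\<close> for \<open>k = k i\<close>, \<open>i \<ge> 1\<close>. So the restrictions are limits.
\<close>

definition stratum :: "nat \<Rightarrow> (nat \<Rightarrow> nat) \<Rightarrow> point set" where
  "stratum N k = {t \<in> points N k. (\<forall>a\<in>{1..k (N+1)}. t (N+1, a) = 0) \<and> (\<forall>i\<in>{1..N}. t (i, k i) \<noteq> 0)
     \<and> (\<forall>i\<in>{1..N+1}. \<forall>j\<in>{1..N+1}. i \<noteq> j \<longrightarrow> t (i, 0) \<noteq> t (j, 0))}"

text \<open>
  The parameters \<open>v\<close> are polynomials in \<open>t\<close>, hence extend continuously to the stratum;
  \<open>lam_tilde\<close> is \<open>\<lambda>(z, t)\<close> with the extended coefficients.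
\<close>

definition params_tilde :: "nat \<Rightarrow> (nat \<Rightarrow> nat) \<Rightarrow> point \<Rightarrow> point" where
  "params_tilde N k t = (\<lambda>x. Lim (at t within flat_domain N k) (\<lambda>t'. params N k t' x))"

definition lam_tilde :: "nat \<Rightarrow> (nat \<Rightarrow> nat) \<Rightarrow> complex \<Rightarrow> point \<Rightarrow> complex" where
  "lam_tilde N k z t = lam N k (params_tilde N k t) z"

text \<open>
  The derivative \<open>\<partial>F/\<partial>t\<^sub>N\<^sub>+\<^sub>1\<^sub>,\<^sub>1\<close> has no limit at the stratum along arbitrary paths: for \<open>k (N+1) = 2\<close>
  it contains a multiple of \<open>t\<^sub>N\<^sub>+\<^sub>1\<^sub>,\<^sub>1 log t\<^sub>N\<^sub>+\<^sub>1\<^sub>,\<^sub>2\<close>, for \<open>k (N+1) = 3\<close> one of \<open>(t\<^sub>N\<^sub>+\<^sub>1\<^sub>,\<^sub>2)\<^sup>2 / t\<^sub>N\<^sub>+\<^sub>1\<^sub>,\<^sub>3\<close>.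
  The substitutions are to be performed in order: first \<open>t\<^sub>N\<^sub>+\<^sub>1\<^sub>,\<^sub>1, \<dots>, t\<^sub>N\<^sub>+\<^sub>1\<^sub>,\<^sub>k\<^sub>-\<^sub>1\<close> are put
  to \<open>0\<close> (\<open>k = k (N+1)\<close>), which stays inside \<open>flat_domain N k\<close>, and then \<open>t\<^sub>N\<^sub>+\<^sub>1\<^sub>,\<^sub>k\<close> tends to \<open>0\<close>.
  \<open>toward N k t s\<close>, for \<open>t\<close> in the stratum, is the point with \<open>t\<^sub>N\<^sub>+\<^sub>1\<^sub>,\<^sub>k = s\<close> of this slice, and
  \<open>restricts_to N k S f t c\<close> says that the restriction of \<open>f\<close> has the value \<open>c\<close> at \<open>t\<close>. Here \<open>S\<close> is
  the set of values of \<open>t\<^sub>N\<^sub>+\<^sub>1\<^sub>,\<^sub>k\<close> on which the branch \<open>f\<close> is given, for instance a sector.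
\<close>

definition toward :: "nat \<Rightarrow> (nat \<Rightarrow> nat) \<Rightarrow> point \<Rightarrow> complex \<Rightarrow> point" where
  "toward N k t s = t((N+1, k (N+1)) := s)"

definition restricts_to :: "nat \<Rightarrow> (nat \<Rightarrow> nat) \<Rightarrow> complex set \<Rightarrow> (point \<Rightarrow> complex) \<Rightarrow> point \<Rightarrow> complex \<Rightarrow> bool" where
  "restricts_to N k S f t c \<longleftrightarrow> ((\<lambda>s. f (toward N k t s)) \<longlongrightarrow> c) (at 0 within S)"

section \<open>The right-hand side\<close>

text \<open>
  The antiderivative of \<open>lam N k v\<close> in \<open>z\<close>, taken term by term in the partial fraction decomposition;
  this fixes the constant of integration, which could otherwise depend on \<open>v\<close>.
  \<open>l i z\<close> stands for a branch of \<open>log (z - v\<^sub>i\<^sub>,\<^sub>0)\<close>.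
\<close>

definition lam_int :: "nat \<Rightarrow> (nat \<Rightarrow> nat) \<Rightarrow> (nat \<Rightarrow> complex \<Rightarrow> complex) \<Rightarrow> point \<Rightarrow> complex \<Rightarrow> complex" where
  "lam_int N k l v z = z ^ (k 0 + 1) / (of_nat (k 0) * of_nat (k 0 + 1))
     + (\<Sum>a=1..k 0 - 1. v (0, a) * z ^ a / of_nat a)
     + (\<Sum>i=1..N+1. v (i, 1) * l i z
          - (\<Sum>a=2..k i. v (i, a) / (of_nat (a - 1) * (z - v (i, 0)) ^ (a - 1))))"

lemma lam_int_has_derivative:
  assumes k: "k 0 \<ge> 1" "\<And>i. i \<in> {1..N+1} \<Longrightarrow> k i \<ge> 1"
    and l: "\<And>i. i \<in> {1..N+1} \<Longrightarrow> (\<exists>a\<in>{1..k i}. v (i, a) \<noteq> 0) \<Longrightarrow>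
          z \<noteq> v (i, 0) \<and> l i field_differentiable at z \<and> (\<forall>\<^sub>F y in nhds z. exp (l i y) = y - v (i, 0))"
  shows "(lam_int N k l v has_field_derivative lam N k v z) (at z)"
proof -
  have A: "((\<lambda>z. z ^ (k 0 + 1) / (of_nat (k 0) * of_nat (k 0 + 1)))
      has_field_derivative z ^ k 0 / of_nat (k 0)) (at z)"
  proof -
    have "((\<lambda>z. z ^ Suc (k 0) / (of_nat (k 0) * of_nat (Suc (k 0))))
        has_field_derivative of_nat (Suc (k 0)) * z ^ k 0 / (of_nat (k 0) * of_nat (Suc (k 0)))) (at z)"
      by (rule DERIV_cdivide) (auto intro!: derivative_eq_intros simp del: of_nat_Suc power_Suc)
    moreover have "of_nat (Suc (k 0)) * z ^ k 0 / (of_nat (k 0) * of_nat (Suc (k 0))) = z ^ k 0 / of_nat (k 0)"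
      using of_nat_neq_0[of "k 0", where 'a = complex] k(1) by (simp add: field_simps del: of_nat_Suc)
    ultimately show ?thesis by simp
  qed
  have B: "((\<lambda>z. \<Sum>a=1..k 0 - 1. v (0, a) * z ^ a / of_nat a)
      has_field_derivative (\<Sum>a=1..k 0 - 1. v (0, a) * z ^ (a - 1))) (at z)"
    by (intro DERIV_sum) (auto intro!: derivative_eq_intros)
  have C: "((\<lambda>z. v (i, 1) * l i z
          - (\<Sum>a=2..k i. v (i, a) / (of_nat (a - 1) * (z - v (i, 0)) ^ (a - 1))))
      has_field_derivative (\<Sum>a=1..k i. v (i, a) / (z - v (i, 0)) ^ a)) (at z)"
    if i: "i \<in> {1..N+1}" for i
  proof (cases "\<exists>a\<in>{1..k i}. v (i, a) \<noteq> 0")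
    case False
    then have "v (i, 1) = 0" "\<And>a. a \<in> {2..k i} \<Longrightarrow> v (i, a) = 0" "\<And>a. a \<in> {1..k i} \<Longrightarrow> v (i, a) = 0"
      using k(2)[OF i] by auto
    then show ?thesis by simp
  next
    case True
    note L = l[OF i True]
    obtain d where d: "(l i has_field_derivative d) (at z)"
      using L field_differentiable_def by blast
    have "((\<lambda>y. exp (l i y)) has_field_derivative exp (l i z) * d) (at z)"
      using d by (auto intro!: derivative_eq_intros)
    moreover have "((\<lambda>y. exp (l i y)) has_field_derivative 1) (at z)
        \<longleftrightarrow> ((\<lambda>y. y - v (i, 0)) has_field_derivative 1) (at z)"
      using L by (intro DERIV_cong_ev) auto
    moreover have "((\<lambda>y. y - v (i, 0)) has_field_derivative 1) (at z)"
      by (auto intro!: derivative_eq_intros)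
    ultimately have "exp (l i z) * d = 1" by (metis DERIV_unique)
    moreover have "exp (l i z) = z - v (i, 0)" using L eventually_nhds_x_imp_x by blast
    ultimately have "d = 1 / (z - v (i, 0))" using L by (auto simp: field_simps)
    then have 1: "((\<lambda>z. v (i, 1) * l i z) has_field_derivative v (i, 1) / (z - v (i, 0))) (at z)"
      using d by (auto intro!: derivative_eq_intros)
    have T: "((\<lambda>z. v (i, a) / (of_nat (a - 1) * (z - v (i, 0)) ^ (a - 1)))
        has_field_derivative - (v (i, a) / (z - v (i, 0)) ^ a)) (at z)" if a: "a \<in> {2..k i}" for a
    proof -
      obtain b where b: "a = Suc (Suc b)" using a by (metis atLeastAtMost_iff le_Suc_ex numeral_2_eq_2 add_Suc)
      define x where "x = z - v (i, 0)"
      have x: "x \<noteq> 0" using L by (simp add: x_def)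
      have n: "of_nat (Suc b) \<noteq> (0::complex)" by (rule of_nat_neq_0)
      have "((\<lambda>z. v (i, a) / (of_nat (Suc b) * (z - v (i, 0)) ^ Suc b)) has_field_derivative
          - (v (i, a) * (of_nat (Suc b) * (of_nat (Suc b) * x ^ b)))
            / ((of_nat (Suc b) * x ^ Suc b) * (of_nat (Suc b) * x ^ Suc b))) (at z)"
        using x n unfolding x_def
        by (auto intro!: derivative_eq_intros simp del: of_nat_Suc power_Suc)
      moreover have "- (v (i, a) * (of_nat (Suc b) * (of_nat (Suc b) * x ^ b)))
            / ((of_nat (Suc b) * x ^ Suc b) * (of_nat (Suc b) * x ^ Suc b)) = - (v (i, a) / x ^ a)"
        using x n unfolding b by (simp add: divide_simps del: of_nat_Suc)
      ultimately show ?thesis by (simp add: b x_def)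
    qed
    have 2: "((\<lambda>z. \<Sum>a=2..k i. v (i, a) / (of_nat (a - 1) * (z - v (i, 0)) ^ (a - 1)))
        has_field_derivative (\<Sum>a=2..k i. - (v (i, a) / (z - v (i, 0)) ^ a))) (at z)"
      by (intro DERIV_sum T)
    have "(\<Sum>a=1..k i. v (i, a) / (z - v (i, 0)) ^ a)
        = v (i, 1) / (z - v (i, 0)) - (\<Sum>a=2..k i. - (v (i, a) / (z - v (i, 0)) ^ a))"
      using k(2)[OF i] by (simp add: sum.atLeast_Suc_atMost sum_negf numeral_2_eq_2)
    then show ?thesis using DERIV_diff[OF 1 2] by simp
  qed
  show ?thesis
    unfolding lam_int_def[abs_def] lam_def by (intro DERIV_add A B DERIV_sum C)
qed

text \<open>
  For each \<open>t\<close> the function \<open>lg t i\<close> is a branch of \<open>log (z - t\<^sub>i\<^sub>,\<^sub>0)\<close> near \<open>z = t\<^sub>N\<^sub>+\<^sub>1\<^sub>,\<^sub>0\<close>, the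
  branches being chosen continuously in \<open>t \<in> W\<close>. None is needed for the pole \<open>i = N+1\<close>, which
  \<open>lam_tilde\<close> does not have.
\<close>

definition log_branches :: "nat \<Rightarrow> point set \<Rightarrow> (point \<Rightarrow> nat \<Rightarrow> complex \<Rightarrow> complex) \<Rightarrow> bool" where
  "log_branches N W lg \<longleftrightarrow> (\<forall>i\<in>{1..N}.
     (\<forall>t\<in>W. \<forall>\<^sub>F z in nhds (t (N+1, 0)). lg t i field_differentiable at z \<and> exp (lg t i z) = z - t (i, 0))
     \<and> continuous_on W (\<lambda>t. lg t i (t (N+1, 0))))"

definition lam_tilde_int ::
  "nat \<Rightarrow> (nat \<Rightarrow> nat) \<Rightarrow> (point \<Rightarrow> nat \<Rightarrow> complex \<Rightarrow> complex) \<Rightarrow> complex \<Rightarrow> point \<Rightarrow> complex" where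
  "lam_tilde_int N k lg z t = lam_int N k (lg t) (params_tilde N k t) z"

lemma lam_tilde_int_has_derivative:
  assumes "k 0 \<ge> 1" and "\<And>i. i \<in> {1..N+1} \<Longrightarrow> k i \<ge> 1"
    and "\<And>i. i \<in> {1..N+1} \<Longrightarrow> (\<exists>a\<in>{1..k i}. params_tilde N k t (i, a) \<noteq> 0) \<Longrightarrow>
          z \<noteq> params_tilde N k t (i, 0) \<and> lg t i field_differentiable at z
          \<and> (\<forall>\<^sub>F y in nhds z. exp (lg t i y) = y - params_tilde N k t (i, 0))"
  shows "((\<lambda>z. lam_tilde_int N k lg z t) has_field_derivative lam_tilde N k z t) (at z)"
  unfolding lam_tilde_int_def lam_tilde_def by (rule lam_int_has_derivative) (use assms in blast)+

text \<open>
  Multi-indices \<open>(\<alpha>\<^sub>1, \<dots>, \<alpha>\<^sub>k\<^sub>-\<^sub>1)\<close>, \<open>k = k 0\<close>. The set is finite and its elements satisfy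
  \<open>|\<alpha>| \<ge> 2\<close>, since each weight \<open>k 0 + 1 - i\<close> lies between \<open>2\<close> and \<open>k 0\<close>;
  so \<open>|\<alpha>| - 2\<close> is not truncated below.
\<close>

definition multi_indices :: "(nat \<Rightarrow> nat) \<Rightarrow> (nat \<Rightarrow> nat) set" where
  "multi_indices k = {\<alpha> \<in> {1..k 0 - 1} \<rightarrow>\<^sub>E UNIV. (\<Sum>i=1..k 0 - 1. (k 0 + 1 - i) * \<alpha> i) = k 0 + 1}"

definition correction :: "(nat \<Rightarrow> nat) \<Rightarrow> point \<Rightarrow> complex" where
  "correction k t = (\<Sum>\<alpha>\<in>multi_indices k.
     fact ((\<Sum>i=1..k 0 - 1. \<alpha> i) - 2) * (\<Prod>i=1..k 0 - 1. t (0, i) ^ \<alpha> i / fact (\<alpha> i)))"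

end

theory Submission
  imports Defs
begin

text \<open>
  Put \<open>w = 1/z\<^sub>i\<close>. Near \<open>v\<^sub>i\<^sub>,\<^sub>0\<close> one has \<open>z = t\<^sub>i\<^sub>,\<^sub>0 + \<psi>\<^sub>i(w) + O(w\<^sup>k\<^sup>+\<^sup>1)\<close> where the coefficients of the polynomial
  \<open>\<psi>\<^sub>i\<close> are the flat coordinates up to the factor \<open>1/k\<^sub>i\<close>, and a change of variables in the residue expresses
  \<open>v\<^sub>i\<^sub>,\<^sub>a\<close> by the coefficient of \<open>w\<^sup>k\<close> in \<open>\<psi>\<^sub>i\<^sup>a\<close>, \<open>k = k\<^sub>i\<close>; similarly at \<open>\<infinity>\<close>. So the parameters are explicit
  polynomials in \<open>t\<close>, the derivatives \<open>\<partial>\<lambda>/\<partial>t\<^sub>x\<close> are explicit, and their leading parts in the local coordinate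
  \<open>w\<close> are monomials times \<open>d\<lambda>/dz\<close>.

  With \<open>\<partial>\<lambda>/\<partial>t\<^sub>N\<^sub>+\<^sub>1\<^sub>,\<^sub>1 = 1/(z - t\<^sub>N\<^sub>+\<^sub>1\<^sub>,\<^sub>0)\<close> as one of the three arguments, the three-tensor can be evaluated on the slice
  \<open>t\<^sub>N\<^sub>+\<^sub>1\<^sub>,\<^sub>1 = \<dots> = t\<^sub>N\<^sub>+\<^sub>1\<^sub>,\<^sub>k\<^sub>-\<^sub>1 = 0\<close>, \<open>k = k\<^sub>N\<^sub>+\<^sub>1\<close>, where \<open>\<lambda>\<close> is a function regular at \<open>p = t\<^sub>N\<^sub>+\<^sub>1\<^sub>,\<^sub>0\<close> plus a multiple of
  \<open>(z - p)\<^sup>-\<^sup>k\<close>. There it does not depend on \<open>t\<^sub>N\<^sub>+\<^sub>1\<^sub>,\<^sub>k\<close>, and it equals the second derivatives of the right-hand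
  side along the slice. Hence on the slice over \<open>W\<close>, which is connected, \<open>\<partial>F/\<partial>t\<^sub>N\<^sub>+\<^sub>1\<^sub>,\<^sub>1\<close> and the right-hand side
  differ by an affine function of \<open>t\<close>, and the limit \<open>t\<^sub>N\<^sub>+\<^sub>1\<^sub>,\<^sub>k \<rightarrow> 0\<close> is trivial.
\<close>

text \<open>Truncation is harmless because of one cancellation. Near a pole
  \<open>\<partial>\<lambda>/\<partial>t\<close> has the form \<open>K A + e\<close> and
  \<open>d\<lambda>/dz\<close> the form \<open>- K + e'\<close> with the same singular
  \<open>K\<close> and small errors, so a product of two such derivatives divided by
  \<open>d\<lambda>/dz\<close> is \<open>- K A B\<close> up to terms without residue. Each residue
  is therefore a single coefficient of a product of power series in \<open>w\<close>.

  The shape of the right-hand side has a similar source. With \<open>c = p - t(i,0)\<close>, its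
  derivatives in the coordinates of a pole \<open>i \<le> N\<close> are coefficients of
  \<open>log (c - \<psi>)\<close>. At infinity, where \<open>1/z = q / (1 - \<theta>)\<close>, they
  are coefficients of \<open>- log (1 - \<theta> - p q)\<close>. This splits as
  \<open>- log (1 - \<theta>) - log (1 - p q / (1 - \<theta>))\<close>: the second summand comes
  from the integral of \<open>\<lambda>\<close>, the first from the multinomial sum, which is the
  coefficient of \<open>q ^ (k 0 + 1)\<close> in
  \<open>(1 - \<theta>) log (1 - \<theta>) + \<theta>\<close>.

  Only directions tangent to the slice are ever differentiated, which avoids the terms that have no
  limit at the stratum.\<close>

unbundle fps_syntax and no vec_syntax

section \<open>Laurent series in a local parameter\<close>

text \<open>A bound on \<open>fls_subdegree\<close> would not do: the zero series has subdegree 0,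
  and the error terms below may well be zero.\<close>

definition fls_vanishes_below :: "int \<Rightarrow> 'a::zero fls \<Rightarrow> bool" where
  "fls_vanishes_below n f \<longleftrightarrow> (\<forall>j<n. f $$ j = 0)"

lemma fls_vanishes_below_iff: "fls_vanishes_below n f \<longleftrightarrow> f = 0 \<or> n \<le> fls_subdegree f"
  unfolding fls_vanishes_below_def
  by (metis fls_eq0_below_subdegree fls_subdegree_geI fls_zero_nth order_less_le_trans)

lemma fls_vanishes_below_mono: "fls_vanishes_below n f \<Longrightarrow> m \<le> n \<Longrightarrow> fls_vanishes_below m f"
  by (auto simp: fls_vanishes_below_def)

lemma fls_vanishes_below_0 [simp]: "fls_vanishes_below n 0"
  by (simp add: fls_vanishes_below_def)

lemma fls_vanishes_below_add: "fls_vanishes_below n f \<Longrightarrow> fls_vanishes_below n g \<Longrightarrow> fls_vanishes_below n (f + g)"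
  for f g :: "'a::monoid_add fls"
  by (auto simp: fls_vanishes_below_def)

lemma fls_vanishes_below_sum:
  "(\<And>i. i \<in> I \<Longrightarrow> fls_vanishes_below n (f i)) \<Longrightarrow> fls_vanishes_below n (\<Sum>i\<in>I. f i)"
  for f :: "'i \<Rightarrow> 'a::comm_monoid_add fls"
  by (auto simp: fls_vanishes_below_def fls_nth_sum)

lemma fls_vanishes_below_mult:
  fixes f g :: "'a::field fls"
  shows "fls_vanishes_below m f \<Longrightarrow> fls_vanishes_below n g \<Longrightarrow> fls_vanishes_below (m + n) (f * g)"
  by (cases "f = 0 \<or> g = 0") (auto simp: fls_vanishes_below_iff)

lemma fls_vanishes_below_mult_le:
  fixes f g :: "'a::field fls"
  shows "fls_vanishes_below m f \<Longrightarrow> fls_vanishes_below n g \<Longrightarrow> l \<le> m + n \<Longrightarrow> fls_vanishes_below l (f * g)"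
  using fls_vanishes_below_mult fls_vanishes_below_mono by blast

lemma fls_vanishes_below_fps [simp]: "n \<le> 0 \<Longrightarrow> fls_vanishes_below n (fps_to_fls f)"
  by (simp add: fls_vanishes_below_def)

lemma fls_vanishes_below_residue: "fls_vanishes_below 0 f \<Longrightarrow> fls_residue f = 0"
  by (simp add: fls_vanishes_below_def)

lemma fls_vanishes_below_deriv:
  assumes "fls_vanishes_below n f" shows "fls_vanishes_below (n - 1) (fls_deriv f)"
  using assms by (auto simp: fls_vanishes_below_def)

text \<open>No order is lost at 0, since differentiation kills the constant term and a derivative
  never has a coefficient at -1.\<close>

lemma fls_vanishes_below_deriv_0:
  assumes "fls_vanishes_below 0 f" shows "fls_vanishes_below 0 (fls_deriv f)"
  unfolding fls_vanishes_below_def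
proof (intro allI impI)
  fix j :: int assume "j < 0"
  then have "j + 1 < 0 \<or> j + 1 = 0" by linarith
  then show "fls_deriv f $$ j = 0"
    using assms by (metis fls_deriv_nth fls_vanishes_below_def mult_zero_left mult_zero_right of_int_0)
qed

text \<open>Formal change of variables \<open>w = \<phi>(u)\<close> in a residue.\<close>

lemma fls_residue_compose:
  fixes \<phi> G :: "complex fps"
  assumes "\<phi> $ 0 = 0" "\<phi> $ 1 \<noteq> 0"
  shows "fls_residue (fps_to_fls ((G oo \<phi>) * fps_deriv \<phi>) / fps_to_fls \<phi> ^ Suc n) = G $ n"
proof -
  let ?F = "fps_to_fls \<phi>"
  have F0: "?F \<noteq> 0" using assms by auto
  have sd: "subdegree \<phi> = 1"
    using assms by (intro subdegreeI) auto
  have sdF: "fls_subdegree ?F = 1" by (simp add: fls_subdegree_fls_to_fps sd)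
  \<comment> \<open>For \<open>j = 0\<close> this is a logarithmic derivative, whose residue is the
    order of the zero of \<open>\<phi>\<close>; for \<open>j > 0\<close> it is a multiple of the
    derivative of \<open>\<phi> ^ (- j)\<close>, which has no residue.\<close>
  have pw: "fls_residue (fps_to_fls (fps_deriv \<phi>) / ?F ^ Suc j) = (if j = 0 then 1 else 0)" for j
  proof (cases j)
    case 0
    then show ?thesis
      using fls_residue_deriv_times_inverse_eq_subdegree(1)[of ?F] sdF F0
      by (simp add: fls_deriv_fps_to_fls[symmetric] field_simps)
  next
    case (Suc m)
    define I where "I = inverse ?F"
    have eq: "fps_to_fls (fps_deriv \<phi>) / ?F ^ Suc j = fls_deriv ?F * I ^ (m + 2)"
      using Suc by (simp only: I_def divide_inverse power_inverse fls_deriv_fps_to_fls) simp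
    have "fls_deriv (I ^ Suc m) = of_nat (Suc m) * I ^ m * fls_deriv I"
      by (subst fls_deriv_power) (simp del: of_nat_Suc add: mult_ac)
    also have "fls_deriv I = - fls_deriv ?F * I ^ 2"
      unfolding I_def by (rule fls_inverse_deriv)
    finally have "fls_deriv (I ^ Suc m) = fls_const (- of_nat (Suc m)) * (fls_deriv ?F * I ^ (m + 2))"
      by (simp only: fls_of_nat power_add mult_minus_left mult_minus_right fls_const_uminus mult_ac)
    then have "fls_residue (fls_deriv (I ^ Suc m)) = - of_nat (Suc m) * fls_residue (fls_deriv ?F * I ^ (m + 2))"
      by (simp only: fls_residue_fls_const_times)
    then have "fls_residue (fls_deriv ?F * I ^ (m + 2)) = 0"
      unfolding fls_residue_deriv using of_nat_neq_0[of m, where 'a=complex] by (simp del: of_nat_Suc fls_residue_def)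
    then show ?thesis unfolding eq using Suc by simp
  qed
  \<comment> \<open>Cutting \<open>G\<close> at degree \<open>n\<close> leaves finitely many terms
    covered by \<open>pw\<close> and a remainder whose factor \<open>\<phi> ^ Suc n\<close> cancels
    the whole pole.\<close>
  have G: "G = (\<Sum>i\<le>n. fps_const (G $ i) * fps_X ^ i) + fps_X ^ Suc n * fps_shift (Suc n) G"
  proof (rule fps_ext)
    fix m
    show "G $ m = ((\<Sum>i\<le>n. fps_const (G $ i) * fps_X ^ i) + fps_X ^ Suc n * fps_shift (Suc n) G) $ m"
    proof (cases "m \<le> n")
      case True
      then show ?thesis
        by (simp add: fps_sum_nth fps_X_power_mult_nth if_distrib sum.delta cong: if_cong del: power_Suc)
    next
      case False
      have "(\<Sum>i\<le>n. if m = i then G $ i else 0) = 0"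
        using False by (intro sum.neutral) auto
      with False show ?thesis
        by (simp add: fps_sum_nth fps_X_power_mult_nth if_distrib cong: if_cong del: power_Suc)
    qed
  qed
  have "G oo \<phi> = (\<Sum>i\<le>n. fps_const (G $ i) * \<phi> ^ i) + \<phi> ^ Suc n * (fps_shift (Suc n) G oo \<phi>)"
    by (subst G) (simp add: fps_compose_add_distrib fps_compose_sum_distrib fps_compose_mult_distrib assms
        fps_compose_power[symmetric] del: power_Suc)
  then have "fps_to_fls ((G oo \<phi>) * fps_deriv \<phi>) / ?F ^ Suc n
      = (\<Sum>i\<le>n. fls_const (G $ i) * (fps_to_fls (fps_deriv \<phi>) / ?F ^ Suc (n - i)))
        + fps_to_fls ((fps_shift (Suc n) G oo \<phi>) * fps_deriv \<phi>)"
    (is "_ = ?A + ?B")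
  proof -
    assume *: "G oo \<phi> = (\<Sum>i\<le>n. fps_const (G $ i) * \<phi> ^ i) + \<phi> ^ Suc n * (fps_shift (Suc n) G oo \<phi>)"
    have sumfls: "fps_to_fls (\<Sum>i\<in>I. f i) = (\<Sum>i\<in>I. fps_to_fls (f i))" for I and f :: "nat \<Rightarrow> complex fps"
      by (induction I rule: infinite_finite_induct) auto
    let ?c = "\<lambda>i. fls_const (G $ i)" and ?D = "fps_to_fls (fps_deriv \<phi>)"
      and ?H = "fps_to_fls (fps_shift (Suc n) G oo \<phi>)"
    have 1: "?c i * ?F ^ i * ?D / ?F ^ Suc n = ?c i * (?D / ?F ^ Suc (n - i))" if "i \<le> n" for i
    proof -
      have "?F ^ Suc n = ?F ^ i * ?F ^ Suc (n - i)"
        using that by (simp add: power_add[symmetric] del: power_Suc)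
      then have "?c i * ?F ^ i * ?D / ?F ^ Suc n = (?F ^ i * (?c i * ?D)) / (?F ^ i * ?F ^ Suc (n - i))"
        by (simp only: mult_ac)
      also have "\<dots> = (?c i * ?D) / ?F ^ Suc (n - i)"
        using F0 by (intro mult_divide_mult_cancel_left) simp
      finally show ?thesis by (simp only: times_divide_eq_right)
    qed
    have "fps_to_fls ((G oo \<phi>) * fps_deriv \<phi>) = (\<Sum>i\<le>n. ?c i * ?F ^ i * ?D) + ?F ^ Suc n * (?H * ?D)"
      unfolding * by (simp only: distrib_right fps_to_fls_plus fls_times_fps_to_fls fps_to_fls_power sumfls
          sum_distrib_right fps_const_to_fls mult.assoc)
    moreover have "(?F ^ Suc n * (?H * ?D)) / ?F ^ Suc n = ?H * ?D" using F0 by (simp del: power_Suc)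
    ultimately have "fps_to_fls ((G oo \<phi>) * fps_deriv \<phi>) / ?F ^ Suc n
        = (\<Sum>i\<le>n. ?c i * ?F ^ i * ?D / ?F ^ Suc n) + ?H * ?D"
      by (simp only: add_divide_distrib sum_divide_distrib)
    also have "(\<Sum>i\<le>n. ?c i * ?F ^ i * ?D / ?F ^ Suc n) = (\<Sum>i\<le>n. ?c i * (?D / ?F ^ Suc (n - i)))"
      by (intro sum.cong refl 1) simp
    finally show ?thesis by (simp only: fls_times_fps_to_fls)
  qed
  then have "fls_residue (fps_to_fls ((G oo \<phi>) * fps_deriv \<phi>) / ?F ^ Suc n)
     = (\<Sum>i\<le>n. G $ i * fls_residue (fps_to_fls (fps_deriv \<phi>) / ?F ^ Suc (n - i))) + fls_residue ?B"
    by (simp add: fls_nth_sum del: power_Suc times_divide_eq_right)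
  also have "\<dots> = (\<Sum>i\<le>n. G $ i * (if n - i = 0 then 1 else 0))"
    unfolding pw by simp
  also have "\<dots> = (\<Sum>i\<le>n. if i = n then G $ i else 0)"
    by (intro sum.cong) auto
  also have "\<dots> = G $ n" by simp
  finally show ?thesis .
qed

text \<open>Think of \<open>w = \<phi>(u)\<close> as a new coordinate near \<open>u = 0\<close> and
  of \<open>u = \<psi>(w)\<close> as its inverse: composing with \<open>\<phi>\<close> rewrites a
  series in \<open>w\<close> as a series in \<open>u\<close>.\<close>

locale local_parameter =
  fixes \<phi> \<psi> :: "complex fps"
  assumes phi0: "\<phi> $ 0 = 0" and phi1: "\<phi> $ 1 \<noteq> 0" and psi0: "\<psi> $ 0 = 0"
    and psi_phi: "\<psi> oo \<phi> = fps_X"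
begin



lemma psi1_phi1: "\<psi> $ 1 * \<phi> $ 1 = 1"
proof -
  have "(\<psi> oo \<phi>) $ 1 = (fps_X :: complex fps) $ 1" by (simp only: psi_phi)
  then show ?thesis by (simp add: fps_compose_nth phi0 psi0)
qed

lemma psi1: "\<psi> $ 1 \<noteq> 0" using psi1_phi1 by auto

lemma psi_pow: "\<psi> ^ n oo \<phi> = fps_X ^ n"
  by (simp add: fps_compose_power[OF phi0, symmetric] psi_phi)

lemma deriv_psi: "(fps_deriv \<psi> oo \<phi>) * fps_deriv \<phi> = 1"
  using fps_compose_deriv[OF phi0, of \<psi>] by (simp add: psi_phi)

lemma phi_nz: "fps_to_fls \<phi> \<noteq> 0" using phi1 by auto

lemma compose_mult: "(F * G) oo \<phi> = (F oo \<phi>) * (G oo \<phi>)"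
  by (rule fps_compose_mult_distrib[OF phi0])

lemma subdeg: "fls_subdegree (fps_to_fls \<phi>) = 1"
proof -
  have "subdegree \<phi> = 1" using phi0 phi1 by (intro subdegreeI) auto
  then show ?thesis by (simp add: fls_subdegree_fls_to_fps)
qed

text \<open>Multiplying by \<open>u ^ (a - 1)\<close> moves the coefficient of
  \<open>u ^ (- a)\<close> into the residue, and in the coordinate \<open>w\<close> this factor is
  \<open>\<psi> ^ (a - 1)\<close>.\<close>

lemma prpart_coeff:
  assumes "a \<ge> 1"
  shows "(fps_to_fls ((G oo \<phi>) * fps_deriv \<phi>) / fps_to_fls \<phi> ^ Suc n) $$ (- int a) = (\<psi> ^ (a - 1) * G) $ n"
proof -
  have "(\<psi> ^ (a - 1) * G) $ n
     = fls_residue (fps_to_fls (((\<psi> ^ (a - 1) * G) oo \<phi>) * fps_deriv \<phi>) / fps_to_fls \<phi> ^ Suc n)"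
    using fls_residue_compose[OF phi0 phi1] by simp
  also have "fps_to_fls (((\<psi> ^ (a - 1) * G) oo \<phi>) * fps_deriv \<phi>) / fps_to_fls \<phi> ^ Suc n
     = fls_X ^ (a - 1) * (fps_to_fls ((G oo \<phi>) * fps_deriv \<phi>) / fps_to_fls \<phi> ^ Suc n)"
    by (simp only: compose_mult psi_pow fls_times_fps_to_fls fps_to_fls_power fps_X_to_fls times_divide_eq_right mult.assoc)
  finally show ?thesis
    using assms by (simp add: fls_X_power_times_conv_shift(1) of_nat_diff del: power_Suc times_divide_eq_right)
qed

text \<open>Lagrange inversion in residue form. The coefficient is the residue of
  \<open>u ^ (a - 1) w ^ (- k) du\<close>; under \<open>u = \<psi>(w)\<close> the form
  \<open>u ^ (a - 1) du\<close> is \<open>d(\<psi> ^ a) / a\<close>, and differentiation brings down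
  the factor \<open>k\<close>.\<close>

lemma pole_coeff:
  assumes "a \<ge> 1" "k \<ge> 1"
  shows "inverse (fps_to_fls \<phi> ^ k) $$ (- int a) = of_nat k / of_nat a * (\<psi> ^ a) $ k"
proof -
  obtain k' where k: "k = Suc k'" using assms by (cases k) auto
  obtain b where a: "a = Suc b" using assms by (cases a) auto
  have "inverse (fps_to_fls \<phi> ^ k) $$ (- int a) = (\<psi> ^ (a - 1) * fps_deriv \<psi>) $ k'"
    using prpart_coeff[OF assms(1), of "fps_deriv \<psi>" k'] by (simp add: deriv_psi k divide_inverse)
  also have "\<dots> = (fps_const (1 / of_nat a) * fps_deriv (\<psi> ^ a)) $ k'"
  proof -
    have "fps_const (1 / of_nat a) * fps_deriv (\<psi> ^ a) = \<psi> ^ (a - 1) * fps_deriv \<psi>"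
    proof -
      have "fps_deriv (\<psi> ^ a) = fps_const (of_nat a) * (\<psi> ^ (a - 1) * fps_deriv \<psi>)"
        by (subst fps_deriv_power) (simp add: mult_ac fps_of_nat)
      then show ?thesis
        using a by (simp add: mult.assoc[symmetric] fps_const_mult del: of_nat_Suc)
    qed
    then show ?thesis by simp
  qed
  also have "\<dots> = of_nat k / of_nat a * (\<psi> ^ a) $ k" by (simp add: k)
  finally show ?thesis .
qed

lemma residue_inverse_power:
  assumes "m \<ge> 1"
  shows "fls_residue (inverse (fps_to_fls \<phi>) ^ m) = of_nat m * \<psi> $ m"
  unfolding power_inverse fls_residue_def using pole_coeff[of 1 m] assms by simp

end

lemma local_parameter_of_psi:
  assumes "\<psi> $ 0 = 0" "\<psi> $ 1 \<noteq> 0" shows "local_parameter (fps_inv \<psi>) \<psi>"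
proof
  show "\<psi> oo fps_inv \<psi> = fps_X" by (rule fps_inv_right[OF assms])
  show "fps_inv \<psi> $ 0 = 0" by (simp add: fps_inv_def)
  show "fps_inv \<psi> $ 1 \<noteq> 0" using assms by (simp add: fps_inv_def)
qed (use assms in auto)

lemma local_parameter_of_phi:
  assumes "\<phi> $ 0 = 0" "\<phi> $ 1 \<noteq> 0" shows "local_parameter \<phi> (fps_inv \<phi>)"
proof
  show "fps_inv \<phi> oo \<phi> = fps_X" by (rule fps_inv[OF assms])
  show "fps_inv \<phi> $ 0 = 0" by (simp add: fps_inv_def)
qed (use assms in auto)

text \<open>The quotient \<open>r = Z / M\<close> starts with 1, so in
  \<open>r ^ k - 1 = (r - 1) (1 + r + ... + r ^ (k - 1))\<close> the last factor has constant term
  \<open>k\<close>, a unit. Hence \<open>r - 1\<close> is as small as \<open>r ^ k - 1\<close>. The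
  common leading coefficient is what excludes the other \<open>k\<close>-th roots.\<close>

lemma fls_root_close:
  fixes Z M :: "complex fls"
  assumes k: "k \<ge> 1" and lead: "fls_subdegree Z = fls_subdegree M" "Z $$ fls_subdegree M = M $$ fls_subdegree M"
    and M: "M \<noteq> 0"
    and close: "fls_vanishes_below (n + int k * fls_subdegree M) (Z ^ k - M ^ k)"
  shows "fls_vanishes_below (n + int m * fls_subdegree M) (Z ^ m - M ^ m)"
proof -
  define r where "r = Z / M"
  let ?d = "fls_subdegree M"
  have Zr: "Z = r * M" using M by (simp add: r_def)
  have Z0: "Z \<noteq> 0" using lead M by (metis fls_zero_nth nth_fls_subdegree_nonzero)
  have r0: "r \<noteq> 0" using M Z0 by (auto simp: r_def)
  have sr: "fls_subdegree r = 0" using lead Zr r0 M by simp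
  have r1: "r $$ 0 = 1"
  proof -
    have "(r * M) $$ (fls_subdegree r + ?d) = r $$ fls_subdegree r * M $$ ?d" by (rule fls_times_base)
    then show ?thesis using lead M Zr sr by simp
  qed
  define s where "s = fls_regpart r"
  have rs: "r = fps_to_fls s" using sr by (simp add: s_def)
  have s0: "s $ 0 = 1" using r1 by (simp add: s_def)
  have one: "fls_vanishes_below n (r ^ k - 1)"
  proof -
    have "Z ^ k - M ^ k = (r ^ k - 1) * M ^ k" by (simp add: Zr power_mult_distrib algebra_simps)
    then show ?thesis using close M
      by (cases "r ^ k = 1") (auto simp: fls_vanishes_below_iff fls_subdegree_pow)
  qed
  have geo: "r ^ j - 1 = (r - 1) * fps_to_fls (\<Sum>i<j. s ^ i)" for j
  proof -
    have "fps_to_fls (s ^ j - 1) = fps_to_fls ((s - 1) * (\<Sum>i<j. s ^ i))"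
      by (simp only: power_diff_1_eq)
    then show ?thesis by (simp only: rs fps_to_fls_minus fps_to_fls_power fps_one_to_fls fls_times_fps_to_fls)
  qed
  have "(\<Sum>i<k. s ^ i) $ 0 = of_nat k" by (simp add: fps_sum_nth fps_nth_power_0 s0)
  then have "(\<Sum>i<k. s ^ i) $ 0 \<noteq> 0" using k by simp
  then have u: "fls_subdegree (fps_to_fls (\<Sum>i<k. s ^ i)) = 0" "fps_to_fls (\<Sum>i<k. s ^ i) \<noteq> 0"
    by (auto simp: fls_subdegree_fls_to_fps)
  have r1n: "fls_vanishes_below n (r - 1)"
    using one u unfolding geo by (cases "r = 1") (auto simp: fls_vanishes_below_iff)
  have "fls_vanishes_below n (r ^ m - 1)"
    using fls_vanishes_below_mult[OF r1n fls_vanishes_below_fps[of 0]] by (simp add: geo)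
  moreover have "fls_vanishes_below (int m * ?d) (M ^ m)" using M by (simp add: fls_vanishes_below_iff fls_subdegree_pow)
  ultimately have "fls_vanishes_below (n + int m * ?d) ((r ^ m - 1) * M ^ m)" by (rule fls_vanishes_below_mult)
  then show ?thesis by (simp only: Zr power_mult_distrib left_diff_distrib mult_1_left)
qed

section \<open>Power series that agree up to a given degree\<close>

definition fps_agree :: "nat \<Rightarrow> complex fps \<Rightarrow> complex fps \<Rightarrow> bool" where
  "fps_agree n f g \<longleftrightarrow> (\<forall>m\<le>n. f $ m = g $ m)"

lemma fps_agreeD: "fps_agree n f g \<Longrightarrow> f $ n = g $ n"
  by (simp add: fps_agree_def)

lemma fps_agree_refl [simp]: "fps_agree n f f"
  by (simp add: fps_agree_def)

lemma fps_agree_add: "fps_agree n f g \<Longrightarrow> fps_agree n f' g' \<Longrightarrow> fps_agree n (f + f') (g + g')"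
  by (simp add: fps_agree_def)

lemma fps_agree_diff: "fps_agree n f g \<Longrightarrow> fps_agree n f' g' \<Longrightarrow> fps_agree n (f - f') (g - g')"
  by (simp add: fps_agree_def)

lemma fps_agree_mult: "fps_agree n f g \<Longrightarrow> fps_agree n f' g' \<Longrightarrow> fps_agree n (f * f') (g * g')"
  by (auto simp: fps_agree_def fps_mult_nth intro!: sum.cong)

lemma fps_agree_power: "fps_agree n f g \<Longrightarrow> fps_agree n (f ^ a) (g ^ a)"
  by (induction a) (auto intro: fps_agree_mult)

lemma fps_agree_X_deriv: "fps_agree n f g \<Longrightarrow> fps_agree n (fps_X * fps_deriv f) (fps_X * fps_deriv g)"
  by (auto simp: fps_agree_def)

lemma fps_agree_inverse:
  assumes "fps_agree n f g" "f $ 0 \<noteq> 0"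
  shows "fps_agree n (inverse f) (inverse g)"
proof -
  have g0: "g $ 0 \<noteq> 0" using assms by (auto simp: fps_agree_def)
  have "fps_agree n (inverse f * (g * inverse g)) (inverse f * (f * inverse g))"
    using assms by (intro fps_agree_mult) (auto simp: fps_agree_def)
  moreover have "g * inverse g = 1" using inverse_mult_eq_1'[OF g0] .
  moreover have "inverse f * (f * inverse g) = inverse g"
    using inverse_mult_eq_1[OF assms(2)] by (simp add: mult.assoc[symmetric])
  ultimately show ?thesis by simp
qed

section \<open>Holomorphic roots, and expansions at poles and at infinity\<close>

lemma analytic_root:
  fixes h :: "complex \<Rightarrow> complex"
  assumes h: "h analytic_on {0}" and \<zeta>: "\<zeta> ^ k = h 0" and k: "k \<ge> 1" and nz: "h 0 \<noteq> 0"
  obtains g where "g analytic_on {0}" "g 0 = \<zeta>" "\<forall>\<^sub>F u in nhds 0. g u ^ k = h u"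
proof
  \<comment> \<open>The quotient \<open>h u / h 0\<close> stays near 1, away from the cut of
    \<open>Ln\<close>; the choice of the root is carried by \<open>\<zeta>\<close> alone.\<close>
  let ?g = "\<lambda>u. \<zeta> * exp (Ln (h u / h 0) / of_nat k)"
  show "?g analytic_on {0}"
    using nz k by (intro analytic_intros h) auto
  show "?g 0 = \<zeta>" using nz by simp
  have "isCont h 0" using h analytic_at_imp_isCont by blast
  then have "h \<midarrow>0\<rightarrow> h 0" by (simp add: isCont_def)
  then have "\<forall>\<^sub>F u in at 0. h u \<noteq> 0" using nz by (rule tendsto_imp_eventually_ne)
  then have "\<forall>\<^sub>F u in nhds 0. h u \<noteq> 0" using nz by (simp add: eventually_nhds_conv_at)
  then show "\<forall>\<^sub>F u in nhds 0. ?g u ^ k = h u"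
  proof eventually_elim
    case (elim u)
    have "?g u ^ k = \<zeta> ^ k * exp (of_nat k * (Ln (h u / h 0) / of_nat k))"
      by (simp only: power_mult_distrib exp_of_nat_mult)
    also have "of_nat k * (Ln (h u / h 0) / of_nat k) = Ln (h u / h 0)" using k by simp
    finally show ?case using \<zeta> elim nz by simp
  qed
qed

lemma has_laurent_expansion_power_inverse:
  "(\<lambda>u. c / u ^ a) has_laurent_expansion fls_const c * fls_X_inv ^ a"
proof -
  have "(\<lambda>u. c * inverse u ^ a) has_laurent_expansion fls_const c * fls_X_inv ^ a"
    by (intro laurent_expansion_intros)
  then show ?thesis by (simp add: divide_inverse power_inverse)
qed

lemma has_laurent_expansion_transform:
  assumes "f has_laurent_expansion F" "\<forall>\<^sub>F u in at 0. f u = g u"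
  shows "g has_laurent_expansion F"
  using assms has_laurent_expansion_cong[OF assms(2) refl] by blast

lemma has_laurent_expansion_pole_part:
  assumes "rest analytic_on {v}"
  obtains F where "(\<lambda>u. (\<Sum>a=1..n. c a / ((v + u) - v) ^ a) + rest (v + u)) has_laurent_expansion F"
    "\<And>a. a \<ge> 1 \<Longrightarrow> F $$ (- int a) = (if a \<le> n then c a else 0)"
proof -
  let ?P = "\<Sum>a=1..n. fls_const (c a) * fls_X_inv ^ a"
  have 1: "(\<lambda>u. \<Sum>a=1..n. c a / u ^ a) has_laurent_expansion ?P"
    by (intro has_laurent_expansion_sum has_laurent_expansion_power_inverse)
  obtain g where "(\<lambda>u. rest (v + u)) has_fps_expansion g"
    using analytic_at_imp_has_fps_expansion[OF assms] by blast
  then have 2: "(\<lambda>u. rest (v + u)) has_laurent_expansion fps_to_fls g"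
    by (rule has_laurent_expansion_fps)
  show ?thesis
  proof
    show "(\<lambda>u. (\<Sum>a=1..n. c a / ((v + u) - v) ^ a) + rest (v + u)) has_laurent_expansion (?P + fps_to_fls g)"
      using has_laurent_expansion_add[OF 1 2] by simp
    show "(?P + fps_to_fls g) $$ (- int a) = (if a \<le> n then c a else 0)" if "a \<ge> 1" for a
    proof -
      have "?P $$ (- int a) = (\<Sum>b=1..n. if b = a then c b else 0)"
        unfolding fls_nth_sum by (rule sum.cong) auto
      also have "\<dots> = (if a \<le> n then c a else 0)" using that by simp
      finally have *: "?P $$ (- int a) = (if a \<le> n then c a else 0)" .
      show ?thesis unfolding fls_plus_nth * using that by simp
    qed
  qed
qed

lemma has_laurent_expansion_polar_at_inf:
  assumes "a \<ge> 1"
  obtains g where "(\<lambda>w. c / (1 / w - v) ^ a) has_laurent_expansion fps_to_fls g" "g $ 0 = 0"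
proof -
  let ?g = "fps_const c * fps_X ^ a * inverse (1 - fps_const v * fps_X) ^ a"
  have e: "(\<lambda>w. 1 - v * w) has_fps_expansion (1 - fps_const v * fps_X)"
    by (intro fps_expansion_intros)
  have "(\<lambda>w. c * w ^ a * inverse (1 - v * w) ^ a) has_fps_expansion ?g"
    by (intro fps_expansion_intros e) simp
  then have "(\<lambda>w. c * w ^ a * inverse (1 - v * w) ^ a) has_laurent_expansion fps_to_fls ?g"
    by (rule has_laurent_expansion_fps)
  moreover have "\<forall>\<^sub>F w in at 0. c * w ^ a * inverse (1 - v * w) ^ a = c / (1 / w - v) ^ a"
  proof -
    have "\<forall>\<^sub>F w in at (0::complex). w \<noteq> 0" by (simp add: eventually_at_filter)
    then show ?thesis
    proof eventually_elim
      case (elim w)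
      have eq: "(1 / w - v) = (1 - v * w) / w" using elim by (simp add: field_simps)
      show ?case
        by (simp only: eq power_divide divide_divide_eq_right) (simp add: divide_inverse power_inverse)
    qed
  qed
  ultimately have "(\<lambda>w. c / (1 / w - v) ^ a) has_laurent_expansion fps_to_fls ?g"
    by (rule has_laurent_expansion_transform)
  moreover have "?g $ 0 = 0" using assms by (simp add: fps_mult_nth_0 fps_nth_power_0)
  ultimately show ?thesis using that by blast
qed

text \<open>The coefficient of \<open>z\<^sup>a\<^sup>-\<^sup>1\<close> is the coefficient of \<open>w\<^sup>1\<^sup>-\<^sup>a\<close> where \<open>w = 1/z\<close>.\<close>

lemma has_laurent_expansion_at_inf:
  assumes rest: "rest has_laurent_expansion R" "fls_vanishes_below 1 R"
  obtains F where "(\<lambda>w. (\<Sum>a=1..n. c a * (1 / w) ^ (a - 1)) + rest w) has_laurent_expansion F"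
    "\<And>a. a \<ge> 1 \<Longrightarrow> F $$ (1 - int a) = (if a \<le> n then c a else 0)"
proof -
  let ?P = "\<Sum>a=1..n. fls_const (c a) * fls_X_inv ^ (a - 1)"
  have "(\<lambda>u. \<Sum>a=1..n. c a / u ^ (a - 1)) has_laurent_expansion ?P"
    by (intro has_laurent_expansion_sum has_laurent_expansion_power_inverse)
  then have 1: "(\<lambda>u. \<Sum>a=1..n. c a * (1 / u) ^ (a - 1)) has_laurent_expansion ?P"
    by (simp add: power_divide)
  show ?thesis
  proof
    show "(\<lambda>w. (\<Sum>a=1..n. c a * (1 / w) ^ (a - 1)) + rest w) has_laurent_expansion (?P + R)"
      using has_laurent_expansion_add[OF 1 rest(1)] by simp
    show "(?P + R) $$ (1 - int a) = (if a \<le> n then c a else 0)" if "a \<ge> 1" for a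
    proof -
      have "?P $$ (1 - int a) = (\<Sum>b=1..n. if b = a then c b else 0)"
        unfolding fls_nth_sum using that by (intro sum.cong) auto
      also have "\<dots> = (if a \<le> n then c a else 0)" using that by simp
      finally have *: "?P $$ (1 - int a) = (if a \<le> n then c a else 0)" .
      have "R $$ (1 - int a) = 0" using rest(2) that by (simp add: fls_vanishes_below_def)
      then show ?thesis unfolding fls_plus_nth * by simp
    qed
  qed
qed

text \<open>Translates the normalisation \<open>z0 z - z = O(1/z)\<close> into a condition on
  coefficients: with a lower order, \<open>f w / w\<close> would have a pole and could not stay
  bounded.\<close>

lemma has_laurent_expansion_bigo_ident:
  assumes "f has_laurent_expansion F" "\<forall>\<^sub>F w in at 0. norm (f w) \<le> c * norm w"
  shows "fls_vanishes_below 1 F"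
proof (rule ccontr)
  assume "\<not> fls_vanishes_below 1 F"
  then have F: "F \<noteq> 0" "fls_subdegree F < 1" by (auto simp: fls_vanishes_below_iff)
  have "(\<lambda>w. f w / w) has_laurent_expansion F / fls_X"
    by (intro laurent_expansion_intros assms)
  moreover have "fls_subdegree (F / fls_X) < 0" using F by (simp add: fls_divide_subdegree)
  ultimately have "filterlim (\<lambda>w. f w / w) at_infinity (at 0)"
    by (rule has_laurent_expansion_imp_filterlim_infinity_0)
  then have "\<forall>\<^sub>F w in at 0. \<bar>c\<bar> + 1 \<le> norm (f w / w)"
    unfolding filterlim_at_infinity[OF order.refl] by (auto dest!: spec[of _ "\<bar>c\<bar> + 1"])
  moreover have "\<forall>\<^sub>F w in at (0::complex). w \<noteq> 0" by (simp add: eventually_at_filter)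
  ultimately have "\<forall>\<^sub>F w in at (0::complex). False"
    using assms(2)
  proof eventually_elim
    case (elim w)
    then have "norm (f w / w) \<le> c" by (simp add: norm_divide field_simps)
    with elim show False by linarith
  qed
  then show False by simp
qed

text \<open>The root tends to infinity with \<open>l\<close>, so its isolated singularity is a pole,
  and comparing orders in \<open>Z ^ k = L\<close> makes this pole simple. Its reciprocal is the
  local parameter \<open>\<phi>\<close>.\<close>

lemma isolated_pole_of_root:
  assumes hol: "z holomorphic_on ball v r - {v}" and r: "r > 0"
    and pw: "\<And>x. x \<in> ball v r - {v} \<Longrightarrow> z x ^ k = l x"
    and l: "(\<lambda>u. l (v + u)) has_laurent_expansion L" "fls_subdegree L = - int k" and k: "k \<ge> 1"
  obtains \<phi> where "\<phi> $ 0 = 0" "\<phi> $ 1 \<noteq> 0" "(\<lambda>u. z (v + u)) has_laurent_expansion inverse (fps_to_fls \<phi>)"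
    "inverse (fps_to_fls \<phi>) ^ k = L"
proof -
  have ev: "\<forall>\<^sub>F x in at v. z x ^ k = l x"
    using eventually_at_in_open[of "ball v r" v] r pw by (auto elim!: eventually_mono)
  have "is_pole l v" using l k by (intro has_laurent_expansion_imp_is_pole[OF l(1)]) auto
  then have lim: "filterlim l at_infinity (at v)" by (simp add: is_pole_def)
  have "filterlim z at_infinity (at v)"
    unfolding filterlim_at_infinity[OF order.refl]
  proof (intro allI impI)
    fix C :: real assume C: "0 < C"
    then have "\<forall>\<^sub>F x in at v. C ^ k \<le> norm (l x)"
      using lim unfolding filterlim_at_infinity[OF order.refl] by (auto dest!: spec[of _ "C ^ k"])
    with ev show "\<forall>\<^sub>F x in at v. C \<le> norm (z x)"
    proof eventually_elim
      case (elim x)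
      then have "C ^ k \<le> norm (z x) ^ k" by (metis norm_power)
      then show ?case using k C by (intro power_le_imp_le_base[of C "k - 1"]) auto
    qed
  qed
  then have pole: "is_pole z v" by (simp add: is_pole_def)
  have iso: "isolated_singularity_at z v"
    using hol r by (intro isolated_singularity_at_holomorphic[of _ "ball v r"]) auto
  define Z where "Z = laurent_expansion z v"
  have Z: "(\<lambda>u. z (v + u)) has_laurent_expansion Z"
    unfolding Z_def using iso pole by (intro not_essential_has_laurent_expansion) (auto simp: not_essential_def)
  have "(\<lambda>u. z (v + u) ^ k) has_laurent_expansion Z ^ k" by (intro laurent_expansion_intros Z)
  moreover have "(\<lambda>u. z (v + u) ^ k) has_laurent_expansion L"
    using l(1) has_laurent_expansion_cong'[OF ev refl refl] by blast
  ultimately have ZL: "Z ^ k = L" using has_laurent_expansion_unique by blast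
  have "int k * fls_subdegree Z = - int k" using l(2) unfolding ZL[symmetric] by (simp add: fls_subdegree_pow)
  then have "int k * (fls_subdegree Z + 1) = 0" by (simp add: distrib_left)
  then have sZ: "fls_subdegree Z = -1" using k by simp
  then have Z0: "Z \<noteq> 0" by auto
  define \<phi> where "\<phi> = fls_regpart (inverse Z)"
  have sI: "fls_subdegree (inverse Z) = 1" using sZ by simp
  then have I: "inverse Z = fps_to_fls \<phi>" unfolding \<phi>_def by simp
  then have ZI: "Z = inverse (fps_to_fls \<phi>)" by (metis inverse_inverse_eq)
  show ?thesis
  proof
    show "\<phi> $ 0 = 0" unfolding \<phi>_def using sI by simp
    have "inverse Z $$ 1 \<noteq> 0" using nth_fls_subdegree_nonzero[of "inverse Z"] sI Z0 by simp
    then show "\<phi> $ 1 \<noteq> 0" unfolding \<phi>_def by simp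
  qed (use Z ZL ZI in auto)
qed

text \<open>After multiplication by \<open>u ^ k\<close> the singularity is removable with a nonzero
  value, so a holomorphic root \<open>g\<close> exists; dividing it by \<open>u\<close> gives the
  root of \<open>l\<close>, whose leading coefficient is the prescribed
  \<open>\<zeta>\<close>.\<close>

lemma root_of_laurent:
  assumes l: "(\<lambda>u. l (v + u)) has_laurent_expansion L" "fls_subdegree L = - int k" and k: "k \<ge> 1"
    and \<zeta>: "\<zeta> ^ k = L $$ (- int k)"
  obtains g G r where "g has_fps_expansion G" "g 0 = \<zeta>" "r > 0" "g holomorphic_on ball 0 r"
    "\<And>u. u \<in> ball 0 r - {0} \<Longrightarrow> (g u / u) ^ k = l (v + u)"
proof -
  define H where "H = fls_regpart (fls_shift (- int k) L)"
  have L0: "L \<noteq> 0" using l k by auto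
  have "fls_subdegree (fls_shift (- int k) L) = 0" using l(2) L0 by simp
  then have H: "fls_shift (- int k) L = fps_to_fls H" unfolding H_def by simp
  have H0: "H $ 0 = L $$ (- int k)" by (simp add: H_def)
  have nz: "H $ 0 \<noteq> 0" unfolding H0 using nth_fls_subdegree_nonzero[OF L0] l(2) by simp
  define h where "h = (\<lambda>u. if u = 0 then H $ 0 else l (v + u) * u powi int k)"
  have "(\<lambda>u. l (v + u) * u powi int k) has_laurent_expansion fps_to_fls H"
    unfolding H[symmetric] by (rule has_laurent_expansion_shift[OF l(1)])
  then have hH: "h has_fps_expansion H"
    unfolding h_def by (rule has_fps_expansion_fps_to_fls)
  have "h analytic_on {0}" using hH by (rule has_fps_expansion_imp_analytic_0)
  moreover have "h 0 = H $ 0" by (simp add: h_def)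
  ultimately obtain g where g: "g analytic_on {0}" "g 0 = \<zeta>" "\<forall>\<^sub>F u in nhds 0. g u ^ k = h u"
    using analytic_root[of h \<zeta> k] \<zeta> H0 k nz by auto
  obtain G where G: "g has_fps_expansion G"
    using analytic_at_imp_has_fps_expansion_0[OF g(1)] by blast
  obtain r1 where r1: "r1 > 0" "g holomorphic_on ball 0 r1"
    using g(1) analytic_at_ball by blast
  obtain r2 where r2: "r2 > 0" "\<And>u. dist u 0 < r2 \<Longrightarrow> g u ^ k = h u"
    using g(3) unfolding eventually_nhds_metric by blast
  show ?thesis
  proof
    show "min r1 r2 > 0" using r1 r2 by simp
    show "g holomorphic_on ball 0 (min r1 r2)" using r1(2) by (rule holomorphic_on_subset) auto
    show "(g u / u) ^ k = l (v + u)" if "u \<in> ball 0 (min r1 r2) - {0}" for u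
      using that r2(2)[of u] by (simp add: h_def power_divide dist_commute)
  qed (use G g in auto)
qed

section \<open>The parameters as functions of the flat coordinates\<close>

text \<open>With \<open>w = 1/z\<^sub>i\<close> the flat coordinates are the coefficients in \<open>z - v\<^sub>i\<^sub>,\<^sub>0 = cpsi k t i (w) + O(w\<^sup>k\<^sup>+\<^sup>1)\<close>.\<close>

definition cpsi :: "(nat \<Rightarrow> nat) \<Rightarrow> point \<Rightarrow> nat \<Rightarrow> complex fps" where
  "cpsi k t i = Abs_fps (\<lambda>m. if m \<in> {1..k i} then t (i, k i + 1 - m) / of_nat (k i) else 0)"

text \<open>By \<open>pole_coeff\<close> this is the coefficient of \<open>u ^ (- a)\<close> in
  \<open>w ^ (- k)\<close> when \<open>u = \<psi>(w)\<close>.\<close>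

definition polar_coeff :: "nat \<Rightarrow> complex fps \<Rightarrow> nat \<Rightarrow> complex" where
  "polar_coeff k \<psi> a = of_nat k / of_nat a * (\<psi> ^ a) $ k"

lemma cpsi_0 [simp]: "cpsi k t i $ 0 = 0"
  by (simp add: cpsi_def)

lemma cpsi_1: "k i \<ge> 1 \<Longrightarrow> cpsi k t i $ 1 = t (i, k i) / of_nat (k i)"
  by (simp add: cpsi_def)

definition lam_rest :: "nat \<Rightarrow> (nat \<Rightarrow> nat) \<Rightarrow> point \<Rightarrow> nat \<Rightarrow> complex \<Rightarrow> complex" where
  "lam_rest N k v i z = z ^ k 0 / of_nat (k 0) + (\<Sum>a=1..k 0 - 1. v (0, a) * z ^ (a - 1))
     + (\<Sum>j\<in>{1..N+1}-{i}. \<Sum>a=1..k j. v (j, a) / (z - v (j, 0)) ^ a)"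

lemma lam_split:
  assumes "i \<in> {1..N+1}"
  shows "lam N k v z = (\<Sum>a=1..k i. v (i, a) / (z - v (i, 0)) ^ a) + lam_rest N k v i z"
proof -
  let ?f = "\<lambda>i. \<Sum>a=1..k i. v (i, a) / (z - v (i, 0)) ^ a"
  have "(\<Sum>i=1..N+1. ?f i) = ?f i + (\<Sum>j\<in>{1..N+1}-{i}. ?f j)"
    using assms by (intro sum.remove) auto
  then show ?thesis unfolding lam_def lam_rest_def by (simp only: ac_simps)
qed

lemma lam_rest_analytic:
  assumes "\<forall>j\<in>{1..N+1}-{i}. z \<noteq> v (j, 0)"
  shows "lam_rest N k v i analytic_on {z}"
  unfolding lam_rest_def[abs_def] using assms by (cases "k 0 = 0") (auto intro!: analytic_intros)

lemma lam_expansion_pole: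
  assumes "i \<in> {1..N+1}" "\<forall>j\<in>{1..N+1}-{i}. v (i, 0) \<noteq> v (j, 0)"
  obtains L where "(\<lambda>u. lam N k v (v (i, 0) + u)) has_laurent_expansion L"
    "\<And>a. a \<ge> 1 \<Longrightarrow> L $$ (- int a) = (if a \<le> k i then v (i, a) else 0)"
proof -
  obtain L where "(\<lambda>u. (\<Sum>a=1..k i. v (i, a) / ((v (i, 0) + u) - v (i, 0)) ^ a) + lam_rest N k v i (v (i, 0) + u)) has_laurent_expansion L"
    "\<And>a. a \<ge> 1 \<Longrightarrow> L $$ (- int a) = (if a \<le> k i then v (i, a) else 0)"
    by (rule has_laurent_expansion_pole_part[where n = "k i" and c = "\<lambda>a. v (i, a)", OF lam_rest_analytic[OF assms(2)]]) blast
  then show ?thesis using that by (simp only: lam_split[OF assms(1)])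
qed

lemma fls_subdegree_of_neg_coeffs:
  assumes "\<And>a. a > k \<Longrightarrow> L $$ (- int a) = 0" "L $$ (- int k) \<noteq> 0"
  shows "fls_subdegree L = - int k"
proof (rule fls_subdegree_eqI[OF assms(2)])
  fix j assume "j < - int k"
  then have "j = - int (nat (- j))" "nat (- j) > k" by auto
  then show "L $$ j = 0" using assms(1) by metis
qed

text \<open>Let \<open>\<psi>\<close> be the exact inverse of \<open>u \<mapsto> 1 / zi\<close>. The
  residue of \<open>zi ^ m\<close> is \<open>m\<close> times the coefficient of
  \<open>\<psi>\<close> at \<open>m\<close>, so the flat coordinates are \<open>k i\<close> times
  the coefficients up to degree \<open>k i\<close>. Beyond this degree \<open>\<psi>\<close> may
  differ from \<open>cpsi k t i\<close>, but the coefficient of degree \<open>k i\<close> in a power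
  cannot see that.\<close>

lemma flat_coords_pole_forward:
  assumes v: "v \<in> hurwitz_space N k" and i: "i \<in> {1..N+1}" and k: "k i \<ge> 1"
    and t1: "t (i, 1) = v (i, 1)" and z: "root_at N k v i zi"
    and t: "\<forall>\<alpha>\<in>{2..k i}. t (i, \<alpha>) = of_nat (k i) / of_nat (k i - \<alpha> + 1)
              * residue (\<lambda>z. zi z ^ (k i - \<alpha> + 1)) (v (i, 0))"
  shows "t (i, k i) \<noteq> 0" "\<And>a. a \<in> {1..k i} \<Longrightarrow> v (i, a) = polar_coeff (k i) (cpsi k t i) a"
proof -
  have dist: "\<forall>j\<in>{1..N+1}-{i}. v (i, 0) \<noteq> v (j, 0)" using v i by (auto simp: hurwitz_space_def)
  obtain L where L: "(\<lambda>u. lam N k v (v (i, 0) + u)) has_laurent_expansion L"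
    "\<And>a. a \<ge> 1 \<Longrightarrow> L $$ (- int a) = (if a \<le> k i then v (i, a) else 0)"
    using lam_expansion_pole[OF i dist] by blast
  have nz: "v (i, k i) \<noteq> 0" using v i by (auto simp: hurwitz_space_def)
  have sL: "fls_subdegree L = - int (k i)"
    using L(2) nz k by (intro fls_subdegree_of_neg_coeffs) auto
  obtain r where r: "r > 0" "zi holomorphic_on (ball (v (i, 0)) r - {v (i, 0)})"
    "\<And>z. z \<in> ball (v (i, 0)) r - {v (i, 0)} \<Longrightarrow> zi z ^ k i = lam N k v z"
    using z unfolding root_at_def by blast
  obtain \<phi> where \<phi>: "\<phi> $ 0 = 0" "\<phi> $ 1 \<noteq> 0"
    and zi: "(\<lambda>u. zi (v (i, 0) + u)) has_laurent_expansion inverse (fps_to_fls \<phi>)"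
    and pw: "inverse (fps_to_fls \<phi>) ^ k i = L"
    by (rule isolated_pole_of_root[OF r(2) r(1) r(3) L(1) sL k])
  define \<psi> where "\<psi> = fps_inv \<phi>"
  interpret local_parameter \<phi> \<psi> unfolding \<psi>_def by (rule local_parameter_of_phi[OF \<phi>])
  have vL: "v (i, a) = polar_coeff (k i) \<psi> a" if "a \<in> {1..k i}" for a
    using that L(2)[of a] pole_coeff[of a "k i"] k unfolding pw[symmetric]
    by (simp add: polar_coeff_def power_inverse)
  have tpsi: "t (i, k i + 1 - m) = of_nat (k i) * \<psi> $ m" if m: "m \<in> {1..k i}" for m
  \<comment> \<open>The top coefficient corresponds to \<open>\<alpha> = 1\<close>, where the flat
    coordinate is \<open>v (i, 1)\<close> itself and not given by a residue.\<close>
  proof (cases "m = k i")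
    case True
    then show ?thesis using vL[of 1] k t1 by (simp add: polar_coeff_def)
  next
    case False
    then have a: "k i + 1 - m \<in> {2..k i}" "k i - (k i + 1 - m) + 1 = m" using m by auto
    have "(\<lambda>u. zi (v (i, 0) + u) ^ m) has_laurent_expansion inverse (fps_to_fls \<phi>) ^ m"
      by (intro laurent_expansion_intros zi)
    then have "residue (\<lambda>z. zi z ^ m) (v (i, 0)) = of_nat m * \<psi> $ m"
      using has_laurent_expansion_residue[of "\<lambda>z. zi z ^ m"] residue_inverse_power[of m] m by simp
    then show ?thesis using t[rule_format, OF a(1)] m unfolding a(2) by simp
  qed
  have agree: "fps_agree (k i) (cpsi k t i) \<psi>"
    unfolding fps_agree_def
  proof (intro allI impI)
    fix m assume "m \<le> k i"
    then show "cpsi k t i $ m = \<psi> $ m"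
      using tpsi[of m] psi0 k by (cases "m = 0") (auto simp: cpsi_def)
  qed
  show "t (i, k i) \<noteq> 0" using tpsi[of 1] k psi1 by simp
  show "v (i, a) = polar_coeff (k i) (cpsi k t i) a" if "a \<in> {1..k i}" for a
    unfolding vL[OF that] polar_coeff_def using fps_agreeD[OF fps_agree_power[OF agree, of a]] by simp
qed

text \<open>Inverting the polynomial \<open>cpsi k t i\<close> gives a series \<open>M\<close> whose
  \<open>k i\<close>-th power has the polar part of \<open>\<lambda>\<close>, but \<open>M\<close>
  itself need not be a root. The true root \<open>Z\<close> satisfies
  \<open>Z ^ k i - M ^ k i\<close> regular, and \<open>fls_root_close\<close> then shows that
  \<open>Z ^ m\<close> and \<open>M ^ m\<close> have the same residue for
  \<open>m < k i\<close>.\<close>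

lemma flat_coords_pole_backward:
  assumes v: "v \<in> hurwitz_space N k" and i: "i \<in> {1..N+1}" and k: "k i \<ge> 1"
    and t: "t (i, k i) \<noteq> 0" and tv: "\<And>a. a \<in> {1..k i} \<Longrightarrow> v (i, a) = polar_coeff (k i) (cpsi k t i) a"
  shows "t (i, 1) = v (i, 1)"
    "\<exists>zi. root_at N k v i zi \<and> (\<forall>\<alpha>\<in>{2..k i}. t (i, \<alpha>) = of_nat (k i) / of_nat (k i - \<alpha> + 1)
              * residue (\<lambda>z. zi z ^ (k i - \<alpha> + 1)) (v (i, 0)))"
proof -
  let ?\<psi> = "cpsi k t i"
  show "t (i, 1) = v (i, 1)" using tv[of 1] k by (simp add: polar_coeff_def cpsi_def)
  have dist: "\<forall>j\<in>{1..N+1}-{i}. v (i, 0) \<noteq> v (j, 0)" using v i by (auto simp: hurwitz_space_def)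
  obtain L where L: "(\<lambda>u. lam N k v (v (i, 0) + u)) has_laurent_expansion L"
    "\<And>a. a \<ge> 1 \<Longrightarrow> L $$ (- int a) = (if a \<le> k i then v (i, a) else 0)"
    using lam_expansion_pole[OF i dist] by blast
  have psi1nz: "?\<psi> $ 1 \<noteq> 0" using t k cpsi_1[of k i t] by simp
  define \<phi> where "\<phi> = fps_inv ?\<psi>"
  interpret local_parameter \<phi> ?\<psi> unfolding \<phi>_def by (rule local_parameter_of_psi[OF cpsi_0 psi1nz])
  define M where "M = inverse (fps_to_fls \<phi>)"
  have M: "M \<noteq> 0" "fls_subdegree M = -1" using phi_nz subdeg by (auto simp: M_def)
  have Mcoeff: "(M ^ k i) $$ (- int a) = polar_coeff (k i) ?\<psi> a" if "a \<ge> 1" for a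
    using pole_coeff[OF that k] by (simp add: M_def power_inverse polar_coeff_def)
  have Mlead: "M $$ -1 = ?\<psi> $ 1"
    using residue_inverse_power[of 1] by (simp add: M_def)
  have Mlow: "(M ^ k i) $$ (- int a) = 0" if "a > k i" for a
    using M that by (simp add: fls_subdegree_pow)
  have eq: "L $$ (- int a) = (M ^ k i) $$ (- int a)" if "a \<ge> 1" for a
    using L(2)[OF that] Mcoeff[OF that] Mlow[of a] tv[of a] that by (cases "a \<le> k i") auto
  have close: "fls_vanishes_below 0 (L - M ^ k i)"
    unfolding fls_vanishes_below_def
  proof (intro allI impI)
    fix j :: int assume "j < 0"
    then have "j = - int (nat (- j))" "nat (- j) \<ge> 1" by auto
    then show "(L - M ^ k i) $$ j = 0" using eq by (metis fls_minus_nth right_minus_eq)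
  qed
  have lead: "L $$ (- int (k i)) = (?\<psi> $ 1) ^ k i"
  proof -
    have "(M ^ k i) $$ (int (k i) * fls_subdegree M) = (M $$ fls_subdegree M) ^ k i"
      by (rule fls_pow_base)
    then show ?thesis using eq[of "k i"] k M Mlead by simp
  qed
  have sL: "fls_subdegree L = - int (k i)"
    using L(2) lead psi1nz k by (intro fls_subdegree_of_neg_coeffs) auto
  \<comment> \<open>Among the \<open>k i\<close> roots the one starting like \<open>M\<close> has to
    be taken; equality of the \<open>k i\<close>-th powers of the leading coefficients would not
    suffice for \<open>fls_root_close\<close>.\<close>
  obtain g G r where g: "g has_fps_expansion G" "g 0 = ?\<psi> $ 1" "r > 0" "g holomorphic_on ball 0 r"
    "\<And>u. u \<in> ball 0 r - {0} \<Longrightarrow> (g u / u) ^ k i = lam N k v (v (i, 0) + u)"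
    using root_of_laurent[OF L(1) sL k, of "?\<psi> $ 1"] lead by metis
  define zi where "zi = (\<lambda>z. g (z - v (i, 0)) / (z - v (i, 0)))"
  have root: "root_at N k v i zi"
    unfolding root_at_def
  proof (intro exI conjI ballI)
    show "0 < r" by fact
    have "(g \<circ> (\<lambda>z. z - v (i, 0))) holomorphic_on ball (v (i, 0)) r"
      by (rule holomorphic_on_compose_gen[OF _ g(4)])
        (auto intro!: holomorphic_intros simp: dist_norm norm_minus_commute)
    then show "zi holomorphic_on ball (v (i, 0)) r - {v (i, 0)}"
      unfolding zi_def o_def by (intro holomorphic_intros) (auto elim: holomorphic_on_subset)
    show "zi z ^ k i = lam N k v z" if "z \<in> ball (v (i, 0)) r - {v (i, 0)}" for z
      using g(5)[of "z - v (i, 0)"] that by (auto simp: zi_def dist_norm norm_minus_commute)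
  qed
  define Z where "Z = fps_to_fls G / fls_X"
  have zZ: "(\<lambda>u. zi (v (i, 0) + u)) has_laurent_expansion Z"
  proof -
    have "(\<lambda>u. g u / u) has_laurent_expansion Z"
      unfolding Z_def by (intro laurent_expansion_intros has_laurent_expansion_fps g(1))
    then show ?thesis by (simp add: zi_def)
  qed
  have G0: "G $ 0 = ?\<psi> $ 1" using has_fps_expansion_imp_0_eq_fps_nth_0[OF g(1)] g(2) by simp
  then have sG: "fls_subdegree (fps_to_fls G) = 0" "G \<noteq> 0" using psi1nz by (auto simp: fls_subdegree_fls_to_fps)
  have Zsub: "fls_subdegree Z = -1" unfolding Z_def using sG by (simp add: fls_divide_subdegree)
  have Zlead: "Z $$ -1 = ?\<psi> $ 1" unfolding Z_def using G0 by simp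
  have Zpow: "Z ^ k i = L"
  proof -
    have "(\<lambda>u. zi (v (i, 0) + u) ^ k i) has_laurent_expansion Z ^ k i"
      by (intro laurent_expansion_intros zZ)
    moreover have "\<forall>\<^sub>F u in at 0. zi (v (i, 0) + u) ^ k i = lam N k v (v (i, 0) + u)"
      using eventually_at_in_open[of "ball 0 r" "0::complex"] g(3,5) by (auto elim!: eventually_mono simp: zi_def)
    ultimately have "(\<lambda>u. lam N k v (v (i, 0) + u)) has_laurent_expansion Z ^ k i"
      by (rule has_laurent_expansion_transform)
    then show ?thesis using L(1) has_laurent_expansion_unique by blast
  qed
  have res: "residue (\<lambda>z. zi z ^ m) (v (i, 0)) = of_nat m * ?\<psi> $ m" if m: "m \<ge> 1" "m < k i" for m
  proof -
    have "fls_vanishes_below (int (k i) + int m * fls_subdegree M) (Z ^ m - M ^ m)"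
    proof (rule fls_root_close[OF k _ _ M(1)])
      show "fls_subdegree Z = fls_subdegree M" by (simp only: Zsub M(2))
      show "Z $$ fls_subdegree M = M $$ fls_subdegree M" by (simp only: M(2) Zlead Mlead)
      show "fls_vanishes_below (int (k i) + int (k i) * fls_subdegree M) (Z ^ k i - M ^ k i)"
        using close unfolding Zpow M(2) by simp
    qed
    then have "fls_residue (Z ^ m - M ^ m) = 0"
      unfolding M(2) using m by (intro fls_vanishes_below_residue) (auto elim: fls_vanishes_below_mono)
    then have "fls_residue (Z ^ m) = of_nat m * ?\<psi> $ m"
      using residue_inverse_power[OF m(1)] by (simp add: M_def)
    moreover have "(\<lambda>u. zi (v (i, 0) + u) ^ m) has_laurent_expansion Z ^ m"
      by (intro laurent_expansion_intros zZ)
    ultimately show ?thesis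
      using has_laurent_expansion_residue[of "\<lambda>z. zi z ^ m"] by simp
  qed
  show "\<exists>zi. root_at N k v i zi \<and> (\<forall>\<alpha>\<in>{2..k i}. t (i, \<alpha>) = of_nat (k i) / of_nat (k i - \<alpha> + 1)
              * residue (\<lambda>z. zi z ^ (k i - \<alpha> + 1)) (v (i, 0)))"
  proof (intro exI conjI ballI)
    fix \<alpha> assume \<alpha>: "\<alpha> \<in> {2..k i}"
    have "of_nat (k i - \<alpha> + 1) \<noteq> (0::complex)" using of_nat_neq_0[of "k i - \<alpha>"] by simp
    then have "of_nat (k i) / of_nat (k i - \<alpha> + 1) * residue (\<lambda>z. zi z ^ (k i - \<alpha> + 1)) (v (i, 0))
       = of_nat (k i) * ?\<psi> $ (k i - \<alpha> + 1)"
      using \<alpha> by (subst res) (auto simp del: of_nat_add of_nat_Suc)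
    also have "\<dots> = t (i, \<alpha>)" using \<alpha> by (auto simp: cpsi_def Suc_diff_le)
    finally show "t (i, \<alpha>) = of_nat (k i) / of_nat (k i - \<alpha> + 1) * residue (\<lambda>z. zi z ^ (k i - \<alpha> + 1)) (v (i, 0))"
      by simp
  qed (rule root)
qed

text \<open>With \<open>q = 1/z\<^sub>0\<close> the flat coordinates are the coefficients in
  \<open>1/z = q / (1 - theta k t (q)) + O(q\<^sup>k\<^sup>+\<^sup>2)\<close>, \<open>k = k 0\<close>.\<close>

definition theta :: "(nat \<Rightarrow> nat) \<Rightarrow> point \<Rightarrow> complex fps" where
  "theta k t = Abs_fps (\<lambda>m. if m \<in> {2..k 0} then t (0, k 0 + 1 - m) else 0)"

definition inf_psi :: "complex fps \<Rightarrow> complex fps" where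
  "inf_psi \<theta> = fps_X * inverse (1 - \<theta>)"

text \<open>The coefficient of \<open>z ^ (a - 1)\<close> in \<open>q ^ (- k) / k\<close>, where
  \<open>1/z = inf_psi \<theta> (q)\<close>. The first factor is the derivative of
  \<open>inf_psi \<theta>\<close> with its denominator \<open>(1 - \<theta>) ^ 2\<close>
  cleared.\<close>

definition inf_coeff :: "nat \<Rightarrow> complex fps \<Rightarrow> nat \<Rightarrow> complex" where
  "inf_coeff k \<theta> a = ((1 - \<theta> + fps_X * fps_deriv \<theta>) * inf_psi \<theta> ^ a) $ Suc k / of_nat k"

lemma theta_0 [simp]: "theta k t $ 0 = 0" and theta_1 [simp]: "theta k t $ Suc 0 = 0"
  by (simp_all add: theta_def)

lemma inf_psi_0 [simp]: "inf_psi \<theta> $ 0 = 0"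
  by (simp add: inf_psi_def)

lemma inf_psi_1: "\<theta> $ 0 = 0 \<Longrightarrow> inf_psi \<theta> $ 1 = 1"
  by (simp add: inf_psi_def)

lemma inf_psi_deriv:
  assumes "\<theta> $ 0 = 0"
  shows "fps_deriv (inf_psi \<theta>) * (1 - \<theta>) ^ 2 = 1 - \<theta> + fps_X * fps_deriv \<theta>"
proof -
  define u w where "u = 1 - \<theta>" and "w = inverse u"
  have uw: "w * u = 1" unfolding w_def by (rule inverse_mult_eq_1) (simp add: u_def assms)
  have "fps_deriv w = - fps_deriv u * w ^ 2"
    unfolding w_def by (rule fps_inverse_deriv) (simp add: u_def assms)
  then have "fps_deriv (inf_psi \<theta>) * u ^ 2 = (w * u) * u + fps_X * fps_deriv \<theta> * (w * u) ^ 2"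
    by (simp add: inf_psi_def u_def[symmetric] w_def[symmetric]) (simp add: u_def algebra_simps power2_eq_square)
  then show ?thesis by (simp only: uw power_one mult_1_left mult_1_right) (simp only: u_def)
qed

text \<open>In \<open>w = 1/z\<close> the form \<open>dz\<close> contributes
  \<open>1 / w ^ 2\<close>. Since \<open>w = q / (1 - \<theta>)\<close>, this equals
  \<open>(1 - \<theta>) ^ 2 / q ^ 2\<close>: the numerator cancels the denominator of
  \<open>inf_psi_deriv\<close>, and the denominator raises the pole by two, hence the index
  \<open>Suc k\<close>.\<close>

lemma inf_residue:
  assumes "local_parameter \<phi> (inf_psi \<theta>)" and \<theta>: "\<theta> $ 0 = 0"
  shows "fls_residue (fps_to_fls (H oo \<phi>) / (fls_X ^ 2 * fps_to_fls \<phi> ^ k))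
           = ((1 - \<theta> + fps_X * fps_deriv \<theta>) * H) $ Suc k"
proof -
  interpret local_parameter \<phi> "inf_psi \<theta>" by fact
  define u w where "u = 1 - \<theta>" and "w = inverse u"
  have uw: "w * u = 1" unfolding w_def by (rule inverse_mult_eq_1) (simp add: u_def \<theta>)
  define U where "U = fps_to_fls (u oo \<phi>)"
  have "(inf_psi \<theta> * u) oo \<phi> = \<phi>"
    using phi0 uw by (simp add: inf_psi_def u_def[symmetric] w_def[symmetric] mult.assoc)
  then have "fps_X * (u oo \<phi>) = \<phi>" by (simp only: compose_mult psi_phi)
  then have F: "fps_to_fls \<phi> = fls_X * U"
    unfolding U_def by (metis fls_times_fps_to_fls fps_X_to_fls)
  have U0: "U \<noteq> 0" using F phi_nz by auto
  have "(1 - \<theta> + fps_X * fps_deriv \<theta>) * H = (u * u * H) * fps_deriv (inf_psi \<theta>)"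
    unfolding inf_psi_deriv[OF \<theta>, symmetric] by (simp add: u_def power2_eq_square mult_ac)
  then have "(((1 - \<theta> + fps_X * fps_deriv \<theta>) * H) oo \<phi>) * fps_deriv \<phi>
     = (u oo \<phi>) * (u oo \<phi>) * (H oo \<phi>) * ((fps_deriv (inf_psi \<theta>) oo \<phi>) * fps_deriv \<phi>)"
    by (simp only: compose_mult mult.assoc)
  then have e1: "fps_to_fls ((((1 - \<theta> + fps_X * fps_deriv \<theta>) * H) oo \<phi>) * fps_deriv \<phi>) = U * U * fps_to_fls (H oo \<phi>)"
    by (simp only: deriv_psi mult_1_right U_def fls_times_fps_to_fls)
  have e2: "fps_to_fls \<phi> ^ Suc (Suc k) = (U * U) * (fls_X ^ 2 * fps_to_fls \<phi> ^ k)"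
    by (simp only: power_Suc F power2_eq_square mult_ac)
  have e3: "(U * U * fps_to_fls (H oo \<phi>)) / ((U * U) * (fls_X ^ 2 * fps_to_fls \<phi> ^ k))
      = fps_to_fls (H oo \<phi>) / (fls_X ^ 2 * fps_to_fls \<phi> ^ k)"
    using U0 by (intro mult_divide_mult_cancel_left) simp
  show ?thesis
    using fls_residue_compose[OF phi0 phi1, of "(1 - \<theta> + fps_X * fps_deriv \<theta>) * H" "Suc k"]
    unfolding e1 e2 e3 .
qed

lemma inf_power_coeff:
  assumes "local_parameter \<phi> (inf_psi \<theta>)" "\<theta> $ 0 = 0" "a \<ge> 1"
  shows "(inverse (fps_to_fls \<phi>) ^ k) $$ (1 - int a) = ((1 - \<theta> + fps_X * fps_deriv \<theta>) * inf_psi \<theta> ^ a) $ Suc k"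
proof -
  interpret local_parameter \<phi> "inf_psi \<theta>" by fact
  have "((1 - \<theta> + fps_X * fps_deriv \<theta>) * inf_psi \<theta> ^ a) $ Suc k
     = fls_residue (fls_X ^ a * (inverse (fls_X ^ 2) * inverse (fps_to_fls \<phi>) ^ k))"
    using inf_residue[OF assms(1,2), of "inf_psi \<theta> ^ a" k]
    by (simp only: psi_pow fps_to_fls_power fps_X_to_fls divide_inverse power_inverse inverse_mult_distrib)
  also have "fls_X ^ a * (inverse (fls_X ^ 2) * inverse (fps_to_fls \<phi>) ^ k)
     = (fls_X ^ a * fls_X_inv ^ 2) * inverse (fps_to_fls \<phi>) ^ k"
    by (simp only: power_inverse[symmetric] fls_inverse_X mult_ac)
  also have "fls_residue \<dots> = (inverse (fps_to_fls \<phi>) ^ k) $$ (1 - int a)"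
    unfolding mult.assoc
    by (simp only: fls_residue_def fls_X_power_times_conv_shift(1) fls_X_inv_power_times_conv_shift(1)
        fls_shift_nth) (rule arg_cong[where f = "fls_nth _"], simp)
  finally show ?thesis by (rule sym)
qed

text \<open>At degree \<open>m + 1\<close> the operator \<open>q d/dq - 1\<close> acts as
  multiplication by \<open>m\<close>; this is the factor divided out in the definition of the flat
  coordinates at infinity.\<close>

lemma inf_coord_residue:
  assumes "local_parameter \<phi> (inf_psi \<theta>)" "\<theta> $ 0 = 0" "m \<ge> 1"
  shows "fls_residue (inverse (fps_to_fls \<phi>) ^ m / fls_X ^ 2) = of_nat m * \<theta> $ Suc m"
proof -
  have "fls_residue (inverse (fps_to_fls \<phi>) ^ m / fls_X ^ 2) = ((1 - \<theta> + fps_X * fps_deriv \<theta>) * 1) $ Suc m"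
    using inf_residue[OF assms(1,2), of 1 m]
    by (simp only: fps_compose_1 fps_one_to_fls divide_inverse power_inverse inverse_mult_distrib mult_1_left mult_1_right mult.commute)
  also have "\<dots> = of_nat m * \<theta> $ Suc m" using assms(3) by (simp add: algebra_simps)
  finally show ?thesis .
qed

lemma lam_expansion_inf:
  assumes k: "k 0 \<ge> 1"
  obtains L where "(\<lambda>w. lam N k v (1 / w)) has_laurent_expansion L"
    "\<And>a. a \<ge> 1 \<Longrightarrow> L $$ (1 - int a) = (if a < k 0 then v (0, a) else if a = k 0 + 1 then 1 / of_nat (k 0) else 0)"
proof -
  \<comment> \<open>Index \<open>a\<close> stands for \<open>z ^ (a - 1)\<close>. The leading term
    sits at \<open>k 0 + 1\<close>, and the value 0 at \<open>k 0\<close> records that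
    \<open>\<lambda>\<close> has no term \<open>z ^ (k 0 - 1)\<close>.\<close>
  define c where "c = (\<lambda>a. if a < k 0 then v (0, a) else if a = k 0 + 1 then 1 / of_nat (k 0) else 0)"
  define rest where "rest = (\<lambda>w. \<Sum>i=1..N+1. \<Sum>a=1..k i. v (i, a) / (1 / w - v (i, 0)) ^ a)"
  have "\<exists>g. (\<lambda>w. v (i, a) / (1 / w - v (i, 0)) ^ a) has_laurent_expansion g \<and> fls_vanishes_below 1 g"
    if "a \<in> {1..k i}" for i a
  proof -
    have a: "a \<ge> 1" using that by simp
    obtain g where g: "(\<lambda>w. v (i, a) / (1 / w - v (i, 0)) ^ a) has_laurent_expansion fps_to_fls g" "g $ 0 = 0"
      by (rule has_laurent_expansion_polar_at_inf[OF a, of "v (i, a)" "v (i, 0)"])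
    then have "fls_vanishes_below 1 (fps_to_fls g)"
      by (auto simp: fls_vanishes_below_def)
    with g show ?thesis by blast
  qed
  note ex = this
  define g where "g = (\<lambda>i a. SOME g. (\<lambda>w. v (i, a) / (1 / w - v (i, 0)) ^ a) has_laurent_expansion g
    \<and> fls_vanishes_below 1 g)"
  have g: "(\<lambda>w. v (i, a) / (1 / w - v (i, 0)) ^ a) has_laurent_expansion g i a"
    "fls_vanishes_below 1 (g i a)" if "a \<in> {1..k i}" for i a
    using someI_ex[OF ex[OF that]] unfolding g_def by blast+
  have R: "rest has_laurent_expansion (\<Sum>i=1..N+1. \<Sum>a=1..k i. g i a)"
    unfolding rest_def by (intro has_laurent_expansion_sum g)
  have R': "fls_vanishes_below 1 (\<Sum>i=1..N+1. \<Sum>a=1..k i. g i a)"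
    by (intro fls_vanishes_below_sum g)
  obtain L where L: "(\<lambda>w. (\<Sum>a=1..k 0 + 1. c a * (1 / w) ^ (a - 1)) + rest w) has_laurent_expansion L"
    "\<And>a. a \<ge> 1 \<Longrightarrow> L $$ (1 - int a) = (if a \<le> k 0 + 1 then c a else 0)"
    by (rule has_laurent_expansion_at_inf[where n = "k 0 + 1" and c = c, OF R R']) blast
  have "lam N k v (1 / w) = (\<Sum>a=1..k 0 + 1. c a * (1 / w) ^ (a - 1)) + rest w" for w
  proof -
    obtain k' where k': "k 0 = Suc k'" using k by (cases "k 0") auto
    have "(\<Sum>a=1..k 0 + 1. c a * (1 / w) ^ (a - 1)) = (\<Sum>a=1..k'. c a * (1 / w) ^ (a - 1)) + (1 / w) ^ k 0 / of_nat (k 0)"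
      by (simp add: k' c_def)
    also have "(\<Sum>a=1..k'. c a * (1 / w) ^ (a - 1)) = (\<Sum>a=1..k 0 - 1. v (0, a) * (1 / w) ^ (a - 1))"
      by (intro sum.cong) (auto simp: k' c_def)
    finally show ?thesis by (simp only: lam_def rest_def ac_simps)
  qed
  then have "(\<lambda>w. lam N k v (1 / w)) has_laurent_expansion L" using L(1) by (simp only:)
  then show ?thesis
    by (rule that) (simp add: L(2), simp add: c_def)
qed

lemma residue_inf_expansion:
  assumes "(\<lambda>w. f (1 / w)) has_laurent_expansion F"
  shows "residue_inf f = - fls_residue (F / fls_X ^ 2)"
proof -
  have "(\<lambda>w. f (1 / w) / w ^ 2) has_laurent_expansion F / fls_X ^ 2"
    by (intro laurent_expansion_intros assms)
  then show ?thesis unfolding residue_inf_def using has_laurent_expansion_residue_0 by metis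
qed

text \<open>The factor \<open>fps_X ^ a\<close> with \<open>a \<ge> 1\<close> lowers the relevant
  degree from \<open>Suc k\<close> to at most \<open>k\<close>.\<close>

lemma inf_coeff_agree:
  assumes "fps_agree k \<theta> \<theta>'" "\<theta> $ 0 = 0" "a \<ge> 1"
  shows "inf_coeff k \<theta> a = inf_coeff k \<theta>' a"
proof -
  let ?f = "\<lambda>\<theta>. (1 - \<theta> + fps_X * fps_deriv \<theta>) * inverse (1 - \<theta>) ^ a"
  have "(1 - \<theta> + fps_X * fps_deriv \<theta>) * inf_psi \<theta> ^ a = fps_X ^ a * ?f \<theta>" for \<theta> :: "complex fps"
    by (simp only: inf_psi_def power_mult_distrib mult_ac)
  moreover have "fps_agree k (?f \<theta>) (?f \<theta>')"
    using assms by (intro fps_agree_mult fps_agree_add fps_agree_diff fps_agree_X_deriv fps_agree_power fps_agree_inverse) auto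
  then have "(?f \<theta>) $ (Suc k - a) = (?f \<theta>') $ (Suc k - a)"
    using assms(3) by (simp add: fps_agree_def)
  ultimately show ?thesis unfolding inf_coeff_def by (simp only: fps_X_power_mult_nth)
qed

text \<open>As \<open>\<theta>\<close> starts in degree 2, everything is \<open>q ^ a\<close> modulo
  higher terms. The two coefficients give the leading term of \<open>q ^ (- k 0)\<close> and its
  missing term in \<open>z ^ (k 0 - 1)\<close>, both of which \<open>\<lambda>\<close> has by
  definition.\<close>

lemma inf_psi_low:
  assumes "\<theta> $ 0 = 0" "\<theta> $ 1 = 0"
  shows "((1 - \<theta> + fps_X * fps_deriv \<theta>) * inf_psi \<theta> ^ a) $ a = 1"
    "((1 - \<theta> + fps_X * fps_deriv \<theta>) * inf_psi \<theta> ^ a) $ Suc a = 0"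
proof -
  let ?f = "\<lambda>\<theta>. (1 - \<theta> + fps_X * fps_deriv \<theta>) * inverse (1 - \<theta>) ^ a"
  have "fps_agree 1 \<theta> 0"
    unfolding fps_agree_def using assms by (auto simp: le_Suc_eq)
  then have "fps_agree 1 (?f \<theta>) (?f 0)"
    using assms by (intro fps_agree_mult fps_agree_add fps_agree_diff fps_agree_X_deriv fps_agree_power fps_agree_inverse) auto
  moreover have "?f (0::complex fps) = 1" by simp
  moreover define f where "f = ?f \<theta>"
  ultimately have f: "f $ 0 = 1" "f $ Suc 0 = 0" by (auto simp: fps_agree_def)
  have e: "(1 - \<theta> + fps_X * fps_deriv \<theta>) * inf_psi \<theta> ^ a = fps_X ^ a * f"
    by (simp only: inf_psi_def power_mult_distrib mult_ac f_def)
  show "((1 - \<theta> + fps_X * fps_deriv \<theta>) * inf_psi \<theta> ^ a) $ a = 1"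
    "((1 - \<theta> + fps_X * fps_deriv \<theta>) * inf_psi \<theta> ^ a) $ Suc a = 0"
    unfolding e by (simp_all add: fps_X_power_mult_nth f)
qed

lemma lam_power_expansion_inf:
  assumes k: "k 0 \<ge> 1"
  obtains L where "(\<lambda>w. of_nat (k 0) * lam N k v (1 / w)) has_laurent_expansion L"
    "\<And>a. a \<ge> 1 \<Longrightarrow> L $$ (1 - int a) = (if a < k 0 then of_nat (k 0) * v (0, a) else if a = k 0 + 1 then 1 else 0)"
    "fls_subdegree L = - int (k 0)"
proof -
  obtain L where L: "(\<lambda>w. lam N k v (1 / w)) has_laurent_expansion L"
    "\<And>a. a \<ge> 1 \<Longrightarrow> L $$ (1 - int a) = (if a < k 0 then v (0, a) else if a = k 0 + 1 then 1 / of_nat (k 0) else 0)"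
    by (rule lam_expansion_inf[where k = k and N = N and v = v, OF k]) blast
  define L' where "L' = fls_const (of_nat (k 0)) * L"
  have c: "L' $$ (1 - int a) = (if a < k 0 then of_nat (k 0) * v (0, a) else if a = k 0 + 1 then 1 else 0)" if "a \<ge> 1" for a
    using L(2)[OF that] k by (simp add: L'_def)
  show ?thesis
  proof (rule that)
    show "(\<lambda>w. of_nat (k 0) * lam N k v (1 / w)) has_laurent_expansion L'"
      unfolding L'_def by (intro laurent_expansion_intros L)
    show "L' $$ (1 - int a) = (if a < k 0 then of_nat (k 0) * v (0, a) else if a = k 0 + 1 then 1 else 0)" if "a \<ge> 1" for a
      by (rule c[OF that])
    show "fls_subdegree L' = - int (k 0)"
      using c[of "k 0 + 1"] c[of "Suc a" for a] by (intro fls_subdegree_of_neg_coeffs) auto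
  qed
qed

text \<open>The exact inverse \<open>\<psi>\<close> of \<open>1 / z0\<close> is written as
  \<open>inf_psi \<theta>\<close>. The normalisation of \<open>z0\<close> kills the coefficients of
  \<open>\<theta>\<close> at 0 and 1, and residues identify the others up to degree
  \<open>k 0\<close> with flat coordinates.\<close>

lemma flat_coords_inf_forward:
  assumes k: "k 0 \<ge> 2" and z0: "root_inf N k v z0"
    and t: "\<forall>\<alpha>\<in>{1..k 0 - 1}. t (0, \<alpha>) = - (1 / of_nat (k 0 - \<alpha>)) * residue_inf (\<lambda>z. z0 z ^ (k 0 - \<alpha>))"
    and a: "a \<in> {1..k 0 - 1}"
  shows "v (0, a) = inf_coeff (k 0) (theta k t) a"
proof -
  have k1: "k 0 \<ge> 1" using k by simp
  obtain L where L: "(\<lambda>w. of_nat (k 0) * lam N k v (1 / w)) has_laurent_expansion L"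
    "\<And>a. a \<ge> 1 \<Longrightarrow> L $$ (1 - int a) = (if a < k 0 then of_nat (k 0) * v (0, a) else if a = k 0 + 1 then 1 else 0)"
    "fls_subdegree L = - int (k 0)"
    by (rule lam_power_expansion_inf[where k = k and N = N and v = v, OF k1]) blast
  obtain r where r: "z0 holomorphic_on {z. norm z > r}"
    "\<And>z. norm z > r \<Longrightarrow> z0 z ^ k 0 = of_nat (k 0) * lam N k v z"
    and O: "(\<lambda>z. z0 z - z) \<in> O[at_infinity](\<lambda>z. 1 / z)"
    using z0 unfolding root_inf_def by blast
  \<comment> \<open>The radius \<open>r\<close> may be zero or negative, so it is replaced by
    \<open>\<bar>r\<bar> + 1\<close> before inversion.\<close>
  define r' where "r' = 1 / (\<bar>r\<bar> + 1)"
  have r': "r' > 0" by (simp add: r'_def add_nonneg_pos)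
  have in_dom: "norm (1 / w) > r" if "w \<in> ball 0 r' - {0}" for w :: complex
  proof -
    have w: "0 < norm w" "norm w < 1 / (\<bar>r\<bar> + 1)" using that by (auto simp: r'_def)
    have "\<bar>r\<bar> + 1 < 1 / norm w" using w by (simp add: field_simps)
    then show ?thesis by (simp add: norm_divide)
  qed
  have hol: "(\<lambda>w. z0 (1 / w)) holomorphic_on ball 0 r' - {0}"
  proof -
    have "(z0 \<circ> (\<lambda>w. 1 / w)) holomorphic_on ball 0 r' - {0}"
      by (rule holomorphic_on_compose_gen[OF _ r(1)]) (use in_dom in \<open>auto intro!: holomorphic_intros\<close>)
    then show ?thesis by (simp add: o_def)
  qed
  have pw: "z0 (1 / w) ^ k 0 = of_nat (k 0) * lam N k v (1 / w)" if "w \<in> ball 0 r' - {0}" for w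
    by (rule r(2)[OF in_dom[OF that]])
  have L1: "(\<lambda>u. of_nat (k 0) * lam N k v (1 / (0 + u))) has_laurent_expansion L" using L(1) by simp
  obtain \<phi> where \<phi>: "\<phi> $ 0 = 0" "\<phi> $ 1 \<noteq> 0"
    and Z0: "(\<lambda>u. z0 (1 / (0 + u))) has_laurent_expansion inverse (fps_to_fls \<phi>)"
    and pwL: "inverse (fps_to_fls \<phi>) ^ k 0 = L"
    by (rule isolated_pole_of_root[OF hol r' pw L1 L(3) k1])
  have Z: "(\<lambda>u. z0 (1 / u)) has_laurent_expansion inverse (fps_to_fls \<phi>)" using Z0 by simp
  define \<psi> where "\<psi> = fps_inv \<phi>"
  interpret local_parameter \<phi> \<psi> unfolding \<psi>_def by (rule local_parameter_of_phi[OF \<phi>])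
  define E where "E = inverse (fps_to_fls \<phi>) - fls_X_inv"
  have E: "fls_vanishes_below 1 E"
  proof -
    have "(\<lambda>w. z0 (1 / w) - inverse w) has_laurent_expansion E"
      unfolding E_def by (intro laurent_expansion_intros Z)
    moreover obtain c where "c > 0" and c: "\<forall>\<^sub>F z in at_infinity. norm (z0 z - z) \<le> c * norm (1 / z)"
      using O by (rule landau_o.bigE)
    have "\<forall>\<^sub>F w in at 0. norm (z0 (1 / w) - inverse w) \<le> c * norm w"
    proof -
      have "filterlim inverse at_infinity (at (0::complex))" by (rule filterlim_inverse_at_infinity)
      from eventually_compose_filterlim[OF c this] show ?thesis by (simp add: inverse_eq_divide)
    qed
    ultimately show ?thesis by (rule has_laurent_expansion_bigo_ident)
  qed
  have psi1: "\<psi> $ 1 = 1"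
  proof -
    have "inverse (fps_to_fls \<phi>) $$ (-1) = 1"
      using E by (auto simp: E_def fls_vanishes_below_def)
    then show ?thesis using residue_inverse_power[of 1] by simp
  qed
  \<comment> \<open>The residue of \<open>\<phi> ^ (- 2)\<close> is twice this coefficient. The
    square of \<open>1/u + E\<close> has no residue because \<open>E\<close> starts in degree
    1.\<close>
  have psi2: "\<psi> $ 2 = 0"
  proof -
    have "inverse (fps_to_fls \<phi>) ^ 2 = fls_X_inv ^ 2 + (2 * (fls_X_inv * E) + E * E)"
      by (simp add: E_def power2_eq_square algebra_simps)
    moreover have "fls_vanishes_below 0 (E * E)" "fls_vanishes_below 0 (fls_X_inv * E)"
      by (rule fls_vanishes_below_mult_le[OF E E]; simp)
        (rule fls_vanishes_below_mult_le[OF _ E, of "-1"]; simp add: fls_vanishes_below_def)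
    ultimately have "fls_residue (inverse (fps_to_fls \<phi>) ^ 2) = 0"
      by (simp add: fls_vanishes_below_def)
    then show ?thesis using residue_inverse_power[of 2] by simp
  qed
  \<comment> \<open>The solution of \<open>inf_psi \<theta> = \<psi>\<close>.\<close>
  define \<theta> where "\<theta> = 1 - inverse (fps_shift 1 \<psi>)"
  have s0: "fps_shift 1 \<psi> $ 0 = 1" using psi1 by simp
  have th: "\<theta> $ 0 = 0" "\<theta> $ 1 = 0"
  proof -
    show "\<theta> $ 0 = 0" using psi1 by (simp add: \<theta>_def)
    have "(inverse (fps_shift 1 \<psi>) * fps_shift 1 \<psi>) $ 1 = (1 :: complex fps) $ 1"
      using inverse_mult_eq_1[of "fps_shift 1 \<psi>"] s0 by simp
    then show "\<theta> $ 1 = 0"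
      using psi1 psi2 by (simp add: \<theta>_def fps_mult_nth numeral_2_eq_2)
  qed
  have psi: "inf_psi \<theta> = \<psi>"
  proof -
    have "inverse (1 - \<theta>) = fps_shift 1 \<psi>" using s0 by (simp add: \<theta>_def)
    then have "inf_psi \<theta> = fps_shift 1 \<psi> * fps_X" by (simp add: inf_psi_def mult.commute)
    also have "\<dots> = \<psi>" using psi0 by (intro fps_ext) auto
    finally show ?thesis .
  qed
  have lp: "local_parameter \<phi> (inf_psi \<theta>)" unfolding psi by unfold_locales
  have tth: "t (0, k 0 - m) = \<theta> $ Suc m" if m: "m \<in> {1..k 0 - 1}" for m
  proof -
    have "(\<lambda>w. z0 (1 / w) ^ m) has_laurent_expansion inverse (fps_to_fls \<phi>) ^ m"
      by (intro laurent_expansion_intros Z)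
    then have "residue_inf (\<lambda>z. z0 z ^ m) = - (of_nat m * \<theta> $ Suc m)"
      using residue_inf_expansion[of "\<lambda>z. z0 z ^ m"] inf_coord_residue[OF lp th(1), of m] m by simp
    moreover have "t (0, k 0 - m) = - (1 / of_nat m) * residue_inf (\<lambda>z. z0 z ^ m)"
    proof -
      have "k 0 - m \<in> {1..k 0 - 1}" "k 0 - (k 0 - m) = m" using m by auto
      then show ?thesis using t by metis
    qed
    ultimately show ?thesis using m by simp
  qed
  have agree: "fps_agree (k 0) \<theta> (theta k t)"
    unfolding fps_agree_def
  proof (intro allI impI)
    fix m assume m: "m \<le> k 0"
    consider "m = 0" | "m = 1" | m' where "m = Suc m'" "m' \<in> {1..k 0 - 1}"
      using m by (cases m; cases "m - 1") auto
    then show "\<theta> $ m = theta k t $ m"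
    proof cases
      case 3
      then show ?thesis using tth[of m'] by (auto simp: theta_def)
    qed (use th in auto)
  qed
  have "of_nat (k 0) * v (0, a) = L $$ (1 - int a)" using L(2)[of a] a by auto
  also have "\<dots> = of_nat (k 0) * inf_coeff (k 0) \<theta> a"
    using inf_power_coeff[OF lp th(1), of a "k 0"] a k unfolding pwL by (simp add: inf_coeff_def)
  also have "inf_coeff (k 0) \<theta> a = inf_coeff (k 0) (theta k t) a"
    using a by (intro inf_coeff_agree[OF agree th(1)]) simp
  finally show ?thesis using k by simp
qed

text \<open>As at the finite poles, the inverse \<open>M\<close> of a polynomial expression is
  compared with the true root \<open>Z\<close>. Since \<open>dz\<close> has a double pole at
  infinity, agreement is needed one order further: \<open>L\<close> and \<open>M ^ k 0\<close> must
  coincide through degree 0 in \<open>1/z\<close>. The coefficients that are not parameters agree by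
  \<open>inf_psi_low\<close>.\<close>

lemma flat_coords_inf_backward:
  assumes k: "k 0 \<ge> 2" and v: "\<And>a. a \<in> {1..k 0 - 1} \<Longrightarrow> v (0, a) = inf_coeff (k 0) (theta k t) a"
  shows "\<exists>z0. root_inf N k v z0 \<and>
    (\<forall>\<alpha>\<in>{1..k 0 - 1}. t (0, \<alpha>) = - (1 / of_nat (k 0 - \<alpha>)) * residue_inf (\<lambda>z. z0 z ^ (k 0 - \<alpha>)))"
proof -
  have k1: "k 0 \<ge> 1" using k by simp
  let ?\<theta> = "theta k t"
  have th: "?\<theta> $ 0 = 0" "?\<theta> $ 1 = 0" by simp_all
  obtain L where L: "(\<lambda>w. of_nat (k 0) * lam N k v (1 / w)) has_laurent_expansion L"
    "\<And>a. a \<ge> 1 \<Longrightarrow> L $$ (1 - int a) = (if a < k 0 then of_nat (k 0) * v (0, a) else if a = k 0 + 1 then 1 else 0)"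
    "fls_subdegree L = - int (k 0)"
    by (rule lam_power_expansion_inf[where k = k and N = N and v = v, OF k1]) blast
  have Llead: "L $$ (- int (k 0)) = 1" using L(2)[of "k 0 + 1"] by simp
  define \<phi> where "\<phi> = fps_inv (inf_psi ?\<theta>)"
  have lp: "local_parameter \<phi> (inf_psi ?\<theta>)"
    unfolding \<phi>_def using inf_psi_1[OF th(1)] by (intro local_parameter_of_psi) auto
  interpret local_parameter \<phi> "inf_psi ?\<theta>" by fact
  define M where "M = inverse (fps_to_fls \<phi>)"
  have M: "M \<noteq> 0" "fls_subdegree M = -1" using phi_nz subdeg by (auto simp: M_def)
  have Mlead: "M $$ -1 = 1"
    using residue_inverse_power[of 1] inf_psi_1[OF th(1)] by (simp add: M_def)
  have Mc: "(M ^ m) $$ (1 - int a) = ((1 - ?\<theta> + fps_X * fps_deriv ?\<theta>) * inf_psi ?\<theta> ^ a) $ Suc m" if "a \<ge> 1" for a m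
    unfolding M_def by (rule inf_power_coeff[OF lp th(1) that])
  have close: "fls_vanishes_below 1 (L - M ^ k 0)"
    unfolding fls_vanishes_below_def
  proof (intro allI impI)
    fix j :: int assume "j < 1"
    then obtain a where a: "j = 1 - int a" "a \<ge> 1"
      using that[of "nat (1 - j)"] by auto
    consider "a < k 0" | "a = k 0" | "a = k 0 + 1" | "a > k 0 + 1" by linarith
    then have "L $$ (1 - int a) = (M ^ k 0) $$ (1 - int a)"
    proof cases
      case 1
      then show ?thesis using L(2)[OF a(2)] Mc[OF a(2)] v[of a] a k by (simp add: inf_coeff_def)
    next
      case 2
      then show ?thesis using L(2)[OF a(2)] Mc[OF a(2)] inf_psi_low(2)[OF th, of a] by simp
    next
      case 3
      then show ?thesis using L(2)[OF a(2)] Mc[OF a(2)] inf_psi_low(1)[OF th, of a] by simp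
    next
      case 4
      then have "(M ^ k 0) $$ (1 - int a) = 0" using M by (intro fls_eq0_below_subdegree) (simp add: fls_subdegree_pow)
      then show ?thesis using L(2)[OF a(2)] 4 by simp
    qed
    then show "(L - M ^ k 0) $$ j = 0" by (simp add: a)
  qed
  have L1: "(\<lambda>u. of_nat (k 0) * lam N k v (1 / (0 + u))) has_laurent_expansion L" using L(1) by simp
  have one: "(1::complex) ^ k 0 = L $$ (- int (k 0))" using Llead by simp
  obtain g G r where g: "g has_fps_expansion G" "g 0 = 1" "r > 0" "g holomorphic_on ball 0 r"
    "\<And>u. u \<in> ball 0 r - {0} \<Longrightarrow> (g u / u) ^ k 0 = of_nat (k 0) * lam N k v (1 / (0 + u))"
    by (rule root_of_laurent[OF L1 L(3) k1 one]) blast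
  define z0 where "z0 = (\<lambda>z. z * g (1 / z))"
  define Z where "Z = fps_to_fls G / fls_X"
  have gZ: "(\<lambda>u. g u / u) has_laurent_expansion Z"
    unfolding Z_def by (intro laurent_expansion_intros has_laurent_expansion_fps g(1))
  have zZ: "(\<lambda>u. z0 (1 / u)) has_laurent_expansion Z"
    using gZ by (simp add: z0_def)
  have G0: "G $ 0 = 1" using has_fps_expansion_imp_0_eq_fps_nth_0[OF g(1)] g(2) by simp
  then have sG: "fls_subdegree (fps_to_fls G) = 0" "G \<noteq> 0" by (auto simp: fls_subdegree_fls_to_fps)
  have Zsub: "fls_subdegree Z = -1" unfolding Z_def using sG by (simp add: fls_divide_subdegree)
  have Zlead: "Z $$ -1 = 1" unfolding Z_def using G0 by simp
  have Zpow: "Z ^ k 0 = L"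
  proof -
    have "(\<lambda>u. (g u / u) ^ k 0) has_laurent_expansion Z ^ k 0"
      by (intro laurent_expansion_intros gZ)
    moreover have "\<forall>\<^sub>F u in at 0. (g u / u) ^ k 0 = of_nat (k 0) * lam N k v (1 / u)"
      using eventually_at_in_open[of "ball 0 r" "0::complex"] g(3,5) by (auto elim!: eventually_mono)
    ultimately have "(\<lambda>w. of_nat (k 0) * lam N k v (1 / w)) has_laurent_expansion Z ^ k 0"
      by (rule has_laurent_expansion_transform)
    then show ?thesis using L(1) has_laurent_expansion_unique by blast
  qed
  have diff: "fls_vanishes_below (int (k 0) + 1 + int m * fls_subdegree M) (Z ^ m - M ^ m)" for m
  proof (rule fls_root_close[OF k1 _ _ M(1)])
    show "fls_subdegree Z = fls_subdegree M" by (simp only: Zsub M(2))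
    show "Z $$ fls_subdegree M = M $$ fls_subdegree M" by (simp only: M(2) Zlead Mlead)
    show "fls_vanishes_below (int (k 0) + 1 + int (k 0) * fls_subdegree M) (Z ^ k 0 - M ^ k 0)"
      using close unfolding Zpow M(2) by simp
  qed
  have E: "fls_vanishes_below 1 (Z - fls_X_inv)"
  proof -
    have "fls_vanishes_below 1 (Z - M)"
      using diff[of 1] k unfolding M(2) by (auto elim: fls_vanishes_below_mono)
    moreover have "fls_vanishes_below 1 (M - fls_X_inv)"
      unfolding fls_vanishes_below_def
    proof (intro allI impI)
      fix j :: int assume "j < 1"
      then consider "j = 0" | "j = -1" | "j < -1" by linarith
      then show "(M - fls_X_inv) $$ j = 0"
      proof cases
        case 1
        then show ?thesis using Mc[of 1 1] inf_psi_low(2)[OF th, of 1] by simp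
      qed (use Mlead M in auto)
    qed
    ultimately have "fls_vanishes_below 1 ((Z - M) + (M - fls_X_inv))" by (rule fls_vanishes_below_add)
    then show ?thesis by simp
  qed
  have root: "root_inf N k v z0"
    unfolding root_inf_def
  proof (intro conjI exI allI impI)
    have in_dom: "1 / z \<in> ball 0 r - {0}" if "norm z > 1 / r" for z :: complex
    proof -
      have "norm z > 0" using that g(3) by (meson divide_pos_pos less_trans zero_less_one)
      then show ?thesis using that g(3) by (simp add: norm_divide field_simps)
    qed
    have "(g \<circ> (\<lambda>z. 1 / z)) holomorphic_on {z. 1 / r < norm z}"
      by (rule holomorphic_on_compose_gen[OF _ g(4)])
        (use in_dom g(3) in \<open>auto intro!: holomorphic_intros\<close>)
    then show "z0 holomorphic_on {z. 1 / r < norm z}"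
      unfolding z0_def o_def by (intro holomorphic_intros)
    show "z0 z ^ k 0 = of_nat (k 0) * lam N k v z" if "1 / r < norm z" for z
      using g(5)[OF in_dom[OF that]] by (simp add: z0_def mult.commute)
    have "(\<lambda>w. (z0 (1 / w) - inverse w) / w) has_laurent_expansion (Z - fls_X_inv) / fls_X"
      by (intro laurent_expansion_intros zZ)
    moreover have "fls_subdegree ((Z - fls_X_inv) / fls_X) \<ge> 0"
      using E by (intro fls_subdegree_ge0I) (auto simp: fls_vanishes_below_def)
    ultimately have "(\<lambda>w. (z0 (1 / w) - inverse w) / w) \<midarrow>0\<rightarrow> ((Z - fls_X_inv) / fls_X) $$ 0" (is "?q \<midarrow>0\<rightarrow> ?l")
      by (rule has_laurent_expansion_imp_tendsto_0)
    from tendstoD[OF this zero_less_one] have "\<forall>\<^sub>F w in at 0. dist (?q w) ?l < 1" .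
    define C where "C = norm ?l + 1"
    have "norm (?q w) \<le> C" if "dist (?q w) ?l < 1" for w
      using that norm_triangle_ineq2[of "?q w" ?l] unfolding C_def dist_norm by linarith
    with \<open>\<forall>\<^sub>F w in at 0. dist (?q w) ?l < 1\<close>
    have C: "\<forall>\<^sub>F w in at 0. norm ((z0 (1 / w) - inverse w) / w) \<le> C"
      by (auto elim!: eventually_mono)
    then obtain d where d: "d > 0" "\<And>w. w \<noteq> 0 \<Longrightarrow> norm w < d \<Longrightarrow> norm ((z0 (1 / w) - inverse w) / w) \<le> C"
      unfolding eventually_at by (auto simp: dist_norm)
    show "(\<lambda>z. z0 z - z) \<in> O[at_infinity](\<lambda>z. 1 / z)"
    proof (rule landau_o.bigI[of "\<bar>C\<bar> + 1"])
      show "\<forall>\<^sub>F z in at_infinity. norm (z0 z - z) \<le> (\<bar>C\<bar> + 1) * norm (1 / z)"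
        unfolding eventually_at_infinity
      proof (intro exI allI impI)
        fix z :: complex assume z: "1 / d + 1 \<le> norm z"
        have z0': "norm z > 0" using z d(1) by (smt (verit) divide_pos_pos)
        have "1 / d < norm z" using z by simp
        then have "norm (1 / z) < d" using d(1) z0' by (simp add: norm_divide field_simps)
        then have "norm ((z0 z - z) / (1 / z)) \<le> C"
          using d(2)[of "1 / z"] z0' by (simp add: inverse_eq_divide)
        then have "norm (z0 z - z) / norm (1 / z) \<le> C" by (simp only: norm_divide)
        moreover have "0 < norm (1 / z)" using z0' by simp
        ultimately have "norm (z0 z - z) \<le> C * norm (1 / z)" by (simp only: pos_divide_le_eq)
        also have "\<dots> \<le> (\<bar>C\<bar> + 1) * norm (1 / z)" by (intro mult_right_mono) auto
        finally show "norm (z0 z - z) \<le> (\<bar>C\<bar> + 1) * norm (1 / z)" .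
      qed
    qed simp
  qed
  have res: "residue_inf (\<lambda>z. z0 z ^ m) = - (of_nat m * ?\<theta> $ Suc m)" if m: "m \<in> {1..k 0 - 1}" for m
  proof -
    have "(Z ^ m - M ^ m) $$ 1 = 0"
      using diff[of m] m unfolding M(2) fls_vanishes_below_def by auto
    then have "fls_residue (Z ^ m / fls_X ^ 2) = fls_residue (M ^ m / fls_X ^ 2)" by simp
    also have "\<dots> = of_nat m * ?\<theta> $ Suc m"
      unfolding M_def using m by (intro inf_coord_residue[OF lp th(1)]) simp
    finally have "fls_residue (Z ^ m / fls_X ^ 2) = of_nat m * ?\<theta> $ Suc m" .
    moreover have "(\<lambda>w. z0 (1 / w) ^ m) has_laurent_expansion Z ^ m"
      by (intro laurent_expansion_intros zZ)
    ultimately show ?thesis using residue_inf_expansion[of "\<lambda>z. z0 z ^ m"] by simp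
  qed
  show ?thesis
  proof (intro exI conjI ballI)
    fix \<alpha> assume \<alpha>: "\<alpha> \<in> {1..k 0 - 1}"
    then have m: "k 0 - \<alpha> \<in> {1..k 0 - 1}" by auto
    have "?\<theta> $ Suc (k 0 - \<alpha>) = t (0, \<alpha>)" using \<alpha> by (auto simp: theta_def)
    then show "t (0, \<alpha>) = - (1 / of_nat (k 0 - \<alpha>)) * residue_inf (\<lambda>z. z0 z ^ (k 0 - \<alpha>))"
      unfolding res[OF m] using m by auto
  qed (rule root)
qed

text \<open>The closed form of \<open>params\<close>. It is defined for every \<open>t\<close>,
  hence also on the stratum, where \<open>params\<close> itself is out of reach and only its limit
  is wanted.\<close>

definition vpar :: "nat \<Rightarrow> (nat \<Rightarrow> nat) \<Rightarrow> point \<Rightarrow> point" where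
  "vpar N k t = (\<lambda>(i, a).
     if i = 0 then if a \<in> {1..k 0 - 1} then inf_coeff (k 0) (theta k t) a else 0
     else if i \<in> {1..N+1} then
       if a = 0 then t (i, 0) else if a \<le> k i then polar_coeff (k i) (cpsi k t i) a else 0
     else 0)"

definition flat_dom :: "nat \<Rightarrow> (nat \<Rightarrow> nat) \<Rightarrow> point set" where
  "flat_dom N k = {t \<in> points N k. (\<forall>i\<in>{1..N+1}. t (i, k i) \<noteq> 0)
     \<and> (\<forall>i\<in>{1..N+1}. \<forall>j\<in>{1..N+1}. i \<noteq> j \<longrightarrow> t (i, 0) \<noteq> t (j, 0))}"

lemma vpar_inf: "a \<in> {1..k 0 - 1} \<Longrightarrow> vpar N k t (0, a) = inf_coeff (k 0) (theta k t) a"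
  by (simp add: vpar_def)

lemma vpar_center: "i \<in> {1..N+1} \<Longrightarrow> vpar N k t (i, 0) = t (i, 0)"
  by (simp add: vpar_def)

lemma vpar_polar: "i \<in> {1..N+1} \<Longrightarrow> a \<in> {1..k i} \<Longrightarrow> vpar N k t (i, a) = polar_coeff (k i) (cpsi k t i) a"
  by (simp add: vpar_def)

lemma vpar_points: "vpar N k t \<in> points N k"
  by (auto simp: points_def vpar_def idx_def)

lemma idxE:
  assumes "x \<in> idx N k"
  obtains (inf) \<gamma> where "x = (0, \<gamma>)" "\<gamma> \<in> {1..k 0 - 1}"
  | (pole) i \<alpha> where "x = (i, \<alpha>)" "i \<in> {1..N+1}" "\<alpha> \<le> k i"
  using assms by (auto simp: idx_def)

lemma finite_idx: "finite (idx N k)"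
proof -
  have "idx N k \<subseteq> Pair 0 ` {1..k 0 - 1} \<union> (\<Union>i\<in>{1..N+1}. Pair i ` {0..k i})"
    by (auto simp: idx_def)
  then show ?thesis by (rule finite_subset) auto
qed

text \<open>Only the linear term of \<open>cpsi\<close> contributes. Thus the condition that
  \<open>v (i, k i)\<close> be nonzero becomes the same condition on
  \<open>t (i, k i)\<close>.\<close>

lemma polar_coeff_top:
  assumes "k i \<ge> 1"
  shows "polar_coeff (k i) (cpsi k t i) (k i) = (t (i, k i) / of_nat (k i)) ^ k i"
  using assms cpsi_1[of k i t] startsby_zero_power_nth_same[of "cpsi k t i" "k i"]
  by (simp add: polar_coeff_def)

locale hurwitz_data =
  fixes N :: nat and k :: "nat \<Rightarrow> nat"
  assumes k0: "k 0 \<ge> 2" and ki: "\<And>i. i \<in> {1..N+1} \<Longrightarrow> k i \<ge> 1"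
begin

text \<open>Different choices of the roots give one \<open>v\<close> several systems of flat
  coordinates, but each \<open>t\<close> determines its \<open>v\<close>. This is what makes the
  description in \<open>params\<close> unique.\<close>

lemma flat_coords_imp:
  assumes "flat_coords N k v t"
  shows "t \<in> flat_dom N k" "v = vpar N k t"
proof -
  have v: "v \<in> hurwitz_space N k" and t: "t \<in> points N k" using assms by (auto simp: flat_coords_def)
  obtain z0 where z0: "root_inf N k v z0"
    "\<forall>\<alpha>\<in>{1..k 0 - 1}. t (0, \<alpha>) = - (1 / of_nat (k 0 - \<alpha>)) * residue_inf (\<lambda>z. z0 z ^ (k 0 - \<alpha>))"
    using assms by (auto simp: flat_coords_def)
  have pole: "t (i, k i) \<noteq> 0" "\<And>a. a \<in> {1..k i} \<Longrightarrow> v (i, a) = polar_coeff (k i) (cpsi k t i) a"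
    "t (i, 0) = v (i, 0)" if i: "i \<in> {1..N+1}" for i
  proof -
    have *: "t (i, 0) = v (i, 0) \<and> t (i, 1) = v (i, 1) \<and>
          (\<exists>zi. root_at N k v i zi \<and>
             (\<forall>\<alpha>\<in>{2..k i}. t (i, \<alpha>) = of_nat (k i) / of_nat (k i - \<alpha> + 1)
                                * residue (\<lambda>z. zi z ^ (k i - \<alpha> + 1)) (v (i, 0))))"
      using assms i unfolding flat_coords_def by blast
    then obtain zi where zi: "root_at N k v i zi"
      "\<forall>\<alpha>\<in>{2..k i}. t (i, \<alpha>) = of_nat (k i) / of_nat (k i - \<alpha> + 1)
                                * residue (\<lambda>z. zi z ^ (k i - \<alpha> + 1)) (v (i, 0))" by blast
    have t1: "t (i, 1) = v (i, 1)" using * by blast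
    show "t (i, k i) \<noteq> 0" "\<And>a. a \<in> {1..k i} \<Longrightarrow> v (i, a) = polar_coeff (k i) (cpsi k t i) a"
      by (rule flat_coords_pole_forward[where N = N and zi = zi, OF v i ki[OF i] t1 zi], assumption?)+
    show "t (i, 0) = v (i, 0)" using * by blast
  qed
  show "t \<in> flat_dom N k"
    using t pole(1,3) v by (auto simp: flat_dom_def hurwitz_space_def)
  show "v = vpar N k t"
  proof
    fix x
    show "v x = vpar N k t x"
    proof (cases "x \<in> idx N k")
      case True
      then show ?thesis
      proof (cases rule: idxE)
        case (inf \<gamma>)
        then show ?thesis using flat_coords_inf_forward[where N = N, OF k0 z0, of \<gamma>] by (simp add: vpar_inf)
      next
        case (pole i \<alpha>)
        then show ?thesis
          using \<open>\<And>i. i \<in> {1..N+1} \<Longrightarrow> t (i, 0) = v (i, 0)\<close> \<open>\<And>i a. i \<in> {1..N+1} \<Longrightarrow> a \<in> {1..k i} \<Longrightarrow> v (i, a) = polar_coeff (k i) (cpsi k t i) a\<close>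
          by (cases "\<alpha> = 0") (simp_all add: vpar_center vpar_polar)
      qed
    next
      case False
      then show ?thesis using v vpar_points[of N k t] by (cases x) (auto simp: hurwitz_space_def points_def)
    qed
  qed
qed

lemma vpar_hurwitz:
  assumes "t \<in> flat_dom N k" shows "vpar N k t \<in> hurwitz_space N k"
proof -
  have "vpar N k t (i, k i) \<noteq> 0" if i: "i \<in> {1..N+1}" for i
    using assms i ki[OF i] by (subst vpar_polar) (auto simp: flat_dom_def polar_coeff_top)
  then show ?thesis using assms by (auto simp: hurwitz_space_def vpar_points vpar_center flat_dom_def)
qed

lemma flat_coords_vpar:
  assumes t: "t \<in> flat_dom N k" shows "flat_coords N k (vpar N k t) t"
proof -
  let ?v = "vpar N k t"
  have v: "?v \<in> hurwitz_space N k" by (rule vpar_hurwitz[OF t])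
  have "t (i, 0) = ?v (i, 0) \<and> t (i, 1) = ?v (i, 1) \<and>
          (\<exists>zi. root_at N k ?v i zi \<and>
             (\<forall>\<alpha>\<in>{2..k i}. t (i, \<alpha>) = of_nat (k i) / of_nat (k i - \<alpha> + 1)
                                * residue (\<lambda>z. zi z ^ (k i - \<alpha> + 1)) (?v (i, 0))))"
    if i: "i \<in> {1..N+1}" for i
  proof -
    have nz: "t (i, k i) \<noteq> 0" using t i by (auto simp: flat_dom_def)
    have tv: "\<And>a. a \<in> {1..k i} \<Longrightarrow> ?v (i, a) = polar_coeff (k i) (cpsi k t i) a" using i by (rule vpar_polar)
    show ?thesis
      using flat_coords_pole_backward[where N = N and k = k and t = t, OF v i ki[OF i] nz tv] vpar_center[OF i, of k t]
      by metis
  qed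
  then show ?thesis
    unfolding flat_coords_def
    using v t flat_coords_inf_backward[of k ?v t N, OF k0 vpar_inf] by (auto simp: flat_dom_def)
qed

lemma flat_domain_eq: "flat_domain N k = flat_dom N k"
proof
  show "flat_domain N k \<subseteq> flat_dom N k" using flat_coords_imp(1) by (auto simp: flat_domain_def)
  show "flat_dom N k \<subseteq> flat_domain N k" using flat_coords_vpar by (auto simp: flat_domain_def)
qed

lemma params_eq: "t \<in> flat_dom N k \<Longrightarrow> params N k t = vpar N k t"
  unfolding params_def by (rule the_equality) (erule flat_coords_vpar, erule flat_coords_imp(2))

text \<open>Openness along coordinate lines, the form in which partial derivatives use it.\<close>

lemma flat_dom_open:
  assumes t: "t \<in> flat_dom N k" and x: "x \<in> idx N k"
  shows "\<forall>\<^sub>F s in nhds (t x). t(x := s) \<in> flat_dom N k"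
proof -
  have cont: "isCont (\<lambda>s. (t(x := s)) y) (t x)" for y
    by (cases "y = x") auto
  have ev: "\<forall>\<^sub>F s in nhds (t x). f s \<noteq> 0" if "isCont f (t x)" "f (t x) \<noteq> 0" for f :: "complex \<Rightarrow> complex"
  proof -
    have "f \<midarrow>t x\<rightarrow> f (t x)" using that(1) by (simp add: isCont_def)
    then have "\<forall>\<^sub>F s in at (t x). f s \<noteq> 0" using that(2) by (rule tendsto_imp_eventually_ne)
    then show ?thesis using that(2) by (simp add: eventually_nhds_conv_at)
  qed
  have "\<forall>\<^sub>F s in nhds (t x). \<forall>i\<in>{1..N+1}. (t(x := s)) (i, k i) \<noteq> 0"
    using t by (intro eventually_ball_finite ballI ev cont) (auto simp: flat_dom_def)
  moreover have "\<forall>\<^sub>F s in nhds (t x). \<forall>i\<in>{1..N+1}. \<forall>j\<in>{1..N+1}. i \<noteq> j \<longrightarrow> (t(x := s)) (i, 0) \<noteq> (t(x := s)) (j, 0)"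
  proof (intro eventually_ball_finite ballI finite_atLeastAtMost)
    fix i j assume ij: "i \<in> {1..N+1}" "j \<in> {1..N+1}"
    show "\<forall>\<^sub>F s in nhds (t x). i \<noteq> j \<longrightarrow> (t(x := s)) (i, 0) \<noteq> (t(x := s)) (j, 0)"
    proof (cases "i = j")
      case False
      have "\<forall>\<^sub>F s in nhds (t x). (t(x := s)) (i, 0) - (t(x := s)) (j, 0) \<noteq> 0"
        using t ij False by (intro ev continuous_diff cont) (auto simp: flat_dom_def)
      then show ?thesis by (auto elim!: eventually_mono)
    qed simp
  qed
  ultimately show ?thesis
  proof eventually_elim
    case (elim s)
    then show ?case using t x by (auto simp: flat_dom_def points_def)
  qed
qed

end

section \<open>Coefficientwise derivatives of families of power series\<close>

definition fps_has_deriv :: "(complex \<Rightarrow> complex fps) \<Rightarrow> complex fps \<Rightarrow> complex \<Rightarrow> bool" where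
  "fps_has_deriv f D x \<longleftrightarrow> (\<forall>n. ((\<lambda>s. f s $ n) has_field_derivative D $ n) (at x))"

lemma fps_has_derivD: "fps_has_deriv f D x \<Longrightarrow> ((\<lambda>s. f s $ n) has_field_derivative D $ n) (at x)"
  by (simp add: fps_has_deriv_def)

lemma fps_has_deriv_unique: "fps_has_deriv f D x \<Longrightarrow> fps_has_deriv f D' x \<Longrightarrow> D = D'"
  by (intro fps_ext) (blast intro: DERIV_unique dest: fps_has_derivD)

lemma fps_has_deriv_const: "fps_has_deriv (\<lambda>_. c) 0 x"
  by (simp add: fps_has_deriv_def)

lemma fps_has_deriv_add: "fps_has_deriv f D x \<Longrightarrow> fps_has_deriv g E x \<Longrightarrow> fps_has_deriv (\<lambda>s. f s + g s) (D + E) x"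
  by (simp add: fps_has_deriv_def DERIV_add)

lemma fps_has_deriv_diff: "fps_has_deriv f D x \<Longrightarrow> fps_has_deriv g E x \<Longrightarrow> fps_has_deriv (\<lambda>s. f s - g s) (D - E) x"
  by (simp add: fps_has_deriv_def DERIV_diff)

lemma fps_has_deriv_mult:
  assumes "fps_has_deriv f D x" "fps_has_deriv g E x"
  shows "fps_has_deriv (\<lambda>s. f s * g s) (D * g x + f x * E) x"
  unfolding fps_has_deriv_def
proof
  fix n
  have "((\<lambda>s. \<Sum>i=0..n. f s $ i * g s $ (n - i)) has_field_derivative
     (\<Sum>i=0..n. D $ i * g x $ (n - i) + f x $ i * E $ (n - i))) (at x)"
    by (intro DERIV_sum) (auto intro!: derivative_eq_intros assms[THEN fps_has_derivD])
  then show "((\<lambda>s. (f s * g s) $ n) has_field_derivative (D * g x + f x * E) $ n) (at x)"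
    by (simp add: fps_mult_nth sum.distrib)
qed

lemma fps_has_deriv_power:
  assumes "fps_has_deriv f D x"
  shows "fps_has_deriv (\<lambda>s. f s ^ a) (of_nat a * f x ^ (a - 1) * D) x"
proof (induction a)
  case 0
  show ?case by (simp add: fps_has_deriv_const)
next
  case (Suc a)
  have "D * f x ^ a + f x * (of_nat a * f x ^ (a - 1) * D) = of_nat (Suc a) * f x ^ (Suc a - 1) * D"
    by (cases a) (simp_all add: algebra_simps)
  then show ?case using fps_has_deriv_mult[OF assms Suc] by simp
qed

lemma fps_has_deriv_fps_deriv:
  assumes "fps_has_deriv f D x" shows "fps_has_deriv (\<lambda>s. fps_deriv (f s)) (fps_deriv D) x"
  using assms by (simp add: fps_has_deriv_def DERIV_cmult del: of_nat_Suc)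

text \<open>With constant term 1 the recursion for the coefficients of the inverse is polynomial, so
  they are differentiable by induction. The value of the derivative then follows from
  differentiating \<open>w s * f s = 1\<close>.\<close>

lemma fps_has_deriv_inverse:
  assumes f: "fps_has_deriv f D x" and 1: "\<And>s. f s $ 0 = 1"
  shows "fps_has_deriv (\<lambda>s. inverse (f s)) (- (inverse (f x) ^ 2 * D)) x"
proof -
  define w where "w = (\<lambda>s. inverse (f s))"
  have wf: "w s * f s = 1" for s unfolding w_def by (rule inverse_mult_eq_1) (simp add: 1)
  have "(\<lambda>s. w s $ n) field_differentiable at x" for n
  proof (induction n rule: less_induct)
    case (less n)
    show ?case
    proof (cases "n = 0")
      case True
      then show ?thesis by (simp add: w_def 1)
    next
      case False
      have "w s $ n = - (\<Sum>i<n. w s $ i * f s $ (n - i))" for s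
      proof -
        have "(\<Sum>i=0..n. w s $ i * f s $ (n - i)) = 0"
          using wf[of s] False by (simp add: fps_mult_nth[symmetric])
        moreover have "{0..n} = insert n {..<n}" by auto
        ultimately show ?thesis by (simp add: 1 add_eq_0_iff)
      qed
      moreover have "(\<lambda>s. - (\<Sum>i<n. w s $ i * f s $ (n - i))) field_differentiable at x"
        using f less by (intro field_differentiable_minus field_differentiable_sum field_differentiable_mult)
          (auto simp: fps_has_deriv_def field_differentiable_def)
      ultimately show ?thesis by (simp only:)
    qed
  qed
  then have W: "fps_has_deriv w (Abs_fps (\<lambda>n. deriv (\<lambda>s. w s $ n) x)) x" (is "fps_has_deriv w ?W x")
    by (simp add: fps_has_deriv_def field_differentiable_derivI)
  have "fps_has_deriv (\<lambda>s. w s * f s) (?W * f x + w x * D) x" by (rule fps_has_deriv_mult[OF W f])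
  then have "fps_has_deriv (\<lambda>s. 1) (?W * f x + w x * D) x" by (simp only: wf)
  then have "?W * f x + w x * D = 0" using fps_has_deriv_const by (rule fps_has_deriv_unique)
  then have "w x * (?W * f x + w x * D) = 0" by (simp only: mult_zero_right)
  moreover have "w x * (?W * f x + w x * D) = ?W * (w x * f x) + w x ^ 2 * D"
    by (simp only: power2_eq_square algebra_simps)
  ultimately have "?W + w x ^ 2 * D = 0" by (simp only: wf mult_1_right)
  then have "?W = - (w x ^ 2 * D)" by (simp only: add_eq_0_iff2)
  then show ?thesis using W by (simp add: w_def)
qed

lemma theta_const: "fst x \<noteq> 0 \<Longrightarrow> theta k (t(x := s)) = theta k t"
  by (intro fps_ext) (auto simp: theta_def)

lemma cpsi_const: "fst x \<noteq> i \<or> snd x = 0 \<Longrightarrow> cpsi k (t(x := s)) i = cpsi k t i"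
  by (intro fps_ext) (auto simp: cpsi_def)

lemma theta_deriv:
  assumes "\<gamma> \<in> {1..k 0 - 1}"
  shows "fps_has_deriv (\<lambda>s. theta k (t((0, \<gamma>) := s))) (fps_X ^ (k 0 + 1 - \<gamma>)) s"
  unfolding fps_has_deriv_def
proof
  fix n
  show "((\<lambda>s. theta k (t((0, \<gamma>) := s)) $ n) has_field_derivative fps_X ^ (k 0 + 1 - \<gamma>) $ n) (at s)"
  proof (cases "n = k 0 + 1 - \<gamma>")
    case True
    then have "k 0 + 1 - n = \<gamma>" "n \<in> {2..k 0}" using assms by auto
    then have "(\<lambda>s. theta k (t((0, \<gamma>) := s)) $ n) = (\<lambda>s. s)"
      by (simp add: theta_def)
    then show ?thesis using True by simp
  next
    case False
    then have "(\<lambda>s. theta k (t((0, \<gamma>) := s)) $ n) = (\<lambda>s. theta k t $ n)"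
      using assms by (intro ext) (auto simp: theta_def)
    then show ?thesis using False by simp
  qed
qed

lemma cpsi_deriv:
  assumes "\<alpha> \<in> {1..k i}"
  shows "fps_has_deriv (\<lambda>s. cpsi k (t((i, \<alpha>) := s)) i) (fps_const (1 / of_nat (k i)) * fps_X ^ (k i + 1 - \<alpha>)) s"
  unfolding fps_has_deriv_def
proof
  fix n
  show "((\<lambda>s. cpsi k (t((i, \<alpha>) := s)) i $ n) has_field_derivative
      (fps_const (1 / of_nat (k i)) * fps_X ^ (k i + 1 - \<alpha>)) $ n) (at s)"
  proof (cases "n = k i + 1 - \<alpha>")
    case True
    then have "k i + 1 - n = \<alpha>" "n \<in> {1..k i}" using assms by auto
    then have "(\<lambda>s. cpsi k (t((i, \<alpha>) := s)) i $ n) = (\<lambda>s. s / of_nat (k i))"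
      by (simp add: cpsi_def)
    moreover have "((\<lambda>s. s / of_nat (k i)) has_field_derivative 1 / of_nat (k i)) (at s)"
      by (intro DERIV_cdivide DERIV_ident)
    ultimately show ?thesis using True by simp
  next
    case False
    then have "(\<lambda>s. cpsi k (t((i, \<alpha>) := s)) i $ n) = (\<lambda>s. cpsi k t i $ n)"
      using assms by (intro ext) (auto simp: cpsi_def)
    then show ?thesis using False by simp
  qed
qed

lemma polar_coeff_deriv:
  assumes "fps_has_deriv f D x" "a \<ge> 1"
  shows "((\<lambda>s. polar_coeff k (f s) a) has_field_derivative of_nat k * (f x ^ (a - 1) * D) $ k) (at x)"
proof -
  have "((\<lambda>s. (f s ^ a) $ k) has_field_derivative (of_nat a * f x ^ (a - 1) * D) $ k) (at x)"
    by (intro fps_has_derivD fps_has_deriv_power assms)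
  moreover have "(of_nat a * f x ^ (a - 1) * D) $ k = of_nat a * (f x ^ (a - 1) * D) $ k"
    by (simp add: mult.assoc flip: fps_of_nat)
  ultimately have "((\<lambda>s. of_nat k / of_nat a * (f s ^ a) $ k) has_field_derivative
      of_nat k / of_nat a * (of_nat a * (f x ^ (a - 1) * D) $ k)) (at x)"
    by (intro DERIV_cmult) simp
  then show ?thesis using assms(2) by (simp add: polar_coeff_def)
qed

lemma inf_psi_has_deriv:
  assumes f: "fps_has_deriv f D x" and 0: "\<And>s. f s $ 0 = 0"
  shows "fps_has_deriv (\<lambda>s. inf_psi (f s)) (fps_X * (inverse (1 - f x) ^ 2 * D)) x"
proof -
  have "fps_has_deriv (\<lambda>s. 1 - f s) (0 - D) x" by (intro fps_has_deriv_diff fps_has_deriv_const f)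
  then have "fps_has_deriv (\<lambda>s. inverse (1 - f s)) (- (inverse (1 - f x) ^ 2 * (0 - D))) x"
    by (rule fps_has_deriv_inverse) (simp add: 0)
  then have "fps_has_deriv (\<lambda>s. fps_X * inverse (1 - f s))
      (0 * inverse (1 - f x) + fps_X * (- (inverse (1 - f x) ^ 2 * (0 - D)))) x"
    by (rule fps_has_deriv_mult[OF fps_has_deriv_const])
  then show ?thesis by (simp add: inf_psi_def)
qed

text \<open>With \<open>P = D * inf_psi (f x) ^ a\<close> the product rule collapses to
  \<open>fps_X * fps_deriv P - P\<close>, by \<open>inf_psi_deriv\<close>. In degree
  \<open>Suc k\<close> this is \<open>k\<close> times the coefficient of \<open>P\<close>, which
  cancels the denominator in \<open>inf_coeff\<close>.\<close>

lemma inf_coeff_deriv: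
  assumes f: "fps_has_deriv f D x" and 0: "\<And>s. f s $ 0 = 0" and k: "k \<ge> 1"
  shows "((\<lambda>s. inf_coeff k (f s) a) has_field_derivative (D * inf_psi (f x) ^ a) $ Suc k) (at x)"
proof -
  let ?\<psi> = "inf_psi (f x)" and ?w = "inverse (1 - f x)"
  have wu: "?w * (1 - f x) = 1" by (rule inverse_mult_eq_1) (simp add: 0)
  have 1: "fps_has_deriv (\<lambda>s. 1 - f s + fps_X * fps_deriv (f s)) (0 - D + (0 * fps_deriv (f x) + fps_X * fps_deriv D)) x"
    by (intro fps_has_deriv_add fps_has_deriv_diff fps_has_deriv_const fps_has_deriv_mult fps_has_deriv_fps_deriv f)
  have 2: "fps_has_deriv (\<lambda>s. inf_psi (f s) ^ a) (of_nat a * ?\<psi> ^ (a - 1) * (fps_X * (?w ^ 2 * D))) x"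
    by (intro fps_has_deriv_power inf_psi_has_deriv f 0)
  define E where "E = (0 - D + (0 * fps_deriv (f x) + fps_X * fps_deriv D)) * ?\<psi> ^ a
     + (1 - f x + fps_X * fps_deriv (f x)) * (of_nat a * ?\<psi> ^ (a - 1) * (fps_X * (?w ^ 2 * D)))"
  have 3: "fps_has_deriv (\<lambda>s. (1 - f s + fps_X * fps_deriv (f s)) * inf_psi (f s) ^ a) E x"
    unfolding E_def by (rule fps_has_deriv_mult[OF 1 2])
  have "(1 - f x + fps_X * fps_deriv (f x)) * (of_nat a * ?\<psi> ^ (a - 1) * (fps_X * (?w ^ 2 * D)))
     = fps_deriv ?\<psi> * (?w * (1 - f x)) ^ 2 * (of_nat a * ?\<psi> ^ (a - 1) * (fps_X * D))"
    unfolding inf_psi_deriv[OF 0, symmetric] by (simp add: power_mult_distrib mult_ac)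
  also have "\<dots> = fps_X * D * fps_deriv (?\<psi> ^ a)"
    unfolding wu by (simp add: fps_deriv_power mult_ac fps_of_nat)
  finally have "E = fps_X * fps_deriv (D * ?\<psi> ^ a) - D * ?\<psi> ^ a"
    unfolding E_def by (simp add: algebra_simps)
  moreover have "(fps_X * fps_deriv P - P) $ Suc k = of_nat k * P $ Suc k" for P :: "complex fps"
    by (simp add: algebra_simps)
  ultimately have "E $ Suc k = of_nat k * (D * ?\<psi> ^ a) $ Suc k" by (simp only:)
  then have "((\<lambda>s. inf_coeff k (f s) a) has_field_derivative of_nat k * (D * ?\<psi> ^ a) $ Suc k / of_nat k) (at x)"
    unfolding inf_coeff_def using fps_has_derivD[OF 3, of "Suc k"] by (intro DERIV_cdivide) simp
  then show ?thesis using k by simp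
qed

section \<open>The derivatives of the superpotential\<close>

text \<open>\<open>zco k i \<alpha>\<close> is the derivative of \<open>z = t\<^sub>i\<^sub>,\<^sub>0 + cpsi k t i (w)\<close> in \<open>t\<^sub>i\<^sub>,\<^sub>\<alpha>\<close> at fixed \<open>w\<close>.\<close>

definition zco :: "(nat \<Rightarrow> nat) \<Rightarrow> nat \<Rightarrow> nat \<Rightarrow> complex fps" where
  "zco k i \<alpha> = (if \<alpha> = 0 then 1 else fps_const (1 / of_nat (k i)) * fps_X ^ (k i + 1 - \<alpha>))"

text \<open>\<open>lam_deriv k t x z\<close> is \<open>\<partial>\<lambda>(z, t)/\<partial>t\<^sub>x\<close>.\<close>

definition lam_deriv :: "(nat \<Rightarrow> nat) \<Rightarrow> point \<Rightarrow> nat \<times> nat \<Rightarrow> complex \<Rightarrow> complex" where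
  "lam_deriv k t x z =
     (if fst x = 0 then \<Sum>a=1..k 0 - 1. (inf_psi (theta k t) ^ a) $ snd x * z ^ (a - 1)
      else \<Sum>a=1..k (fst x) + 1. of_nat (k (fst x)) * (cpsi k t (fst x) ^ (a - 1) * zco k (fst x) (snd x)) $ k (fst x)
             / (z - t (fst x, 0)) ^ a)"

definition lam_poly :: "(nat \<Rightarrow> nat) \<Rightarrow> point \<Rightarrow> complex \<Rightarrow> complex" where
  "lam_poly k t z = z ^ k 0 / of_nat (k 0) + (\<Sum>a=1..k 0 - 1. inf_coeff (k 0) (theta k t) a * z ^ (a - 1))"

definition lam_polar :: "(nat \<Rightarrow> nat) \<Rightarrow> point \<Rightarrow> nat \<Rightarrow> complex \<Rightarrow> complex" where
  "lam_polar k t i z = (\<Sum>a=1..k i. polar_coeff (k i) (cpsi k t i) a / (z - t (i, 0)) ^ a)"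

lemma lam_vpar: "lam N k (vpar N k t) z = lam_poly k t z + (\<Sum>i=1..N+1. lam_polar k t i z)"
  unfolding lam_def lam_poly_def lam_polar_def
  by (intro arg_cong2[where f = "(+)"] sum.cong refl) (simp_all add: vpar_inf vpar_center vpar_polar)

lemma lam_poly_const: "fst x \<noteq> 0 \<Longrightarrow> lam_poly k (t(x := s)) z = lam_poly k t z"
  by (simp add: lam_poly_def theta_const)

lemma lam_polar_const: "fst x \<noteq> i \<Longrightarrow> lam_polar k (t(x := s)) i z = lam_polar k t i z"
  by (auto simp: lam_polar_def cpsi_const)

lemma inf_coeff_flat_deriv:
  assumes "\<gamma> \<in> {1..k 0 - 1}"
  shows "((\<lambda>s. inf_coeff (k 0) (theta k (t((0, \<gamma>) := s))) a) has_field_derivative (inf_psi (theta k t) ^ a) $ \<gamma>) (at (t (0, \<gamma>)))"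
proof -
  let ?f = "\<lambda>s. theta k (t((0, \<gamma>) := s))"
  have "((\<lambda>s. inf_coeff (k 0) (?f s) a) has_field_derivative (fps_X ^ (k 0 + 1 - \<gamma>) * inf_psi (?f (t (0, \<gamma>))) ^ a) $ Suc (k 0)) (at (t (0, \<gamma>)))"
    using assms by (intro inf_coeff_deriv theta_deriv) auto
  moreover have "(fps_X ^ (k 0 + 1 - \<gamma>) * P) $ Suc (k 0) = P $ \<gamma>" for P :: "complex fps"
  proof -
    have "\<not> Suc (k 0) < k 0 + 1 - \<gamma>" "Suc (k 0) - (k 0 + 1 - \<gamma>) = \<gamma>" using assms by auto
    then show ?thesis by (simp only: fps_X_power_mult_nth if_False)
  qed
  ultimately show ?thesis by simp
qed

lemma lam_poly_deriv:
  assumes "\<gamma> \<in> {1..k 0 - 1}"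
  shows "((\<lambda>s. lam_poly k (t((0, \<gamma>) := s)) z) has_field_derivative lam_deriv k t (0, \<gamma>) z) (at (t (0, \<gamma>)))"
proof -
  let ?f = "\<lambda>s. theta k (t((0, \<gamma>) := s))"
  have "((\<lambda>s. z ^ k 0 / of_nat (k 0) + (\<Sum>a=1..k 0 - 1. inf_coeff (k 0) (?f s) a * z ^ (a - 1))) has_field_derivative
     0 + (\<Sum>a=1..k 0 - 1. (inf_psi (theta k t) ^ a) $ \<gamma> * z ^ (a - 1))) (at (t (0, \<gamma>)))"
    by (intro DERIV_add DERIV_const DERIV_sum DERIV_cmult_right inf_coeff_flat_deriv assms)
  then show ?thesis by (simp add: lam_poly_def lam_deriv_def)
qed

lemma DERIV_polar:
  fixes z s c :: complex
  assumes "z \<noteq> s"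
  shows "((\<lambda>s. c / (z - s) ^ a) has_field_derivative of_nat a * c / (z - s) ^ Suc a) (at s)"
    "((\<lambda>z. c / (z - s) ^ a) has_field_derivative - (of_nat a * c / (z - s) ^ Suc a)) (at z)"
proof -
  have zs: "z - s \<noteq> 0" using assms by simp
  have "c * of_nat a * u ^ (a - 1) / (u ^ a * u ^ a) = of_nat a * c / u ^ Suc a" if "u \<noteq> 0" for u :: complex
    using that by (cases a) (simp_all add: divide_simps)
  from this[OF zs]
  have c: "c * of_nat a * (z - s) ^ (a - 1) / ((z - s) ^ a * (z - s) ^ a) = of_nat a * c / (z - s) ^ Suc a" .
  have "((\<lambda>s. c / (z - s) ^ a) has_field_derivative c * of_nat a * (z - s) ^ (a - 1) / ((z - s) ^ a * (z - s) ^ a)) (at s)"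
    using zs by (auto intro!: derivative_eq_intros)
  then show "((\<lambda>s. c / (z - s) ^ a) has_field_derivative of_nat a * c / (z - s) ^ Suc a) (at s)" unfolding c .
  have "((\<lambda>z. c / (z - s) ^ a) has_field_derivative - (c * of_nat a * (z - s) ^ (a - 1) / ((z - s) ^ a * (z - s) ^ a))) (at z)"
    using zs by (auto intro!: derivative_eq_intros)
  then show "((\<lambda>z. c / (z - s) ^ a) has_field_derivative - (of_nat a * c / (z - s) ^ Suc a)) (at z)" unfolding c .
qed

lemma fps_power_mult_nth_low: "f $ 0 = 0 \<Longrightarrow> m < n \<Longrightarrow> (f ^ n * g) $ m = (0::complex)"
  by (auto simp: fps_mult_nth startsby_zero_power_prefix intro!: sum.neutral)

text \<open>For \<open>\<alpha> = 0\<close> the pole moves and every order rises by one, which is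
  why \<open>lam_deriv\<close> sums up to \<open>k i + 1\<close>; the term of order 1 added at the
  other end is zero. For \<open>\<alpha> \<ge> 1\<close> the orders stay, and the extra term at
  \<open>k i + 1\<close> vanishes since \<open>zco k i \<alpha>\<close> has positive order.\<close>

lemma lam_polar_deriv:
  assumes i: "i \<noteq> 0" and k: "k i \<ge> 1" and \<alpha>: "\<alpha> \<le> k i" and z: "z \<noteq> t (i, 0)"
  shows "((\<lambda>s. lam_polar k (t((i, \<alpha>) := s)) i z) has_field_derivative lam_deriv k t (i, \<alpha>) z) (at (t (i, \<alpha>)))"
proof (cases "\<alpha> = 0")
  case True
  let ?\<psi> = "cpsi k t i" and ?u = "z - t (i, 0)"
  have e: "lam_polar k (t((i, \<alpha>) := s)) i z = (\<Sum>a=1..k i. polar_coeff (k i) ?\<psi> a / (z - s) ^ a)" for s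
    using True by (simp add: lam_polar_def cpsi_const)
  have "(\<Sum>a=1..k i. of_nat a * polar_coeff (k i) ?\<psi> a / ?u ^ Suc a) = (\<Sum>a=1..k i. of_nat (k i) * (?\<psi> ^ a) $ k i / ?u ^ Suc a)"
    by (intro sum.cong) (auto simp: polar_coeff_def)
  also have "\<dots> = (\<Sum>a=2..k i + 1. of_nat (k i) * (?\<psi> ^ (a - 1)) $ k i / ?u ^ a)"
    by (rule sum.reindex_bij_witness[of _ "\<lambda>a. a - 1" Suc]) auto
  also have "\<dots> = (\<Sum>a=1..k i + 1. of_nat (k i) * (?\<psi> ^ (a - 1)) $ k i / ?u ^ a)" (is "_ = sum ?f _")
  proof -
    have "sum ?f {1..k i + 1} = ?f 1 + sum ?f {Suc 1..k i + 1}"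
      by (rule sum.atLeast_Suc_atMost) simp
    moreover have "?f 1 = 0" using k by simp
    ultimately show ?thesis by (simp only: Suc_1 add_0_left)
  qed
  finally have d: "(\<Sum>a=1..k i. of_nat a * polar_coeff (k i) ?\<psi> a / ?u ^ Suc a) = lam_deriv k t (i, \<alpha>) z"
    using i True by (simp add: lam_deriv_def zco_def)
  have "((\<lambda>s. \<Sum>a=1..k i. polar_coeff (k i) ?\<psi> a / (z - s) ^ a) has_field_derivative
      (\<Sum>a=1..k i. of_nat a * polar_coeff (k i) ?\<psi> a / ?u ^ Suc a)) (at (t (i, 0)))"
    by (intro DERIV_sum DERIV_polar z)
  then show ?thesis unfolding e d by (simp only: True)
next
  case False
  let ?\<psi> = "cpsi k t i" and ?u = "z - t (i, 0)"
  have e: "lam_polar k (t((i, \<alpha>) := s)) i z = (\<Sum>a=1..k i. polar_coeff (k i) (cpsi k (t((i, \<alpha>) := s)) i) a / ?u ^ a)" for s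
    using False by (simp add: lam_polar_def)
  have zc: "zco k i \<alpha> = fps_const (1 / of_nat (k i)) * fps_X ^ (k i + 1 - \<alpha>)" using False by (simp add: zco_def)
  have D: "fps_has_deriv (\<lambda>s. cpsi k (t((i, \<alpha>) := s)) i) (zco k i \<alpha>) (t (i, \<alpha>))"
    unfolding zc using False \<alpha> by (intro cpsi_deriv) auto
  have "((\<lambda>s. \<Sum>a=1..k i. polar_coeff (k i) (cpsi k (t((i, \<alpha>) := s)) i) a / ?u ^ a) has_field_derivative
     (\<Sum>a=1..k i. of_nat (k i) * (cpsi k (t((i, \<alpha>) := t (i, \<alpha>))) i ^ (a - 1) * zco k i \<alpha>) $ k i / ?u ^ a)) (at (t (i, \<alpha>)))"
    by (intro DERIV_sum DERIV_cdivide polar_coeff_deriv D) auto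
  moreover have "(\<Sum>a=1..k i. of_nat (k i) * (cpsi k (t((i, \<alpha>) := t (i, \<alpha>))) i ^ (a - 1) * zco k i \<alpha>) $ k i / ?u ^ a)
     = lam_deriv k t (i, \<alpha>) z"
  proof -
    have "?\<psi> ^ k i * zco k i \<alpha> = fps_const (1 / of_nat (k i)) * (fps_X ^ (k i + 1 - \<alpha>) * ?\<psi> ^ k i)"
      by (simp only: zc mult_ac)
    moreover have "(fps_X ^ (k i + 1 - \<alpha>) * ?\<psi> ^ k i) $ k i = 0"
      using False \<alpha> by (auto simp: fps_X_power_mult_nth startsby_zero_power_prefix)
    ultimately have "(?\<psi> ^ k i * zco k i \<alpha>) $ k i = 0" by (simp only: fps_mult_left_const_nth mult_zero_right)
    then show ?thesis using i by (simp add: lam_deriv_def)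
  qed
  ultimately show ?thesis unfolding e by simp
qed

text \<open>The set \<open>I\<close> is left open for two uses: all poles give
  \<open>\<lambda>\<close>, and the poles up to \<open>N\<close> give its part regular at
  \<open>t (N+1, 0)\<close>, where it may be evaluated.\<close>

lemma lam_sum_deriv:
  assumes x: "x \<in> idx N k" and I: "I \<subseteq> {1..N+1}" and ki: "\<And>i. i \<in> {1..N+1} \<Longrightarrow> k i \<ge> 1"
    and z: "\<And>i. i \<in> I \<Longrightarrow> z \<noteq> t (i, 0)"
  shows "((\<lambda>s. lam_poly k (t(x := s)) z + (\<Sum>i\<in>I. lam_polar k (t(x := s)) i z)) has_field_derivative
     (if fst x \<in> insert 0 I then lam_deriv k t x z else 0)) (at (t x))"
  using x
proof (cases rule: idxE)
  case (inf \<gamma>)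
  have "\<And>i s. i \<in> I \<Longrightarrow> lam_polar k (t((0, \<gamma>) := s)) i z = lam_polar k t i z"
    using I by (intro lam_polar_const) auto
  then have "(\<lambda>s. lam_poly k (t((0, \<gamma>) := s)) z + (\<Sum>i\<in>I. lam_polar k (t((0, \<gamma>) := s)) i z))
     = (\<lambda>s. lam_poly k (t((0, \<gamma>) := s)) z + (\<Sum>i\<in>I. lam_polar k t i z))" by simp
  moreover have "((\<lambda>s. lam_poly k (t((0, \<gamma>) := s)) z + (\<Sum>i\<in>I. lam_polar k t i z)) has_field_derivative
      lam_deriv k t (0, \<gamma>) z + 0) (at (t (0, \<gamma>)))"
    by (intro DERIV_add DERIV_const lam_poly_deriv inf)
  ultimately show ?thesis using inf by simp
next
  case (pole j \<alpha>)
  have fin: "finite I" using I finite_subset by blast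
  have "((\<lambda>s. lam_polar k (t((j, \<alpha>) := s)) i z) has_field_derivative (if i = j then lam_deriv k t (j, \<alpha>) z else 0)) (at (t (j, \<alpha>)))"
    if "i \<in> I" for i
  proof (cases "i = j")
    case True
    then show ?thesis using lam_polar_deriv[of j k \<alpha> z t] pole ki z that by auto
  next
    case False
    then have "(\<lambda>s. lam_polar k (t((j, \<alpha>) := s)) i z) = (\<lambda>s. lam_polar k t i z)"
      by (intro ext lam_polar_const) auto
    then show ?thesis using False by simp
  qed
  then have "((\<lambda>s. lam_poly k t z + (\<Sum>i\<in>I. lam_polar k (t((j, \<alpha>) := s)) i z)) has_field_derivative
     0 + (\<Sum>i\<in>I. if i = j then lam_deriv k t (j, \<alpha>) z else 0)) (at (t (j, \<alpha>)))"
    by (intro DERIV_add DERIV_const DERIV_sum)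
  moreover have "lam_poly k (t((j, \<alpha>) := s)) z = lam_poly k t z" for s
    using pole by (intro lam_poly_const) auto
  ultimately show ?thesis using pole fin by (cases "j \<in> I") (simp_all add: sum.delta)
qed

context hurwitz_data
begin

lemma pd_lam_flat:
  assumes t: "t \<in> flat_dom N k" and x: "x \<in> idx N k" and z: "\<And>i. i \<in> {1..N+1} \<Longrightarrow> z \<noteq> t (i, 0)"
  shows "pd x (lam_flat N k z) t = lam_deriv k t x z"
proof -
  have "fst x \<in> insert 0 {1..N+1}" using x by (auto simp: idx_def)
  then have "((\<lambda>s. lam N k (vpar N k (t(x := s))) z) has_field_derivative lam_deriv k t x z) (at (t x))"
    using lam_sum_deriv[where I = "{1..N+1}" and k = k and N = N and x = x and z = z and t = t, OF x order.refl ki z] unfolding lam_vpar by simp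
  moreover have ev: "\<forall>\<^sub>F s in nhds (t x). lam_flat N k z (t(x := s)) = lam N k (vpar N k (t(x := s))) z"
    using flat_dom_open[OF t x] by eventually_elim (simp add: lam_flat_def params_eq)
  ultimately have "((\<lambda>s. lam_flat N k z (t(x := s))) has_field_derivative lam_deriv k t x z) (at (t x))"
    by (intro iffD2[OF DERIV_cong_ev[OF refl ev refl]])
  then show ?thesis unfolding pd_def by (rule DERIV_imp_deriv)
qed

end

section \<open>Residues\<close>

lemma fls_subdegree_perturb:
  fixes K e :: "'a::comm_ring_1 fls"
  assumes K: "K \<noteq> 0" "fls_subdegree K = - n" and n: "n > 0" and e: "fls_vanishes_below 0 e"
  shows "- K + e \<noteq> 0" "fls_subdegree (- K + e) = - n"
proof -
  have "(- K + e) $$ (-n) = - (K $$ (-n))" using e n by (simp add: fls_vanishes_below_def)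
  then have nz: "(- K + e) $$ (-n) \<noteq> 0" using K nth_fls_subdegree_nonzero[OF K(1)] by simp
  then show "- K + e \<noteq> 0" by (metis fls_zero_nth)
  show "fls_subdegree (- K + e) = - n"
    using nz K n e by (intro fls_subdegree_eqI) (auto simp: fls_vanishes_below_def)
qed

text \<open>Adding \<open>K A B\<close> to the quotient and clearing the denominator cancels the
  term of order \<open>- 2 n\<close>. The remaining numerator has order at least
  \<open>- n - m\<close>, and dividing by a series of order \<open>- n\<close> leaves
  \<open>- m\<close>. Finite poles use \<open>m = 0\<close>, infinity uses
  \<open>m = 1\<close>.\<close>

lemma fls_polar_quotient:
  fixes K A B e1 e2 e3 :: "complex fls"
  assumes K: "K \<noteq> 0" "fls_subdegree K = - n" and n: "n > 0" "0 \<le> m" "m \<le> n"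
    and A: "fls_vanishes_below 0 A" "fls_vanishes_below 0 B"
    and e: "fls_vanishes_below (-m) e1" "fls_vanishes_below (-m) e2" "fls_vanishes_below 0 e3"
  shows "fls_vanishes_below (-m) ((K * A + e1) * (K * B + e2) / (- K + e3) + K * A * B)"
proof -
  define H where "H = - K + e3"
  have Kn: "fls_vanishes_below (-n) K" using K by (simp add: fls_vanishes_below_iff)
  have H: "H \<noteq> 0" "fls_vanishes_below n (inverse H)"
    using fls_subdegree_perturb[OF K n(1) e(3)] by (auto simp: H_def fls_vanishes_below_iff)
  have "fls_vanishes_below (-n-m) (K * A * e2 + e1 * (K * B) + e1 * e2 + K * A * B * e3)"
    by (intro fls_vanishes_below_add fls_vanishes_below_mult_le[OF fls_vanishes_below_mult[OF Kn A(1)] e(2)]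
        fls_vanishes_below_mult_le[OF e(1) fls_vanishes_below_mult[OF Kn A(2)]]
        fls_vanishes_below_mult_le[OF e(1,2)]
        fls_vanishes_below_mult_le[OF fls_vanishes_below_mult[OF fls_vanishes_below_mult[OF Kn A(1)] A(2)] e(3)])
      (use n in auto)
  then have "fls_vanishes_below (-m) ((K * A * e2 + e1 * (K * B) + e1 * e2 + K * A * B * e3) * inverse H)"
    using H(2) by (rule fls_vanishes_below_mult_le) simp
  moreover have "(K * A * e2 + e1 * (K * B) + e1 * e2 + K * A * B * e3) * inverse H
     = (K * A + e1) * (K * B + e2) / H + K * A * B"
  proof -
    have "K * A * e2 + e1 * (K * B) + e1 * e2 + K * A * B * e3 = (K * A + e1) * (K * B + e2) + K * A * B * H"
      by (simp add: H_def algebra_simps)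
    moreover have "K * A * B * H * inverse H = K * A * B" using H(1) by (simp add: mult.assoc)
    ultimately show ?thesis by (simp only: distrib_right divide_inverse)
  qed
  ultimately show ?thesis by (simp add: H_def)
qed

text \<open>The derivative of \<open>- \<phi> ^ (- k) / k\<close>. At a finite pole
  \<open>\<lambda>\<close> is \<open>\<phi> ^ (- k)\<close> up to regular terms, at infinity
  \<open>\<phi> ^ (- k) / k\<close>; this explains the factor \<open>k i\<close> in \<open>K\<close>
  and its absence in \<open>K\<^sub>0\<close>.\<close>

definition pole_dlog :: "complex fps \<Rightarrow> nat \<Rightarrow> complex fls" where
  "pole_dlog \<phi> k = fps_to_fls (fps_deriv \<phi>) / fps_to_fls \<phi> ^ Suc k"

context local_parameter
begin

lemma pole_dlog_subdegree: "pole_dlog \<phi> k \<noteq> 0" "fls_subdegree (pole_dlog \<phi> k) = - (int k + 1)"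
proof -
  have d0: "fps_deriv \<phi> $ 0 \<noteq> 0" using phi1 by simp
  then have "fps_deriv \<phi> \<noteq> 0" by (metis fps_zero_nth)
  moreover have "subdegree (fps_deriv \<phi>) = 0" using d0 by (metis subdegree_eq_0_iff)
  ultimately show "pole_dlog \<phi> k \<noteq> 0" "fls_subdegree (pole_dlog \<phi> k) = - (int k + 1)"
    using phi_nz subdeg by (auto simp: pole_dlog_def fls_divide_subdegree fls_subdegree_pow fls_subdegree_fls_to_fps
        simp del: power_Suc)
qed

lemma pole_dlog_mult_coeff:
  assumes "a \<ge> 1"
  shows "(pole_dlog \<phi> k * fps_to_fls (G oo \<phi>)) $$ (- int a) = (\<psi> ^ (a - 1) * G) $ k"
proof -
  have "pole_dlog \<phi> k * fps_to_fls (G oo \<phi>) = fps_to_fls ((G oo \<phi>) * fps_deriv \<phi>) / fps_to_fls \<phi> ^ Suc k"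
    by (simp add: pole_dlog_def fls_times_fps_to_fls mult.commute del: power_Suc)
  then show ?thesis using prpart_coeff[OF assms, of G k] by (simp only:)
qed

lemma pole_dlog_mult_residue: "fls_residue (pole_dlog \<phi> k * fps_to_fls (G oo \<phi>)) = G $ k"
  using pole_dlog_mult_coeff[of 1 k G] by simp

lemma deriv_inverse_power:
  "fls_deriv (inverse (fps_to_fls \<phi>) ^ k) = - (of_nat k * pole_dlog \<phi> k)"
proof -
  define I where "I = inverse (fps_to_fls \<phi>)"
  have P: "pole_dlog \<phi> k = fls_deriv (fps_to_fls \<phi>) * (I ^ k * I)"
    by (simp only: pole_dlog_def I_def divide_inverse power_inverse fls_deriv_fps_to_fls power_Suc2 inverse_mult_distrib)
  have "fls_deriv (I ^ k) = of_nat k * I ^ (k - 1) * fls_deriv I" by (rule fls_deriv_power)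
  also have "fls_deriv I = - fls_deriv (fps_to_fls \<phi>) * I ^ 2"
    unfolding I_def by (rule fls_inverse_deriv)
  also have "of_nat k * I ^ (k - 1) * (- fls_deriv (fps_to_fls \<phi>) * I ^ 2) = - (of_nat k * pole_dlog \<phi> k)"
    unfolding P by (cases k) (simp_all add: power2_eq_square)
  finally show ?thesis by (simp only: I_def)
qed

end

lemma deriv_shift: "deriv (\<lambda>u. f (v + u)) = (\<lambda>u. deriv f (v + u))"
proof
  fix u
  have "((\<lambda>u. f (u + v)) has_field_derivative D) (at u) \<longleftrightarrow> (f has_field_derivative D) (at (u + v))" for D
    by (simp add: DERIV_shift)
  then show "deriv (\<lambda>u. f (v + u)) u = deriv f (v + u)"
    unfolding deriv_def by (simp add: add.commute)
qed

lemma lam_analytic: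
  assumes "\<And>j. j \<in> {1..N+1} \<Longrightarrow> z \<noteq> v (j, 0)" "k 0 \<ge> 1"
  shows "lam N k v analytic_on {z}"
  unfolding lam_def[abs_def] using assms by (intro analytic_intros) auto

locale flat_point = hurwitz_data +
  fixes t :: point
  assumes t: "t \<in> flat_dom N k"
begin

abbreviation \<psi> where "\<psi> i \<equiv> cpsi k t i"
abbreviation \<phi> where "\<phi> i \<equiv> fps_inv (cpsi k t i)"
abbreviation K where "K i \<equiv> of_nat (k i) * pole_dlog (\<phi> i) (k i)"
abbreviation dlam where "dlam \<equiv> deriv (lam N k (vpar N k t))"

lemma distinct: "i \<in> {1..N+1} \<Longrightarrow> j \<in> {1..N+1} \<Longrightarrow> i \<noteq> j \<Longrightarrow> t (i, 0) \<noteq> t (j, 0)"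
  using t by (auto simp: flat_dom_def)

lemma local_parameter_pole:
  assumes "i \<in> {1..N+1}" shows "local_parameter (\<phi> i) (\<psi> i)"
  using assms t ki[OF assms] cpsi_1[of k i t] by (intro local_parameter_of_psi) (auto simp: flat_dom_def)

lemma K_subdegree:
  assumes "i \<in> {1..N+1}" shows "K i \<noteq> 0" "fls_subdegree (K i) = - (int (k i) + 1)"
proof -
  interpret local_parameter "\<phi> i" "\<psi> i" by (rule local_parameter_pole[OF assms])
  have "of_nat (k i) \<noteq> (0 :: complex fls)" using ki[OF assms] by (simp add: fls_of_nat)
  then show "K i \<noteq> 0" "fls_subdegree (K i) = - (int (k i) + 1)"
    using pole_dlog_subdegree[of "k i"] by auto
qed

lemma K_mult_coeff:
  assumes "i \<in> {1..N+1}" "a \<ge> 1"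
  shows "(K i * fps_to_fls (G oo \<phi> i)) $$ (- int a) = of_nat (k i) * (\<psi> i ^ (a - 1) * G) $ k i"
proof -
  interpret local_parameter "\<phi> i" "\<psi> i" by (rule local_parameter_pole[OF assms(1)])
  show ?thesis using pole_dlog_mult_coeff[OF assms(2), of "k i" G] by (simp add: mult.assoc fls_of_nat)
qed

text \<open>All coefficients of negative order of \<open>\<lambda>\<close> and of
  \<open>w ^ (- k i)\<close> coincide, although \<open>w\<close> is the inverse of the polynomial
  \<open>cpsi k t i\<close> only, so the derivatives differ by a regular series.\<close>

lemma dlam_expansion:
  assumes i: "i \<in> {1..N+1}"
  obtains e where "fls_vanishes_below 0 e" "(\<lambda>u. dlam (t (i, 0) + u)) has_laurent_expansion (- K i + e)"
proof -
  let ?v = "vpar N k t"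
  have v0: "?v (j, 0) = t (j, 0)" if "j \<in> {1..N+1}" for j by (rule vpar_center[OF that])
  have dist: "\<forall>j\<in>{1..N+1}-{i}. ?v (i, 0) \<noteq> ?v (j, 0)"
    using v0 i distinct by (metis DiffE singletonI)
  obtain L where L: "(\<lambda>u. lam N k ?v (?v (i, 0) + u)) has_laurent_expansion L"
    "\<And>a. a \<ge> 1 \<Longrightarrow> L $$ (- int a) = (if a \<le> k i then ?v (i, a) else 0)"
    by (rule lam_expansion_pole[where k = k, OF i dist]) blast
  interpret local_parameter "\<phi> i" "\<psi> i" by (rule local_parameter_pole[OF i])
  let ?M = "inverse (fps_to_fls (\<phi> i)) ^ k i"
  have "L $$ (- int a) = ?M $$ (- int a)" if "a \<ge> 1" for a
  proof (cases "a \<le> k i")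
    case True
    then show ?thesis using that L(2) pole_coeff[OF that ki[OF i]] i
      by (simp add: vpar_polar polar_coeff_def power_inverse)
  next
    case False
    then have "(\<psi> i ^ a) $ k i = 0" by (intro startsby_zero_power_prefix[rule_format]) auto
    then show ?thesis using False that L(2) pole_coeff[OF that ki[OF i]] by (simp add: power_inverse)
  qed
  then have "fls_vanishes_below 0 (L - ?M)"
    unfolding fls_vanishes_below_def
  proof (intro allI impI)
    fix j :: int assume *: "\<And>a. a \<ge> 1 \<Longrightarrow> L $$ (- int a) = ?M $$ (- int a)" and "j < 0"
    then have "j = - int (nat (- j))" "nat (- j) \<ge> 1" by auto
    then show "(L - ?M) $$ j = 0" using * by (metis fls_minus_nth right_minus_eq)
  qed
  then have "fls_vanishes_below 0 (fls_deriv (L - ?M))" by (rule fls_vanishes_below_deriv_0)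
  moreover have "fls_deriv L = - K i + fls_deriv (L - ?M)"
    using deriv_inverse_power[of "k i"] by simp
  moreover have "(\<lambda>u. dlam (t (i, 0) + u)) has_laurent_expansion fls_deriv L"
    using has_laurent_expansion_deriv[OF L(1)] by (simp only: v0[OF i] deriv_shift)
  ultimately show ?thesis using that by metis
qed

text \<open>The chain rule behind the flat coordinates: at fixed \<open>w\<close> the singular part
  of \<open>\<lambda>\<close> does not change while \<open>z\<close> moves by \<open>zco\<close>, so
  at fixed \<open>z\<close> it changes by \<open>- d\<lambda>/dz\<close> times \<open>zco\<close>,
  and \<open>- d\<lambda>/dz\<close> has singular part \<open>K i\<close>.\<close>

lemma lam_deriv_expansion_own:
  assumes i: "i \<in> {1..N+1}"
  obtains e where "fls_vanishes_below 0 e"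
    "(\<lambda>u. lam_deriv k t (i, \<alpha>) (t (i, 0) + u)) has_laurent_expansion (K i * fps_to_fls (zco k i \<alpha> oo \<phi> i) + e)"
proof -
  let ?c = "\<lambda>a. of_nat (k i) * (\<psi> i ^ (a - 1) * zco k i \<alpha>) $ k i"
  have an: "(\<lambda>_. 0) analytic_on {t (i, 0)}" by simp
  obtain F where F: "(\<lambda>u. (\<Sum>a=1..k i + 1. ?c a / ((t (i, 0) + u) - t (i, 0)) ^ a) + 0) has_laurent_expansion F"
    "\<And>a. a \<ge> 1 \<Longrightarrow> F $$ (- int a) = (if a \<le> k i + 1 then ?c a else 0)"
    by (rule has_laurent_expansion_pole_part[where n = "k i + 1" and c = ?c, OF an]) blast
  let ?G = "K i * fps_to_fls (zco k i \<alpha> oo \<phi> i)"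
  have "fls_vanishes_below 0 (F - ?G)"
    unfolding fls_vanishes_below_def
  proof (intro allI impI)
    fix j :: int assume "j < 0"
    then obtain a where a: "j = - int a" "a \<ge> 1" using that[of "nat (- j)"] by auto
    have "F $$ j = ?c a"
    proof (cases "a \<le> k i + 1")
      case False
      then have "?c a = 0" by (simp add: fps_power_mult_nth_low)
      then show ?thesis using F(2)[OF a(2)] a(1) False by simp
    qed (use F(2)[OF a(2)] a(1) in simp)
    moreover have "?G $$ j = ?c a" unfolding a(1) by (rule K_mult_coeff[OF i a(2)])
    ultimately show "(F - ?G) $$ j = 0" by (simp only: fls_minus_nth diff_self)
  qed
  moreover have "(\<lambda>u. lam_deriv k t (i, \<alpha>) (t (i, 0) + u)) has_laurent_expansion (?G + (F - ?G))"
    using F(1) i by (simp add: lam_deriv_def)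
  ultimately show ?thesis using that by blast
qed

lemma lam_deriv_expansion_other:
  assumes i: "i \<in> {1..N+1}" and x: "x \<in> idx N k" "fst x \<noteq> i"
  obtains g where "(\<lambda>u. lam_deriv k t x (t (i, 0) + u)) has_laurent_expansion fps_to_fls g"
    "g $ 0 = lam_deriv k t x (t (i, 0))"
proof -
  have "lam_deriv k t x analytic_on {t (i, 0)}"
  proof (cases "fst x = 0")
    case True
    then show ?thesis unfolding lam_deriv_def[abs_def] by (auto intro!: analytic_intros)
  next
    case False
    then have "t (i, 0) \<noteq> t (fst x, 0)" using x i by (intro distinct) (auto simp: idx_def)
    with False show ?thesis unfolding lam_deriv_def[abs_def] by (auto intro!: analytic_intros)
  qed
  then obtain g where g: "(\<lambda>u. lam_deriv k t x (t (i, 0) + u)) has_fps_expansion g"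
    using analytic_at_imp_has_fps_expansion by blast
  then show ?thesis
    using that has_laurent_expansion_fps[OF g] has_fps_expansion_imp_0_eq_fps_nth_0[OF g] by simp
qed

lemma lam_deriv_expansion_ge:
  assumes i: "i \<in> {1..N+1}" and x: "x \<in> idx N k"
  obtains X where "(\<lambda>u. lam_deriv k t x (t (i, 0) + u)) has_laurent_expansion X"
    "fls_vanishes_below (if fst x = i then - (int (k i) + 1) else 0) X"
proof (cases "fst x = i")
  case True
  then obtain \<alpha> where [simp]: "x = (i, \<alpha>)" by (cases x) auto
  obtain e where e: "fls_vanishes_below 0 e"
    "(\<lambda>u. lam_deriv k t (i, \<alpha>) (t (i, 0) + u)) has_laurent_expansion (K i * fps_to_fls (zco k i \<alpha> oo \<phi> i) + e)"
    by (rule lam_deriv_expansion_own[OF i])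
  have "fls_vanishes_below (- (int (k i) + 1)) (K i * fps_to_fls (zco k i \<alpha> oo \<phi> i))"
  proof (rule fls_vanishes_below_mult_le[OF _ fls_vanishes_below_fps[OF order.refl]])
    show "fls_vanishes_below (- (int (k i) + 1)) (K i)"
      unfolding fls_vanishes_below_iff K_subdegree(2)[OF i] by simp
  qed simp
  moreover have "fls_vanishes_below (- (int (k i) + 1)) e"
    using e(1) by (rule fls_vanishes_below_mono) simp
  ultimately show ?thesis using that e(2) fls_vanishes_below_add by auto
next
  case False
  obtain g where "(\<lambda>u. lam_deriv k t x (t (i, 0) + u)) has_laurent_expansion fps_to_fls g"
    by (rule lam_deriv_expansion_other[OF i x False])
  then show ?thesis using that[of "fps_to_fls g"] False by simp
qed

lemma dlam_inverse_expansion: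
  assumes i: "i \<in> {1..N+1}"
  obtains R where "(\<lambda>u. inverse (dlam (t (i, 0) + u))) has_laurent_expansion R"
    "fls_vanishes_below (int (k i) + 1) R"
proof -
  obtain e where e: "fls_vanishes_below 0 e" "(\<lambda>u. dlam (t (i, 0) + u)) has_laurent_expansion (- K i + e)"
    by (rule dlam_expansion[OF i])
  let ?H = "- K i + e"
  have "fls_subdegree ?H = - (int (k i) + 1)"
    by (rule fls_subdegree_perturb[OF K_subdegree[OF i] _ e(1)]) simp
  then have "fls_vanishes_below (int (k i) + 1) (inverse ?H)"
    by (simp add: fls_vanishes_below_iff)
  moreover have "(\<lambda>u. inverse (dlam (t (i, 0) + u))) has_laurent_expansion inverse ?H"
    by (intro laurent_expansion_intros e(2))
  ultimately show ?thesis using that by blast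
qed

definition integrand where
  "integrand x y z = lam_deriv k t x z * lam_deriv k t y z * lam_deriv k t (N+1, 1) z / dlam z"

lemma residue_integrand:
  assumes "(\<lambda>u. lam_deriv k t x (q + u)) has_laurent_expansion X"
    "(\<lambda>u. lam_deriv k t y (q + u)) has_laurent_expansion Y"
    "(\<lambda>u. lam_deriv k t (N+1, 1) (q + u)) has_laurent_expansion W"
    "(\<lambda>u. inverse (dlam (q + u))) has_laurent_expansion R"
  shows "residue (integrand x y) q = fls_residue (X * Y * W * R)"
proof -
  have "(\<lambda>u. integrand x y (q + u)) has_laurent_expansion X * Y * W * R"
    unfolding integrand_def divide_inverse by (intro has_laurent_expansion_mult assms)
  then show ?thesis by (rule has_laurent_expansion_residue)
qed

text \<open>The factor \<open>1 / (z - p)\<close> is regular at this pole and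
  \<open>1 / dlam\<close> vanishes to order \<open>k i + 1\<close>, which absorbs one singular
  derivative but not two.\<close>

lemma residue_pole_mixed:
  assumes i: "i \<in> {1..N}" and xy: "x \<in> idx N k" "y \<in> idx N k" and ne: "\<not> (fst x = i \<and> fst y = i)"
  shows "residue (integrand x y) (t (i, 0)) = 0"
proof -
  have i': "i \<in> {1..N+1}" and w: "(N+1, 1) \<in> idx N k" "fst (N+1, 1) \<noteq> i"
    using i ki[of "N+1"] by (auto simp: idx_def)
  obtain X where X: "(\<lambda>u. lam_deriv k t x (t (i, 0) + u)) has_laurent_expansion X"
    "fls_vanishes_below (if fst x = i then - (int (k i) + 1) else 0) X"
    by (rule lam_deriv_expansion_ge[OF i' xy(1)])
  obtain Y where Y: "(\<lambda>u. lam_deriv k t y (t (i, 0) + u)) has_laurent_expansion Y"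
    "fls_vanishes_below (if fst y = i then - (int (k i) + 1) else 0) Y"
    by (rule lam_deriv_expansion_ge[OF i' xy(2)])
  obtain W where W: "(\<lambda>u. lam_deriv k t (N+1, 1) (t (i, 0) + u)) has_laurent_expansion fps_to_fls W"
    by (rule lam_deriv_expansion_other[OF i' w])
  obtain R where R: "(\<lambda>u. inverse (dlam (t (i, 0) + u))) has_laurent_expansion R"
    "fls_vanishes_below (int (k i) + 1) R"
    by (rule dlam_inverse_expansion[OF i'])
  have "fls_vanishes_below 0 (X * Y * fps_to_fls W * R)"
    by (rule fls_vanishes_below_mult_le[OF fls_vanishes_below_mult[OF fls_vanishes_below_mult[OF X(2) Y(2)]
          fls_vanishes_below_fps[OF order.refl]] R(2)]) (use ne in auto)
  then show ?thesis
    unfolding residue_integrand[OF X(1) Y(1) W R(1)] by (rule fls_vanishes_below_residue)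
qed

text \<open>Here \<open>zco k i 1\<close> is already of order \<open>k i\<close>, so any positive
  power of \<open>cpsi\<close> pushes the product beyond the coefficient that is read off.\<close>

lemma lam_deriv_simple_pole:
  assumes "i \<in> {1..N+1}"
  shows "lam_deriv k t (i, 1) z = 1 / (z - t (i, 0))"
proof -
  let ?f = "\<lambda>a. of_nat (k i) * (\<psi> i ^ (a - 1) * zco k i 1) $ k i / (z - t (i, 0)) ^ a"
  have zc: "zco k i 1 = fps_const (1 / of_nat (k i)) * fps_X ^ k i" by (simp add: zco_def)
  have c: "(\<psi> i ^ b * zco k i 1) $ k i = (if b = 0 then 1 / of_nat (k i) else 0)" for b
  proof -
    have "\<psi> i ^ b * zco k i 1 = fps_const (1 / of_nat (k i)) * (fps_X ^ k i * \<psi> i ^ b)"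
      by (simp only: zc mult_ac)
    then have "(\<psi> i ^ b * zco k i 1) $ k i = 1 / of_nat (k i) * (\<psi> i ^ b) $ 0"
      by (simp only: fps_mult_left_const_nth fps_X_power_mult_nth) simp
    then show ?thesis by (simp add: fps_nth_power_0)
  qed
  have "lam_deriv k t (i, 1) z = sum ?f {1..k i + 1}" using assms by (simp add: lam_deriv_def)
  also have "\<dots> = (\<Sum>a=1..k i + 1. if a = 1 then 1 / (z - t (i, 0)) else 0)"
    using ki[OF assms] by (intro sum.cong) (auto simp: c simp del: One_nat_def)
  finally show ?thesis by simp
qed

text \<open>By \<open>fls_polar_quotient\<close> the integrand is \<open>- K A B C\<close> plus a
  regular series, where \<open>C\<close> expands \<open>1 / (z - p) = 1 / (u - c)\<close>. Written
  in \<open>w\<close>, all three factors become series composed with \<open>\<phi> i\<close>, and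
  the residue against \<open>K i\<close> picks the coefficient of degree \<open>k i\<close>.\<close>

lemma residue_pole_own:
  assumes i: "i \<in> {1..N}"
  shows "residue (integrand (i, \<alpha>) (i, \<beta>)) (t (i, 0))
    = - (of_nat (k i) * (zco k i \<alpha> * zco k i \<beta> * inverse (\<psi> i - fps_const (t (N+1, 0) - t (i, 0)))) $ k i)"
proof -
  have i': "i \<in> {1..N+1}" using i by simp
  define c where "c = t (N+1, 0) - t (i, 0)"
  have c: "c \<noteq> 0" using distinct[of "N+1" i] i by (simp add: c_def)
  interpret local_parameter "\<phi> i" "\<psi> i" by (rule local_parameter_pole[OF i'])
  let ?A = "fps_to_fls (zco k i \<alpha> oo \<phi> i)" and ?B = "fps_to_fls (zco k i \<beta> oo \<phi> i)"
    and ?C = "fps_to_fls (inverse (fps_X - fps_const c))"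
  obtain e1 where X: "fls_vanishes_below 0 e1"
    "(\<lambda>u. lam_deriv k t (i, \<alpha>) (t (i, 0) + u)) has_laurent_expansion (K i * ?A + e1)"
    by (rule lam_deriv_expansion_own[OF i'])
  obtain e2 where Y: "fls_vanishes_below 0 e2"
    "(\<lambda>u. lam_deriv k t (i, \<beta>) (t (i, 0) + u)) has_laurent_expansion (K i * ?B + e2)"
    by (rule lam_deriv_expansion_own[OF i'])
  obtain e3 where D: "fls_vanishes_below 0 e3" "(\<lambda>u. dlam (t (i, 0) + u)) has_laurent_expansion (- K i + e3)"
    by (rule dlam_expansion[OF i'])
  have W: "(\<lambda>u. lam_deriv k t (N+1, 1) (t (i, 0) + u)) has_laurent_expansion ?C"
  proof -
    have "(\<lambda>u. u - c) has_fps_expansion fps_X - fps_const c" by (intro fps_expansion_intros)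
    then have "(\<lambda>u. inverse (u - c)) has_fps_expansion inverse (fps_X - fps_const c)"
      by (rule has_fps_expansion_inverse) (simp add: c)
    then have "(\<lambda>u. inverse (u - c)) has_laurent_expansion ?C" by (rule has_laurent_expansion_fps)
    moreover have "lam_deriv k t (N+1, 1) (t (i, 0) + u) = inverse (u - c)" for u
      using lam_deriv_simple_pole[of "N+1"] by (simp add: c_def inverse_eq_divide algebra_simps)
    ultimately show ?thesis by simp
  qed
  define Q where "Q = (K i * ?A + e1) * (K i * ?B + e2) / (- K i + e3) + K i * ?A * ?B"
  have Q: "fls_vanishes_below (-0) Q"
    unfolding Q_def by (rule fls_polar_quotient[where n = "int (k i) + 1"]) (use K_subdegree[OF i'] X Y D in auto)
  have "(K i * ?A + e1) * (K i * ?B + e2) * ?C / (- K i + e3) = ((K i * ?A + e1) * (K i * ?B + e2) / (- K i + e3)) * ?C"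
    by simp
  also have "(K i * ?A + e1) * (K i * ?B + e2) / (- K i + e3) = Q - K i * ?A * ?B" by (simp add: Q_def)
  also have "(Q - K i * ?A * ?B) * ?C = Q * ?C - K i * (?A * ?B * ?C)" by (simp add: left_diff_distrib mult.assoc)
  finally have eq: "(K i * ?A + e1) * (K i * ?B + e2) * ?C / (- K i + e3) = Q * ?C - K i * (?A * ?B * ?C)" .
  let ?G = "zco k i \<alpha> * zco k i \<beta> * inverse (\<psi> i - fps_const c)"
  have "?G oo \<phi> i = (zco k i \<alpha> oo \<phi> i) * (zco k i \<beta> oo \<phi> i) * inverse (fps_X - fps_const c)"
  proof -
    have "inverse (\<psi> i - fps_const c) oo \<phi> i = inverse ((\<psi> i - fps_const c) oo \<phi> i)"
      using c psi0 by (intro fps_inverse_compose phi0) simp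
    also have "(\<psi> i - fps_const c) oo \<phi> i = fps_X - fps_const c"
      by (simp add: fps_compose_sub_distrib psi_phi)
    finally show ?thesis by (simp only: compose_mult)
  qed
  then have ABC: "?A * ?B * ?C = fps_to_fls (?G oo \<phi> i)" by (simp only: fls_times_fps_to_fls)
  have "fls_vanishes_below 0 (Q * ?C)"
    using Q by (intro fls_vanishes_below_mult_le[of 0 _ 0]) auto
  then have "fls_residue (Q * ?C) = 0" by (rule fls_vanishes_below_residue)
  moreover have "fls_residue (K i * fps_to_fls (?G oo \<phi> i)) = of_nat (k i) * ?G $ k i"
    using K_mult_coeff[OF i' order.refl, of ?G] by simp
  moreover have "fls_residue (a - b) = fls_residue a - fls_residue b" for a b :: "complex fls" by simp
  ultimately have res: "fls_residue (Q * ?C - K i * (?A * ?B * ?C)) = - (of_nat (k i) * ?G $ k i)"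
    unfolding ABC by (simp only: diff_0)
  have "(\<lambda>u. integrand (i, \<alpha>) (i, \<beta>) (t (i, 0) + u)) has_laurent_expansion Q * ?C - K i * (?A * ?B * ?C)"
    unfolding eq[symmetric] integrand_def by (intro laurent_expansion_intros X Y W D)
  from has_laurent_expansion_residue[OF this]
  show ?thesis using res unfolding c_def by (simp only:)
qed

end

section \<open>Residues at infinity\<close>

context flat_point
begin

abbreviation \<psi>\<^sub>0 where "\<psi>\<^sub>0 \<equiv> inf_psi (theta k t)"
abbreviation \<phi>\<^sub>0 where "\<phi>\<^sub>0 \<equiv> fps_inv (inf_psi (theta k t))"
abbreviation K\<^sub>0 where "K\<^sub>0 \<equiv> pole_dlog (fps_inv (inf_psi (theta k t))) (k 0)"

lemma local_parameter_inf: "local_parameter \<phi>\<^sub>0 \<psi>\<^sub>0"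
  using inf_psi_1[of "theta k t"] by (intro local_parameter_of_psi) auto

text \<open>The factor \<open>- fls_X ^ 2\<close> is the chain rule
  \<open>d/dz = - w ^ 2 d/dw\<close> for \<open>w = 1/z\<close>. The expansions of
  \<open>k 0 * \<lambda>\<close> and \<open>M ^ k 0\<close> agree through degree 0, so their
  derivatives differ by a regular series.\<close>

lemma dlam_inf_expansion:
  obtains e where "fls_vanishes_below 0 e" "(\<lambda>w. dlam (1 / w)) has_laurent_expansion - (fls_X ^ 2 * (- K\<^sub>0 + e))"
proof -
  let ?v = "vpar N k t" and ?\<theta> = "theta k t"
  have k1: "k 0 \<ge> 1" using k0 by simp
  have th: "?\<theta> $ 0 = 0" "?\<theta> $ 1 = 0" by simp_all
  interpret local_parameter "\<phi>\<^sub>0" "\<psi>\<^sub>0" by (rule local_parameter_inf)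
  define M where "M = inverse (fps_to_fls \<phi>\<^sub>0)"
  have M: "M \<noteq> 0" "fls_subdegree M = -1" using phi_nz subdeg by (auto simp: M_def)
  obtain L where L: "(\<lambda>w. of_nat (k 0) * lam N k ?v (1 / w)) has_laurent_expansion L"
    "\<And>a. a \<ge> 1 \<Longrightarrow> L $$ (1 - int a) = (if a < k 0 then of_nat (k 0) * ?v (0, a) else if a = k 0 + 1 then 1 else 0)"
    "fls_subdegree L = - int (k 0)"
    by (rule lam_power_expansion_inf[where k = k and N = N and v = ?v, OF k1]) blast
  have "fls_vanishes_below 1 (L - M ^ k 0)"
    unfolding fls_vanishes_below_def
  proof (intro allI impI)
    fix j :: int assume "j < 1"
    then obtain a where a: "j = 1 - int a" "a \<ge> 1" using that[of "nat (1 - j)"] by auto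
    have Mc: "(M ^ k 0) $$ (1 - int a) = ((1 - ?\<theta> + fps_X * fps_deriv ?\<theta>) * \<psi>\<^sub>0 ^ a) $ Suc (k 0)"
      unfolding M_def by (rule inf_power_coeff[OF local_parameter_inf th(1) a(2)])
    consider "a < k 0" | "a = k 0" | "a = k 0 + 1" | "a > k 0 + 1" by linarith
    then have "L $$ (1 - int a) = (M ^ k 0) $$ (1 - int a)"
    proof cases
      case 1
      then have "?v (0, a) = inf_coeff (k 0) ?\<theta> a" using a by (intro vpar_inf) auto
      then show ?thesis using L(2)[OF a(2)] Mc 1 k0 by (simp add: inf_coeff_def)
    next
      case 2
      then show ?thesis using L(2)[OF a(2)] Mc inf_psi_low(2)[OF th, of a] by simp
    next
      case 3
      then show ?thesis using L(2)[OF a(2)] Mc inf_psi_low(1)[OF th, of a] by simp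
    next
      case 4
      then have "(M ^ k 0) $$ (1 - int a) = 0" using M by (intro fls_eq0_below_subdegree) (simp add: fls_subdegree_pow)
      then show ?thesis using L(2)[OF a(2)] 4 by simp
    qed
    then show "(L - M ^ k 0) $$ j = 0" by (simp add: a)
  qed
  then have ge: "fls_vanishes_below 0 (fls_deriv (L - M ^ k 0))" using fls_vanishes_below_deriv by fastforce
  define e where "e = fls_const (1 / of_nat (k 0)) * fls_deriv (L - M ^ k 0)"
  have e: "fls_vanishes_below 0 e" using ge by (simp add: e_def fls_vanishes_below_def)
  have kk: "fls_const (1 / of_nat (k 0)) * (of_nat (k 0) * x) = x" for x :: "complex fls"
    using k0 by (simp add: fls_of_nat mult.assoc[symmetric])
  have "fls_const (1 / of_nat (k 0)) * fls_deriv L = e + fls_const (1 / of_nat (k 0)) * fls_deriv (M ^ k 0)"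
    by (simp add: e_def algebra_simps)
  also have "fls_deriv (M ^ k 0) = - (of_nat (k 0) * K\<^sub>0)"
    unfolding M_def by (rule deriv_inverse_power)
  finally have dL: "fls_const (1 / of_nat (k 0)) * fls_deriv L = - K\<^sub>0 + e" by (simp add: kk)
  have "(\<lambda>w. - (w ^ 2 * (1 / of_nat (k 0) * deriv (\<lambda>w. of_nat (k 0) * lam N k ?v (1 / w)) w))) has_laurent_expansion
      - (fls_X ^ 2 * (fls_const (1 / of_nat (k 0)) * fls_deriv L))"
    by (intro laurent_expansion_intros L(1))
  moreover have "\<forall>\<^sub>F w in at 0. - (w ^ 2 * (1 / of_nat (k 0) * deriv (\<lambda>w. of_nat (k 0) * lam N k ?v (1 / w)) w)) = dlam (1 / w)"
  proof -
    have "\<forall>\<^sub>F z in at_infinity. \<forall>j\<in>{1..N+1}. z \<noteq> ?v (j, 0)"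
    proof (intro eventually_ball_finite ballI)
      fix j
      show "\<forall>\<^sub>F z in at_infinity. z \<noteq> ?v (j, 0)"
        unfolding eventually_at_infinity by (rule exI[of _ "norm (?v (j, 0)) + 1"]) auto
    qed simp
    moreover have "filterlim inverse at_infinity (at (0::complex))" by (rule filterlim_inverse_at_infinity)
    ultimately have "\<forall>\<^sub>F w in at 0. \<forall>j\<in>{1..N+1}. inverse w \<noteq> ?v (j, 0)" by (rule eventually_compose_filterlim)
    moreover have "\<forall>\<^sub>F w in at (0::complex). w \<noteq> 0" by (simp add: eventually_at_filter)
    ultimately show ?thesis
    proof eventually_elim
      case (elim w)
      have "lam N k ?v analytic_on {1 / w}" using elim k1 by (intro lam_analytic) (auto simp: inverse_eq_divide)
      then have "(lam N k ?v has_field_derivative dlam (1 / w)) (at (1 / w))"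
        using analytic_at field_differentiable_derivI analytic_on_imp_differentiable_at by blast
      moreover have "((\<lambda>w. 1 / w) has_field_derivative - (1 / w ^ 2)) (at w)"
        using elim by (auto intro!: derivative_eq_intros simp: power2_eq_square)
      ultimately have "((\<lambda>w. lam N k ?v (1 / w)) has_field_derivative dlam (1 / w) * - (1 / w ^ 2)) (at w)"
        by (rule DERIV_chain2)
      then have "((\<lambda>w. of_nat (k 0) * lam N k ?v (1 / w)) has_field_derivative of_nat (k 0) * (dlam (1 / w) * - (1 / w ^ 2))) (at w)"
        by (rule DERIV_cmult)
      then show ?case using elim k1 by (simp add: DERIV_imp_deriv)
    qed
  qed
  ultimately have "(\<lambda>w. dlam (1 / w)) has_laurent_expansion - (fls_X ^ 2 * (- K\<^sub>0 + e))"
    unfolding dL by (rule has_laurent_expansion_transform)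
  with e show ?thesis by (rule that)
qed

text \<open>At fixed \<open>q\<close> the variable \<open>z = (1 - \<theta>) / q\<close> moves by
  \<open>- q ^ (k 0 - \<gamma>)\<close>, which explains the monomial. The error starts at degree -1
  inside the bracket because only the coefficients of nonnegative powers of \<open>z\<close> are
  matched.\<close>

lemma lam_deriv_inf_expansion:
  assumes \<gamma>: "\<gamma> \<in> {1..k 0 - 1}"
  obtains e where "fls_vanishes_below (-1) e"
    "(\<lambda>w. lam_deriv k t (0, \<gamma>) (1 / w)) has_laurent_expansion
       fls_X ^ 2 * (K\<^sub>0 * fps_to_fls (fps_X ^ (k 0 - \<gamma>) oo \<phi>\<^sub>0) + e)"
proof -
  interpret local_parameter "\<phi>\<^sub>0" "\<psi>\<^sub>0" by (rule local_parameter_inf)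
  let ?c = "\<lambda>a. (\<psi>\<^sub>0 ^ a) $ \<gamma>"
  let ?G = "K\<^sub>0 * fps_to_fls (fps_X ^ (k 0 - \<gamma>) oo \<phi>\<^sub>0)"
  obtain F where F: "(\<lambda>w. (\<Sum>a=1..k 0 - 1. ?c a * (1 / w) ^ (a - 1)) + 0) has_laurent_expansion F"
    "\<And>a. a \<ge> 1 \<Longrightarrow> F $$ (1 - int a) = (if a \<le> k 0 - 1 then ?c a else 0)"
    by (rule has_laurent_expansion_at_inf[where n = "k 0 - 1" and c = ?c, OF has_laurent_expansion_0 fls_vanishes_below_0]) blast
  have G: "?G $$ (- int (Suc a)) = ?c a" for a
  proof -
    have "?G $$ (- int (Suc a)) = (\<psi>\<^sub>0 ^ a * fps_X ^ (k 0 - \<gamma>)) $ k 0"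
      using pole_dlog_mult_coeff[of "Suc a"] by simp
    also have "\<dots> = ?c a" using \<gamma> by (auto simp: fps_X_power_mult_right_nth)
    finally show ?thesis .
  qed
  define e where "e = fls_X_inv ^ 2 * F - ?G"
  have e: "fls_vanishes_below (-1) e"
    unfolding fls_vanishes_below_def
  proof (intro allI impI)
    fix j :: int assume "j < -1"
    then obtain a where a: "j = - int (Suc a)" "a \<ge> 1" using that[of "nat (-j) - 1"] by auto
    have "(fls_X_inv ^ 2 * F) $$ j = F $$ (1 - int a)"
      unfolding fls_X_inv_power_times_conv_shift by (simp add: a)
    also have "\<dots> = ?c a"
    proof (cases "a \<le> k 0 - 1")
      case False
      then have "?c a = 0" using \<gamma> by (intro startsby_zero_power_prefix[rule_format]) auto
      then show ?thesis using F(2)[OF a(2)] False by simp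
    qed (use F(2)[OF a(2)] in simp)
    finally show "e $$ j = 0" using G[of a] by (simp add: e_def a(1))
  qed
  have "fls_X ^ 2 * fls_X_inv ^ 2 = (1 :: complex fls)"
    by (simp add: fls_inverse_X[symmetric] power_inverse)
  then have "fls_X ^ 2 * (?G + e) = F"
    unfolding e_def by (simp add: mult.assoc[symmetric])
  then show ?thesis using that[OF e] F(1) by (simp add: lam_deriv_def)
qed

lemma lam_deriv_inf_expansion_pole:
  assumes "fst x \<noteq> 0"
  obtains X where "(\<lambda>w. lam_deriv k t x (1 / w)) has_laurent_expansion X" "fls_vanishes_below 1 X"
proof -
  define c where "c = (\<lambda>a. of_nat (k (fst x)) * (cpsi k t (fst x) ^ (a - 1) * zco k (fst x) (snd x)) $ k (fst x))"
  have ex: "\<exists>g. (\<lambda>w. c a / (1 / w - t (fst x, 0)) ^ a) has_laurent_expansion g \<and> fls_vanishes_below 1 g"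
    if a: "a \<ge> 1" for a
  proof -
    obtain g where g: "(\<lambda>w. c a / (1 / w - t (fst x, 0)) ^ a) has_laurent_expansion fps_to_fls g" "g $ 0 = 0"
      by (rule has_laurent_expansion_polar_at_inf[OF a])
    then have "fls_vanishes_below 1 (fps_to_fls g)" by (auto simp: fls_vanishes_below_def)
    with g show ?thesis by blast
  qed
  define g where "g = (\<lambda>a. SOME g. (\<lambda>w. c a / (1 / w - t (fst x, 0)) ^ a) has_laurent_expansion g \<and> fls_vanishes_below 1 g)"
  have g: "(\<lambda>w. c a / (1 / w - t (fst x, 0)) ^ a) has_laurent_expansion g a" "fls_vanishes_below 1 (g a)" if "a \<ge> 1" for a
    using someI_ex[OF ex[OF that]] unfolding g_def by blast+
  have "(\<lambda>w. \<Sum>a=1..k (fst x) + 1. c a / (1 / w - t (fst x, 0)) ^ a) has_laurent_expansion (\<Sum>a=1..k (fst x) + 1. g a)"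
    by (intro has_laurent_expansion_sum g) simp
  moreover have "fls_vanishes_below 1 (\<Sum>a=1..k (fst x) + 1. g a)"
    by (intro fls_vanishes_below_sum g) simp
  ultimately show ?thesis using that assms by (simp add: lam_deriv_def c_def)
qed

lemma dlam_inverse_inf_expansion:
  obtains R where "(\<lambda>w. inverse (dlam (1 / w))) has_laurent_expansion R" "fls_vanishes_below (int (k 0) - 1) R"
proof -
  interpret local_parameter "\<phi>\<^sub>0" "\<psi>\<^sub>0" by (rule local_parameter_inf)
  obtain e where e: "fls_vanishes_below 0 e" "(\<lambda>w. dlam (1 / w)) has_laurent_expansion - (fls_X ^ 2 * (- K\<^sub>0 + e))"
    by (rule dlam_inf_expansion)
  have H: "- K\<^sub>0 + e \<noteq> 0" "fls_subdegree (- K\<^sub>0 + e) = - (int (k 0) + 1)"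
    by (rule fls_subdegree_perturb[OF pole_dlog_subdegree _ e(1)], simp)+
  have "fls_subdegree (- (fls_X ^ 2 * (- K\<^sub>0 + e))) = 1 - int (k 0)"
    unfolding fls_uminus_subdegree using H by (subst fls_subdegree_mult) auto
  then have "fls_vanishes_below (int (k 0) - 1) (inverse (- (fls_X ^ 2 * (- K\<^sub>0 + e))))"
    unfolding fls_vanishes_below_iff fls_inverse_subdegree by simp
  moreover have "(\<lambda>w. inverse (dlam (1 / w))) has_laurent_expansion inverse (- (fls_X ^ 2 * (- K\<^sub>0 + e)))"
    by (intro laurent_expansion_intros e(2))
  ultimately show ?thesis using that by blast
qed

text \<open>A count of orders in \<open>1/z\<close>: at least \<open>1 - k 0\<close> for
  \<open>x\<close>, 1 for \<open>y\<close>, 1 for \<open>1 / (z - p)\<close> and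
  \<open>k 0 - 1\<close> for \<open>1 / dlam\<close>. The sum 2 compensates the double pole of
  \<open>dz\<close>.\<close>

lemma residue_inf_mixed:
  assumes x: "x \<in> idx N k" and y: "fst y \<noteq> 0"
  shows "residue_inf (integrand x y) = 0"
proof -
  interpret local_parameter "\<phi>\<^sub>0" "\<psi>\<^sub>0" by (rule local_parameter_inf)
  obtain Y where Y: "(\<lambda>z. lam_deriv k t y (1 / z)) has_laurent_expansion Y" "fls_vanishes_below 1 Y"
    by (rule lam_deriv_inf_expansion_pole[OF y])
  obtain W where W: "(\<lambda>z. lam_deriv k t (N+1, 1) (1 / z)) has_laurent_expansion W" "fls_vanishes_below 1 W"
    by (rule lam_deriv_inf_expansion_pole[of "(N+1, 1)"]) simp
  obtain R where R: "(\<lambda>w. inverse (dlam (1 / w))) has_laurent_expansion R" "fls_vanishes_below (int (k 0) - 1) R"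
    by (rule dlam_inverse_inf_expansion)
  obtain X where X: "(\<lambda>z. lam_deriv k t x (1 / z)) has_laurent_expansion X" "fls_vanishes_below (1 - int (k 0)) X"
    using x
  proof (cases rule: idxE)
    case (inf \<gamma>)
    obtain e where e: "fls_vanishes_below (-1) e"
      "(\<lambda>w. lam_deriv k t (0, \<gamma>) (1 / w)) has_laurent_expansion
         fls_X ^ 2 * (K\<^sub>0 * fps_to_fls (fps_X ^ (k 0 - \<gamma>) oo \<phi>\<^sub>0) + e)"
      by (rule lam_deriv_inf_expansion[OF inf(2)])
    have "fls_vanishes_below (- (int (k 0) + 1)) (K\<^sub>0 * fps_to_fls (fps_X ^ (k 0 - \<gamma>) oo \<phi>\<^sub>0))"
      by (rule fls_vanishes_below_mult_le[OF _ fls_vanishes_below_fps[OF order.refl], of "- (int (k 0) + 1)"])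
        (simp_all add: fls_vanishes_below_iff pole_dlog_subdegree)
    then have "fls_vanishes_below (- (int (k 0) + 1)) (K\<^sub>0 * fps_to_fls (fps_X ^ (k 0 - \<gamma>) oo \<phi>\<^sub>0) + e)"
      using fls_vanishes_below_mono[OF e(1)] by (intro fls_vanishes_below_add) auto
    then have "fls_vanishes_below (1 - int (k 0)) (fls_X ^ 2 * (K\<^sub>0 * fps_to_fls (fps_X ^ (k 0 - \<gamma>) oo \<phi>\<^sub>0) + e))"
      by (intro fls_vanishes_below_mult_le[of 2]) (auto simp: fls_vanishes_below_def)
    with e(2) inf that show ?thesis by blast
  next
    case (pole i \<alpha>)
    obtain X where "(\<lambda>z. lam_deriv k t x (1 / z)) has_laurent_expansion X" "fls_vanishes_below 1 X"
      using lam_deriv_inf_expansion_pole[of x] pole by auto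
    then show ?thesis using that fls_vanishes_below_mono[of 1 X "1 - int (k 0)"] by auto
  qed
  have "fls_vanishes_below 2 (X * Y * W * R)"
    by (rule fls_vanishes_below_mult_le[OF fls_vanishes_below_mult[OF fls_vanishes_below_mult[OF X(2) Y(2)] W(2)] R(2)]) auto
  then have "fls_residue (X * Y * W * R / fls_X ^ 2) = 0" by (simp add: fls_vanishes_below_def)
  moreover have "(\<lambda>z. integrand x y (1 / z)) has_laurent_expansion X * Y * W * R"
    unfolding integrand_def divide_inverse[of _ "dlam _"] by (intro has_laurent_expansion_mult X Y W R)
  ultimately show ?thesis using residue_inf_expansion[of "integrand x y"] by (simp only: minus_zero)
qed

text \<open>The same cancellation as at the finite poles, with an error one order worse; the zero of
  \<open>1 / (z - p)\<close> at infinity makes up for it.\<close>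

lemma residue_inf_own:
  assumes \<gamma>: "\<gamma> \<in> {1..k 0 - 1}" and \<delta>: "\<delta> \<in> {1..k 0 - 1}"
  shows "residue_inf (integrand (0, \<gamma>) (0, \<delta>))
    = - ((fps_X ^ (k 0 - \<gamma>) * fps_X ^ (k 0 - \<delta>) * (\<psi>\<^sub>0 * inverse (1 - fps_const (t (N+1, 0)) * \<psi>\<^sub>0))) $ k 0)"
proof -
  interpret local_parameter "\<phi>\<^sub>0" "\<psi>\<^sub>0" by (rule local_parameter_inf)
  define p where "p = t (N+1, 0)"
  let ?A = "fps_to_fls (fps_X ^ (k 0 - \<gamma>) oo \<phi>\<^sub>0)" and ?B = "fps_to_fls (fps_X ^ (k 0 - \<delta>) oo \<phi>\<^sub>0)"
    and ?C = "fps_to_fls (fps_X * inverse (1 - fps_const p * fps_X))"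
  obtain e1 where X: "fls_vanishes_below (-1) e1"
    "(\<lambda>w. lam_deriv k t (0, \<gamma>) (1 / w)) has_laurent_expansion fls_X ^ 2 * (K\<^sub>0 * ?A + e1)"
    by (rule lam_deriv_inf_expansion[OF \<gamma>])
  obtain e2 where Y: "fls_vanishes_below (-1) e2"
    "(\<lambda>w. lam_deriv k t (0, \<delta>) (1 / w)) has_laurent_expansion fls_X ^ 2 * (K\<^sub>0 * ?B + e2)"
    by (rule lam_deriv_inf_expansion[OF \<delta>])
  obtain e3 where D: "fls_vanishes_below 0 e3" "(\<lambda>w. dlam (1 / w)) has_laurent_expansion - (fls_X ^ 2 * (- K\<^sub>0 + e3))"
    by (rule dlam_inf_expansion)
  have W: "(\<lambda>w. lam_deriv k t (N+1, 1) (1 / w)) has_laurent_expansion ?C"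
  proof -
    have "(\<lambda>w. 1 - p * w) has_fps_expansion 1 - fps_const p * fps_X" by (intro fps_expansion_intros)
    then have "(\<lambda>w. w * inverse (1 - p * w)) has_fps_expansion fps_X * inverse (1 - fps_const p * fps_X)"
      by (intro fps_expansion_intros has_fps_expansion_inverse) simp_all
    then have "(\<lambda>w. w * inverse (1 - p * w)) has_laurent_expansion ?C" by (rule has_laurent_expansion_fps)
    moreover have "\<forall>\<^sub>F w in at 0. w * inverse (1 - p * w) = lam_deriv k t (N+1, 1) (1 / w)"
    proof -
      have "\<forall>\<^sub>F w in at (0::complex). w \<noteq> 0" by (simp add: eventually_at_filter)
      then show ?thesis
      proof eventually_elim
        case (elim w)
        have "1 / w - p = (1 - p * w) / w" using elim by (simp add: field_simps)
        then show ?case using lam_deriv_simple_pole[of "N+1" "1 / w"] by (simp add: p_def divide_inverse)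
      qed
    qed
    ultimately show ?thesis by (rule has_laurent_expansion_transform)
  qed
  define Q where "Q = (K\<^sub>0 * ?A + e1) * (K\<^sub>0 * ?B + e2) / (- K\<^sub>0 + e3) + K\<^sub>0 * ?A * ?B"
  have Q: "fls_vanishes_below (-1) Q"
    unfolding Q_def by (rule fls_polar_quotient[where n = "int (k 0) + 1"]) (use pole_dlog_subdegree X Y D in auto)
  have X2: "(fls_X ^ 2 :: complex fls) \<noteq> 0" by simp
  \<comment> \<open>With \<open>S\<close> the square of \<open>1/z\<close>: two factors come from
    the derivatives of \<open>\<lambda>\<close>, one is cancelled by \<open>dlam\<close> and the
    other by \<open>dz\<close>.\<close>
  have alg: "S * a * (S * b) * c / (- (S * h)) / S = - (a * b / h * c)" if "S \<noteq> 0" for S a b c h :: "complex fls"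
    using that by (simp add: field_simps)
  have eq: "fls_X ^ 2 * (K\<^sub>0 * ?A + e1) * (fls_X ^ 2 * (K\<^sub>0 * ?B + e2)) * ?C / (- (fls_X ^ 2 * (- K\<^sub>0 + e3))) / fls_X ^ 2
      = K\<^sub>0 * (?A * ?B * ?C) - Q * ?C"
  proof -
    have "fls_X ^ 2 * (K\<^sub>0 * ?A + e1) * (fls_X ^ 2 * (K\<^sub>0 * ?B + e2)) * ?C / (- (fls_X ^ 2 * (- K\<^sub>0 + e3))) / fls_X ^ 2
      = - ((K\<^sub>0 * ?A + e1) * (K\<^sub>0 * ?B + e2) / (- K\<^sub>0 + e3) * ?C)"
      by (rule alg[OF X2])
    also have "(K\<^sub>0 * ?A + e1) * (K\<^sub>0 * ?B + e2) / (- K\<^sub>0 + e3) = Q - K\<^sub>0 * ?A * ?B" by (simp add: Q_def)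
    also have "- ((Q - K\<^sub>0 * ?A * ?B) * ?C) = K\<^sub>0 * (?A * ?B * ?C) - Q * ?C"
      by (simp add: left_diff_distrib mult.assoc)
    finally show ?thesis .
  qed
  let ?G = "fps_X ^ (k 0 - \<gamma>) * fps_X ^ (k 0 - \<delta>) * (\<psi>\<^sub>0 * inverse (1 - fps_const p * \<psi>\<^sub>0))"
  have "?G oo \<phi>\<^sub>0 = (fps_X ^ (k 0 - \<gamma>) oo \<phi>\<^sub>0) * (fps_X ^ (k 0 - \<delta>) oo \<phi>\<^sub>0) * (fps_X * inverse (1 - fps_const p * fps_X))"
  proof -
    have "inverse (1 - fps_const p * \<psi>\<^sub>0) oo \<phi>\<^sub>0 = inverse ((1 - fps_const p * \<psi>\<^sub>0) oo \<phi>\<^sub>0)"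
      by (intro fps_inverse_compose phi0) simp
    also have "(1 - fps_const p * \<psi>\<^sub>0) oo \<phi>\<^sub>0 = 1 - fps_const p * fps_X"
      by (simp only: fps_compose_sub_distrib compose_mult psi_phi fps_const_compose fps_compose_1)
    finally show ?thesis by (simp only: compose_mult psi_phi)
  qed
  then have ABC: "?A * ?B * ?C = fps_to_fls (?G oo \<phi>\<^sub>0)" by (simp only: fls_times_fps_to_fls)
  have "fls_vanishes_below 1 ?C" by (auto simp: fls_vanishes_below_def)
  then have "fls_vanishes_below 0 (Q * ?C)"
    using Q by (intro fls_vanishes_below_mult_le[of "-1" _ 1]) auto
  then have 1: "fls_residue (Q * ?C) = 0" by (rule fls_vanishes_below_residue)
  have 2: "fls_residue (K\<^sub>0 * fps_to_fls (?G oo \<phi>\<^sub>0)) = ?G $ k 0"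
    by (rule pole_dlog_mult_residue)
  have 3: "fls_residue (a - b) = fls_residue a - fls_residue b" for a b :: "complex fls" by simp
  have res: "fls_residue (K\<^sub>0 * (?A * ?B * ?C) - Q * ?C) = ?G $ k 0"
    unfolding ABC 3 1 2 by simp
  have "(\<lambda>w. integrand (0, \<gamma>) (0, \<delta>) (1 / w)) has_laurent_expansion
      fls_X ^ 2 * (K\<^sub>0 * ?A + e1) * (fls_X ^ 2 * (K\<^sub>0 * ?B + e2)) * ?C / (- (fls_X ^ 2 * (- K\<^sub>0 + e3)))"
    unfolding integrand_def by (intro laurent_expansion_intros X Y W D)
  from residue_inf_expansion[OF this] show ?thesis unfolding eq res unfolding p_def .
qed

end

section \<open>The slice on which the last pole is a pure power\<close>

definition lam_regular :: "nat \<Rightarrow> (nat \<Rightarrow> nat) \<Rightarrow> point \<Rightarrow> complex \<Rightarrow> complex" where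
  "lam_regular N k t z = lam_poly k t z + (\<Sum>i=1..N. lam_polar k t i z)"

lemma lam_regular_analytic:
  assumes "\<And>j. j \<in> {1..N} \<Longrightarrow> z \<noteq> t (j, 0)" "k 0 \<ge> 1"
  shows "lam_regular N k t analytic_on {z}"
  unfolding lam_regular_def[abs_def] lam_poly_def lam_polar_def using assms by (intro analytic_intros) auto

text \<open>The points at which \<open>\<lambda>\<close> is \<open>lam_regular N k t\<close> plus a multiple of \<open>(z - p)\<^sup>-\<^sup>k\<close>, where
  \<open>p = t\<^sub>N\<^sub>+\<^sub>1\<^sub>,\<^sub>0\<close> and \<open>k = k (N+1)\<close>.\<close>

locale slice_point = flat_point +
  assumes kN: "k (N+1) \<ge> 2" and slice: "\<And>a. a \<in> {1..<k (N+1)} \<Longrightarrow> t (N+1, a) = 0"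
begin

abbreviation p where "p \<equiv> t (N+1, 0)"
abbreviation \<kappa> where "\<kappa> \<equiv> k (N+1)"

definition c :: complex where "c = t (N+1, \<kappa>) / of_nat \<kappa>"

lemma c_nz: "c \<noteq> 0"
  using t kN by (auto simp: c_def flat_dom_def)

text \<open>What the slice achieves: \<open>z - p\<close> is exactly a multiple of \<open>w\<close>,
  so the expansions of the singular derivatives at \<open>p\<close> are monomials without error
  terms.\<close>

lemma psi_slice: "\<psi> (N+1) = fps_const c * fps_X"
proof (rule fps_ext)
  fix m
  have "m \<in> {2..\<kappa>} \<Longrightarrow> t (N+1, \<kappa> + 1 - m) = 0" by (intro slice) auto
  then show "\<psi> (N+1) $ m = (fps_const c * fps_X) $ m"
    using kN by (cases "m = 0 \<or> m = 1") (auto simp: cpsi_def c_def)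
qed

lemma psi_slice_power: "(\<psi> (N+1) ^ b * (fps_const d * fps_X ^ m)) $ n = (if n = b + m then c ^ b * d else 0)"
proof -
  have "\<psi> (N+1) ^ b * (fps_const d * fps_X ^ m) = fps_const (c ^ b * d) * fps_X ^ (b + m)"
  proof -
    have "\<psi> (N+1) ^ b = fps_const (c ^ b) * fps_X ^ b"
      by (simp only: psi_slice power_mult_distrib fps_const_power)
    then show ?thesis by (simp only: power_add fps_const_mult[symmetric] mult_ac)
  qed
  then show ?thesis by simp
qed

lemma lam_slice: "lam N k (vpar N k t) z = lam_regular N k t z + c ^ \<kappa> / (z - p) ^ \<kappa>"
proof -
  have "lam_polar k t (N+1) z = (\<Sum>a=1..\<kappa>. if a = \<kappa> then c ^ \<kappa> / (z - p) ^ \<kappa> else 0)"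
    unfolding lam_polar_def
  proof (intro sum.cong refl)
    fix a assume "a \<in> {1..\<kappa>}"
    then show "polar_coeff \<kappa> (\<psi> (N+1)) a / (z - p) ^ a = (if a = \<kappa> then c ^ \<kappa> / (z - p) ^ \<kappa> else 0)"
      using psi_slice_power[of a 1 0 \<kappa>] by (auto simp: polar_coeff_def)
  qed
  also have "\<dots> = c ^ \<kappa> / (z - p) ^ \<kappa>" using kN by simp
  finally show ?thesis by (simp add: lam_vpar lam_regular_def)
qed

lemma lam_deriv_slice_center: "lam_deriv k t (N+1, 0) z = of_nat \<kappa> * c ^ \<kappa> / (z - p) ^ Suc \<kappa>"
proof -
  have "lam_deriv k t (N+1, 0) z = (\<Sum>a=1..\<kappa> + 1. of_nat \<kappa> * (\<psi> (N+1) ^ (a - 1) * zco k (N+1) 0) $ \<kappa> / (z - p) ^ a)"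
    by (simp add: lam_deriv_def)
  also have "\<dots> = (\<Sum>a=1..\<kappa> + 1. if a = Suc \<kappa> then of_nat \<kappa> * c ^ \<kappa> / (z - p) ^ Suc \<kappa> else 0)"
  proof (intro sum.cong refl)
    fix a assume a: "a \<in> {1..\<kappa> + 1}"
    have "zco k (N+1) 0 = fps_const 1 * fps_X ^ 0" by (simp add: zco_def)
    then show "of_nat \<kappa> * (\<psi> (N+1) ^ (a - 1) * zco k (N+1) 0) $ \<kappa> / (z - p) ^ a
        = (if a = Suc \<kappa> then of_nat \<kappa> * c ^ \<kappa> / (z - p) ^ Suc \<kappa> else 0)"
      using a by (simp only: psi_slice_power) auto
  qed
  also have "\<dots> = of_nat \<kappa> * c ^ \<kappa> / (z - p) ^ Suc \<kappa>" by simp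
  finally show ?thesis .
qed

lemma lam_deriv_slice_top: "lam_deriv k t (N+1, \<kappa>) z = c ^ (\<kappa> - 1) / (z - p) ^ \<kappa>"
proof -
  have "lam_deriv k t (N+1, \<kappa>) z = (\<Sum>a=1..\<kappa> + 1. of_nat \<kappa> * (\<psi> (N+1) ^ (a - 1) * zco k (N+1) \<kappa>) $ \<kappa> / (z - p) ^ a)"
    by (simp add: lam_deriv_def)
  also have "\<dots> = (\<Sum>a=1..\<kappa> + 1. if a = \<kappa> then c ^ (\<kappa> - 1) / (z - p) ^ \<kappa> else 0)"
  proof (intro sum.cong refl)
    fix a assume a: "a \<in> {1..\<kappa> + 1}"
    have "zco k (N+1) \<kappa> = fps_const (1 / of_nat \<kappa>) * fps_X ^ 1" using kN by (simp add: zco_def)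
    then show "of_nat \<kappa> * (\<psi> (N+1) ^ (a - 1) * zco k (N+1) \<kappa>) $ \<kappa> / (z - p) ^ a
        = (if a = \<kappa> then c ^ (\<kappa> - 1) / (z - p) ^ \<kappa> else 0)"
      using a kN by (simp only: psi_slice_power) auto
  qed
  also have "\<dots> = c ^ (\<kappa> - 1) / (z - p) ^ \<kappa>" using kN by simp
  finally show ?thesis .
qed

text \<open>Full expansions at \<open>p\<close> of the derivatives in the centre and in the top
  coordinate; \<open>- center_polar\<close> is moreover the whole polar part of
  \<open>dlam\<close>.\<close>

definition center_polar where "center_polar = fls_const (of_nat \<kappa> * c ^ \<kappa>) * fls_X_inv ^ Suc \<kappa>"
definition top_polar where "top_polar = fls_const (c ^ (\<kappa> - 1)) * fls_X_inv ^ \<kappa>"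

text \<open>Since \<open>dlam\<close> expands as \<open>fps_to_fls d - center_polar\<close>, the
  reciprocal \<open>R\<close> satisfies the stated identity, which trades a factor
  \<open>center_polar\<close> of the integrand for a series of higher order and the constant
  -1.\<close>

lemma dlam_slice_expansion:
  obtains d R where "(\<lambda>u. inverse (dlam (p + u))) has_laurent_expansion R" "fls_vanishes_below (int \<kappa> + 1) R"
    "center_polar * R = fps_to_fls d * R - 1" "d $ 0 = deriv (lam_regular N k t) p"
proof -
  have an: "lam_regular N k t analytic_on {p}"
    using distinct[of "N+1"] k0 by (intro lam_regular_analytic) auto
  then obtain F where F: "(\<lambda>u. lam_regular N k t (p + u)) has_fps_expansion F"
    using analytic_at_imp_has_fps_expansion by blast
  define d where "d = fps_deriv F"
  have "deriv (\<lambda>u. lam_regular N k t (p + u)) has_fps_expansion d"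
    unfolding d_def by (intro fps_expansion_intros F)
  then have dx: "(\<lambda>u. deriv (lam_regular N k t) (p + u)) has_fps_expansion d" by (simp only: deriv_shift)
  have d0: "d $ 0 = deriv (lam_regular N k t) p"
    using has_fps_expansion_imp_0_eq_fps_nth_0[OF dx] by simp
  have "(\<lambda>u. lam_regular N k t (p + u) + c ^ \<kappa> / u ^ \<kappa>) has_laurent_expansion
      fps_to_fls F + fls_const (c ^ \<kappa>) * fls_X_inv ^ \<kappa>"
    by (intro has_laurent_expansion_add has_laurent_expansion_fps F has_laurent_expansion_power_inverse)
  then have "(\<lambda>u. lam N k (vpar N k t) (p + u)) has_laurent_expansion fps_to_fls F + fls_const (c ^ \<kappa>) * fls_X_inv ^ \<kappa>"
    by (simp only: lam_slice add_diff_cancel_left')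
  from has_laurent_expansion_deriv[OF this]
  have "(\<lambda>u. dlam (p + u)) has_laurent_expansion fls_deriv (fps_to_fls F + fls_const (c ^ \<kappa>) * fls_X_inv ^ \<kappa>)"
    by (simp only: deriv_shift)
  also have "fls_deriv (fps_to_fls F + fls_const (c ^ \<kappa>) * fls_X_inv ^ \<kappa>) = fps_to_fls d - center_polar"
  proof (rule fls_eqI)
    fix j
    show "fls_deriv (fps_to_fls F + fls_const (c ^ \<kappa>) * fls_X_inv ^ \<kappa>) $$ j = (fps_to_fls d - center_polar) $$ j"
      unfolding d_def center_polar_def fls_deriv_fps_to_fls[symmetric] by (auto simp del: power_Suc)
  qed
  finally have D: "(\<lambda>u. dlam (p + u)) has_laurent_expansion fps_to_fls d - center_polar" .
  have b: "of_nat \<kappa> * c ^ \<kappa> \<noteq> 0" using kN c_nz by simp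
  have center_polar: "center_polar \<noteq> 0" "fls_subdegree center_polar = - (int \<kappa> + 1)"
  proof -
    have "center_polar $$ (- int (Suc \<kappa>)) \<noteq> 0" using b c_nz by (simp add: center_polar_def del: power_Suc)
    then show "center_polar \<noteq> 0" by (metis fls_zero_nth)
    show "fls_subdegree center_polar = - (int \<kappa> + 1)"
      using \<open>center_polar $$ (- int (Suc \<kappa>)) \<noteq> 0\<close> by (intro fls_subdegree_eqI) (auto simp: center_polar_def simp del: power_Suc)
  qed
  have H: "- center_polar + fps_to_fls d \<noteq> 0" "fls_subdegree (- center_polar + fps_to_fls d) = - (int \<kappa> + 1)"
    by (rule fls_subdegree_perturb[OF center_polar], simp, simp)+
  define R where "R = inverse (fps_to_fls d - center_polar)"
  have H': "fps_to_fls d - center_polar \<noteq> 0" using H(1) by simp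
  show ?thesis
  proof
    show "(\<lambda>u. inverse (dlam (p + u))) has_laurent_expansion R"
      unfolding R_def by (intro laurent_expansion_intros D)
    have "fls_subdegree (fps_to_fls d - center_polar) = - (int \<kappa> + 1)" using H(2) by (simp add: del: power_Suc)
    then show "fls_vanishes_below (int \<kappa> + 1) R"
      unfolding R_def fls_vanishes_below_iff fls_inverse_subdegree by simp
    have "(fps_to_fls d - center_polar) * R = 1" unfolding R_def using H' by (rule right_inverse)
    then show "center_polar * R = fps_to_fls d * R - 1" by (simp only: left_diff_distrib) (simp add: algebra_simps del: power_Suc)
  qed (rule d0)
qed

lemma simple_pole_expansion: "(\<lambda>u. lam_deriv k t (N+1, 1) (p + u)) has_laurent_expansion fls_X_inv"
proof -
  have "lam_deriv k t (N+1, 1) z = 1 / (z - p)" for z by (rule lam_deriv_simple_pole) simp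
  then show ?thesis
    using has_laurent_expansion_power_inverse[of 1 1]
    by (simp only: add_diff_cancel_left' power_one_right fls_const_1 mult_1_left)
qed

lemma center_expansion: "(\<lambda>u. lam_deriv k t (N+1, 0) (p + u)) has_laurent_expansion center_polar"
  and top_expansion: "(\<lambda>u. lam_deriv k t (N+1, \<kappa>) (p + u)) has_laurent_expansion top_polar"
  by (simp_all only: center_polar_def top_polar_def lam_deriv_slice_center lam_deriv_slice_top add_diff_cancel_left'
      has_laurent_expansion_power_inverse)

text \<open>Orders add up to \<open>- \<kappa> - 1 + (\<kappa> + 1) = 0\<close>, so any factor
  \<open>A\<close> with a pole of order at most \<open>\<kappa>\<close> yields no residue.\<close>

lemma residue_slice_zero:
  fixes A R :: "complex fls"
  assumes "fls_vanishes_below (- int \<kappa>) A" "fls_vanishes_below (int \<kappa> + 1) R"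
  shows "fls_residue (A * fls_X_inv * R) = 0"
proof -
  have "fls_vanishes_below (-1) (fls_X_inv :: complex fls)" by (simp add: fls_vanishes_below_def)
  then have "fls_vanishes_below 0 (A * fls_X_inv * R)"
    by (rule fls_vanishes_below_mult_le[OF fls_vanishes_below_mult[OF assms(1)] assms(2)]) simp
  then show ?thesis by (rule fls_vanishes_below_residue)
qed

lemma top_polar_vanishes_below: "fls_vanishes_below (- int \<kappa>) top_polar"
  by (simp add: top_polar_def fls_vanishes_below_def)

text \<open>Only a factor \<open>center_polar\<close> exceeds the order allowed by
  \<open>residue_slice_zero\<close>. After the trade \<open>center_polar * R = d R - 1\<close> the
  remaining residue is that of \<open>- g / u\<close>, the value at \<open>p\<close> up to
  sign.\<close>

lemma residue_slice_center_regular: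
  assumes x: "x \<in> idx N k" "fst x \<le> N"
  shows "residue (integrand x (N+1, 0)) p = - lam_deriv k t x p"
    "residue (integrand x (N+1, \<kappa>)) p = 0"
    "y \<in> idx N k \<Longrightarrow> fst y \<le> N \<Longrightarrow> residue (integrand x y) p = 0"
proof -
  have i: "N+1 \<in> {1..N+1}" by simp
  obtain g where g: "(\<lambda>u. lam_deriv k t x (p + u)) has_laurent_expansion fps_to_fls g" "g $ 0 = lam_deriv k t x p"
    by (rule lam_deriv_expansion_other[OF i x(1)]) (use x in auto)
  obtain d R where R: "(\<lambda>u. inverse (dlam (p + u))) has_laurent_expansion R" "fls_vanishes_below (int \<kappa> + 1) R"
    "center_polar * R = fps_to_fls d * R - 1"
    by (rule dlam_slice_expansion)
  have fps: "fls_vanishes_below (- int \<kappa>) (fps_to_fls f)" for f :: "complex fps" by simp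
  show "residue (integrand x (N+1, 0)) p = - lam_deriv k t x p"
  proof -
    have "fps_to_fls g * center_polar * fls_X_inv * R = fls_X_inv * (fps_to_fls g * (center_polar * R))" by (simp only: mult_ac)
    also have "\<dots> = fps_to_fls (g * d) * fls_X_inv * R - fls_X_inv * fps_to_fls g"
      unfolding R(3) by (simp add: algebra_simps fls_times_fps_to_fls)
    finally have "fls_residue (fps_to_fls g * center_polar * fls_X_inv * R) = 0 - g $ 0"
      using residue_slice_zero[OF fps R(2), of "g * d"] by (simp add: fls_X_inv_times_conv_shift)
    then show ?thesis
      unfolding residue_integrand[OF g(1) center_expansion simple_pole_expansion R(1)] g(2) by simp
  qed
  show "residue (integrand x (N+1, \<kappa>)) p = 0"
    unfolding residue_integrand[OF g(1) top_expansion simple_pole_expansion R(1)]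
    by (rule residue_slice_zero[OF fls_vanishes_below_mult_le[OF fls_vanishes_below_fps[OF order.refl] top_polar_vanishes_below] R(2)]) simp
  show "residue (integrand x y) p = 0" if y: "y \<in> idx N k" "fst y \<le> N"
  proof -
    obtain h where h: "(\<lambda>u. lam_deriv k t y (p + u)) has_laurent_expansion fps_to_fls h"
      by (rule lam_deriv_expansion_other[OF i y(1)]) (use y in auto)
    show ?thesis
      unfolding residue_integrand[OF g(1) h simple_pole_expansion R(1)] fls_times_fps_to_fls[symmetric]
      by (rule residue_slice_zero[OF fps R(2)])
  qed
qed

text \<open>The trade of \<open>dlam_slice_expansion\<close> is made twice for the square of
  \<open>center_polar\<close>, leaving \<open>- d $ 0\<close>. The monomials split off on the way
  have poles of order above 1 and hence no residue.\<close>

lemma residue_slice_center_singular: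
  shows "residue (integrand (N+1, 0) (N+1, 0)) p = - deriv (lam_regular N k t) p"
    and "residue (integrand (N+1, \<kappa>) (N+1, 0)) p = 0"
    and "residue (integrand (N+1, \<kappa>) (N+1, \<kappa>)) p = 0"
proof -
  obtain d R where R: "(\<lambda>u. inverse (dlam (p + u))) has_laurent_expansion R" "fls_vanishes_below (int \<kappa> + 1) R"
    "center_polar * R = fps_to_fls d * R - 1" "d $ 0 = deriv (lam_regular N k t) p"
    by (rule dlam_slice_expansion)
  define D where "D = fps_to_fls d"
  have D0: "fls_vanishes_below 0 D" by (simp add: D_def)
  have mono: "fls_residue (fls_X_inv * (fls_const a * fls_X_inv ^ m)) = 0" if "m > 0" for a :: complex and m
    using that by (simp add: fls_X_inv_times_conv_shift)
  have reduce: "fls_residue (A * center_polar * fls_X_inv * R) = - fls_residue (fls_X_inv * A)"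
    if A: "fls_vanishes_below (- int \<kappa>) A" for A
  proof -
    have "A * center_polar * fls_X_inv * R = fls_X_inv * A * (center_polar * R)" by (simp only: mult_ac)
    also have "\<dots> = A * D * fls_X_inv * R - fls_X_inv * A"
      unfolding R(3) D_def by (simp only: right_diff_distrib mult_ac mult_1_left mult_1_right)
    finally show ?thesis
      using residue_slice_zero[OF fls_vanishes_below_mult_le[OF A D0] R(2)] by simp
  qed
  show "residue (integrand (N+1, 0) (N+1, 0)) p = - deriv (lam_regular N k t) p"
  proof -
    have "center_polar * center_polar * fls_X_inv * R = fls_X_inv * center_polar * (center_polar * R)" by (simp only: mult_ac)
    also have "\<dots> = D * center_polar * fls_X_inv * R - fls_X_inv * center_polar"
      unfolding R(3) D_def by (simp only: right_diff_distrib mult_ac mult_1_left mult_1_right)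
    finally have "fls_residue (center_polar * center_polar * fls_X_inv * R) = fls_residue (D * center_polar * fls_X_inv * R)"
      using mono[of "Suc \<kappa>" "of_nat \<kappa> * c ^ \<kappa>"] unfolding center_polar_def[symmetric] by simp
    also have "\<dots> = - (d $ 0)"
      using fls_vanishes_below_mono[OF D0] reduce[of D] by (simp add: D_def fls_X_inv_times_conv_shift)
    finally show ?thesis
      unfolding residue_integrand[OF center_expansion center_expansion simple_pole_expansion R(1)] R(4)[symmetric] .
  qed
  show "residue (integrand (N+1, \<kappa>) (N+1, 0)) p = 0"
  proof -
    have "fls_residue (fls_X_inv * top_polar) = 0" unfolding top_polar_def using kN by (intro mono) simp
    then show ?thesis
      unfolding residue_integrand[OF top_expansion center_expansion simple_pole_expansion R(1)]
        reduce[OF top_polar_vanishes_below] by (simp only: minus_zero)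
  qed
  show "residue (integrand (N+1, \<kappa>) (N+1, \<kappa>)) p = 0"
  proof -
    \<comment> \<open>Chosen to make \<open>top_polar * top_polar\<close> equal to
      \<open>E * center_polar\<close>, in accordance with
      \<open>2 \<kappa> = (\<kappa> - 1) + (\<kappa> + 1)\<close>. As
      \<open>\<kappa> \<ge> 2\<close>, the series \<open>E / u\<close> has a pole of order at least
      2.\<close>
    define b where "b = c ^ (\<kappa> - 1) / (of_nat \<kappa> * c ^ \<kappa>) * c ^ (\<kappa> - 1)"
    define E where "E = fls_const b * fls_X_inv ^ (\<kappa> - 1)"
    have bc: "c ^ (\<kappa> - 1) * c ^ (\<kappa> - 1) = b * (of_nat \<kappa> * c ^ \<kappa>)" using kN c_nz by (simp add: b_def)
    have "top_polar * top_polar = fls_const (c ^ (\<kappa> - 1) * c ^ (\<kappa> - 1)) * fls_X_inv ^ (\<kappa> + \<kappa>)"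
      by (simp only: top_polar_def fls_const_mult_const[symmetric] power_add mult_ac)
    also have "\<kappa> + \<kappa> = (\<kappa> - 1) + Suc \<kappa>" using kN by simp
    also have "fls_const (c ^ (\<kappa> - 1) * c ^ (\<kappa> - 1)) * fls_X_inv ^ ((\<kappa> - 1) + Suc \<kappa>) = E * center_polar"
      unfolding bc by (simp only: E_def center_polar_def fls_const_mult_const[symmetric] power_add mult_ac)
    finally have CC: "top_polar * top_polar = E * center_polar" .
    have E: "fls_vanishes_below (- int \<kappa>) E" using kN by (simp add: E_def fls_vanishes_below_def)
    have "fls_residue (fls_X_inv * E) = 0" unfolding E_def using kN by (intro mono) simp
    then show ?thesis
      unfolding residue_integrand[OF top_expansion top_expansion simple_pole_expansion R(1)] CC reduce[OF E]
      by (simp only: minus_zero)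
  qed
qed

end

section \<open>Closed form of the three-tensor on the slice\<close>

lemma triple_commute: "triple N k t x y w = triple N k t y x w"
proof -
  have "pd x f t * pd y f t = pd y f t * pd x f t" for f by (rule mult.commute)
  then show ?thesis unfolding triple_def by (simp only:)
qed

lemma residue_inf_cong:
  assumes "\<forall>\<^sub>F z in at_infinity. f z = g z"
  shows "residue_inf f = residue_inf g"
proof -
  have "filterlim inverse at_infinity (at (0::complex))" by (rule filterlim_inverse_at_infinity)
  from eventually_compose_filterlim[OF assms this]
  have "\<forall>\<^sub>F w in at 0. f (1 / w) / w ^ 2 = g (1 / w) / w ^ 2"
    by eventually_elim (simp add: inverse_eq_divide)
  then show ?thesis unfolding residue_inf_def by (simp add: residue_cong)
qed

context slice_point
begin

text \<open>The derivatives of \<open>lam_flat\<close> are known off the poles only. That suffices,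
  since a residue depends on the function in a punctured neighbourhood.\<close>

lemma triple_residues:
  assumes x: "x \<in> idx N k" and y: "y \<in> idx N k"
  shows "triple N k t x y (N+1, 1) = - (residue_inf (integrand x y) + (\<Sum>i=1..N+1. residue (integrand x y) (t (i, 0))))"
proof -
  have w: "(N+1, 1) \<in> idx N k" using kN by (auto simp: idx_def)
  define f where "f = (\<lambda>z. pd x (lam_flat N k z) t * pd y (lam_flat N k z) t * pd (N+1, 1) (lam_flat N k z) t
                     / deriv (\<lambda>z. lam_flat N k z t) z)"
  have dl: "deriv (\<lambda>z. lam_flat N k z t) = dlam" using t by (simp add: lam_flat_def params_eq)
  have fg: "f z = integrand x y z" if "\<forall>i\<in>{1..N+1}. z \<noteq> t (i, 0)" for z
  proof -
    have z: "\<And>i. i \<in> {1..N+1} \<Longrightarrow> z \<noteq> t (i, 0)" using that by blast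
    have "pd x (lam_flat N k z) t = lam_deriv k t x z" by (rule pd_lam_flat[OF t x z])
    moreover have "pd y (lam_flat N k z) t = lam_deriv k t y z" by (rule pd_lam_flat[OF t y z])
    moreover have "pd (N+1, 1) (lam_flat N k z) t = lam_deriv k t (N+1, 1) z" by (rule pd_lam_flat[OF t w z])
    ultimately show ?thesis by (simp only: f_def integrand_def dl)
  qed
  have "\<forall>\<^sub>F z in at_infinity. \<forall>i\<in>{1..N+1}. z \<noteq> t (i, 0)"
  proof (intro eventually_ball_finite ballI)
    fix j
    show "\<forall>\<^sub>F z in at_infinity. z \<noteq> t (j, 0)"
      unfolding eventually_at_infinity by (rule exI[of _ "norm (t (j, 0)) + 1"]) auto
  qed simp
  then have "\<forall>\<^sub>F z in at_infinity. f z = integrand x y z" by eventually_elim (rule fg)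
  then have 1: "residue_inf f = residue_inf (integrand x y)" by (rule residue_inf_cong)
  have 2: "residue f (t (i, 0)) = residue (integrand x y) (t (i, 0))" if i: "i \<in> {1..N+1}" for i
  proof (rule residue_cong[OF _ refl])
    have "\<forall>\<^sub>F z in at (t (i, 0)). \<forall>j\<in>{1..N+1}. z \<noteq> t (j, 0)"
    proof (intro eventually_ball_finite ballI)
      fix j
      show "\<forall>\<^sub>F z in at (t (i, 0)). z \<noteq> t (j, 0)"
        by (cases "t (i, 0) = t (j, 0)")
          (auto simp: eventually_at_filter intro!: eventually_mono[OF t1_space_nhds])
    qed simp
    then show "\<forall>\<^sub>F z in at (t (i, 0)). f z = integrand x y z" by eventually_elim (rule fg)
  qed
  have "triple N k t x y (N+1, 1) = - (residue_inf f + (\<Sum>i=1..N+1. residue f (params N k t (i, 0))))"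
    unfolding triple_def Let_def f_def ..
  also have "(\<Sum>i=1..N+1. residue f (params N k t (i, 0))) = (\<Sum>i=1..N+1. residue (integrand x y) (t (i, 0)))"
    by (intro sum.cong refl) (simp only: params_eq[OF t] vpar_center 2)
  finally show ?thesis unfolding 1 .
qed

lemma integrand_commute: "integrand x y = integrand y x"
  by (simp add: integrand_def[abs_def] mult.commute)

lemma residue_inf_zero:
  assumes "x \<in> idx N k" "y \<in> idx N k" "fst x \<noteq> 0 \<or> fst y \<noteq> 0"
  shows "residue_inf (integrand x y) = 0"
proof -
  have *: "residue_inf (integrand x y) = 0" if "x \<in> idx N k" "fst y \<noteq> 0" for x y
    by (rule residue_inf_mixed[OF that])
  show ?thesis using assms *[of x y] *[of y x] integrand_commute by metis
qed

lemma triple_eq: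
  assumes x: "x \<in> idx N k" and y: "y \<in> idx N k" and xy: "fst x = fst y \<Longrightarrow> fst x = 0 \<or> fst x = N + 1"
  shows "triple N k t x y (N+1, 1) = - (residue_inf (integrand x y) + residue (integrand x y) p)"
proof -
  have "(\<Sum>i=1..N. residue (integrand x y) (t (i, 0))) = 0"
  proof (intro sum.neutral ballI)
    fix i assume "i \<in> {1..N}"
    then show "residue (integrand x y) (t (i, 0)) = 0" using x y xy by (intro residue_pole_mixed) auto
  qed
  then show ?thesis unfolding triple_residues[OF x y] by simp
qed

lemma triple_inf:
  assumes "\<gamma> \<in> {1..k 0 - 1}" "\<delta> \<in> {1..k 0 - 1}"
  shows "triple N k t (0, \<gamma>) (0, \<delta>) (N+1, 1)
    = (fps_X ^ (k 0 - \<gamma>) * fps_X ^ (k 0 - \<delta>) * (\<psi>\<^sub>0 * inverse (1 - fps_const p * \<psi>\<^sub>0))) $ k 0"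
proof -
  have xy: "(0, \<gamma>) \<in> idx N k" "(0, \<delta>) \<in> idx N k" using assms by (auto simp: idx_def)
  have "triple N k t (0, \<gamma>) (0, \<delta>) (N+1, 1) = - (residue_inf (integrand (0, \<gamma>) (0, \<delta>)) + residue (integrand (0, \<gamma>) (0, \<delta>)) p)"
    by (rule triple_eq[OF xy]) simp
  moreover have "residue (integrand (0, \<gamma>) (0, \<delta>)) p = 0"
    using xy by (intro residue_slice_center_regular) auto
  moreover have "residue_inf (integrand (0, \<gamma>) (0, \<delta>))
    = - ((fps_X ^ (k 0 - \<gamma>) * fps_X ^ (k 0 - \<delta>) * (\<psi>\<^sub>0 * inverse (1 - fps_const p * \<psi>\<^sub>0))) $ k 0)"
    by (rule residue_inf_own[OF assms])
  ultimately show ?thesis by simp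
qed

lemma triple_pole:
  assumes i: "i \<in> {1..N}" and "\<alpha> \<le> k i" "\<beta> \<le> k i"
  shows "triple N k t (i, \<alpha>) (i, \<beta>) (N+1, 1)
    = of_nat (k i) * (zco k i \<alpha> * zco k i \<beta> * inverse (\<psi> i - fps_const (p - t (i, 0)))) $ k i"
proof -
  have xy: "(i, \<alpha>) \<in> idx N k" "(i, \<beta>) \<in> idx N k" using assms by (auto simp: idx_def)
  let ?g = "integrand (i, \<alpha>) (i, \<beta>)"
  have "(\<Sum>j=1..N+1. residue ?g (t (j, 0))) = (\<Sum>j=1..N. residue ?g (t (j, 0))) + residue ?g p" by simp
  also have "(\<Sum>j=1..N. residue ?g (t (j, 0))) = (\<Sum>j=1..N. if j = i then residue ?g (t (i, 0)) else 0)"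
    using xy by (intro sum.cong refl) (auto simp: residue_pole_mixed)
  also have "\<dots> = residue ?g (t (i, 0))" using i by simp
  also have "residue ?g p = 0"
    using xy i by (intro residue_slice_center_regular) auto
  also have "residue ?g (t (i, 0)) = - (of_nat (k i) * (zco k i \<alpha> * zco k i \<beta> * inverse (\<psi> i - fps_const (p - t (i, 0)))) $ k i)"
    by (rule residue_pole_own[OF i])
  finally have s: "(\<Sum>j=1..N+1. residue ?g (t (j, 0)))
    = - (of_nat (k i) * (zco k i \<alpha> * zco k i \<beta> * inverse (\<psi> i - fps_const (p - t (i, 0)))) $ k i)" by simp
  have "residue_inf ?g = 0" using xy i by (intro residue_inf_zero) auto
  then show ?thesis unfolding triple_residues[OF xy] s by simp
qed

lemma triple_mixed:
  assumes "x \<in> idx N k" "y \<in> idx N k" "fst x \<le> N" "fst y \<le> N" "fst x \<noteq> fst y"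
  shows "triple N k t x y (N+1, 1) = 0"
proof -
  have "residue (integrand x y) p = 0" using assms by (intro residue_slice_center_regular) auto
  moreover have "residue_inf (integrand x y) = 0" using assms by (intro residue_inf_zero) auto
  moreover have "triple N k t x y (N+1, 1) = - (residue_inf (integrand x y) + residue (integrand x y) p)"
    using assms by (intro triple_eq) auto
  ultimately show ?thesis by simp
qed

lemma center_idx: "(N+1, 0) \<in> idx N k" and top_idx: "(N+1, \<kappa>) \<in> idx N k"
  by (auto simp: idx_def)

lemma triple_center:
  assumes "x \<in> idx N k" "fst x \<le> N"
  shows "triple N k t x (N+1, 0) (N+1, 1) = lam_deriv k t x p"
    "triple N k t x (N+1, \<kappa>) (N+1, 1) = 0"
proof -
  have "residue (integrand x (N+1, 0)) p = - lam_deriv k t x p" "residue (integrand x (N+1, \<kappa>)) p = 0"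
    using assms by (intro residue_slice_center_regular; simp)+
  moreover have "residue_inf (integrand x (N+1, 0)) = 0" "residue_inf (integrand x (N+1, \<kappa>)) = 0"
    using assms center_idx top_idx by (intro residue_inf_zero; simp)+
  moreover have "triple N k t x y (N+1, 1) = - (residue_inf (integrand x y) + residue (integrand x y) p)" if "y \<in> {(N+1, 0), (N+1, \<kappa>)}" for y
    using assms that center_idx top_idx by (intro triple_eq) auto
  ultimately show "triple N k t x (N+1, 0) (N+1, 1) = lam_deriv k t x p"
    "triple N k t x (N+1, \<kappa>) (N+1, 1) = 0" by (simp_all del: Suc_eq_plus1 add_Suc_right)
qed

lemma triple_singular:
  shows "triple N k t (N+1, 0) (N+1, 0) (N+1, 1) = deriv (lam_regular N k t) p"
    "triple N k t (N+1, \<kappa>) (N+1, 0) (N+1, 1) = 0"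
    "triple N k t (N+1, \<kappa>) (N+1, \<kappa>) (N+1, 1) = 0"
proof -
  have *: "triple N k t x y (N+1, 1) = - residue (integrand x y) p"
    if "x \<in> {(N+1, 0), (N+1, \<kappa>)}" "y \<in> {(N+1, 0), (N+1, \<kappa>)}" for x y
  proof -
    have "triple N k t x y (N+1, 1) = - (residue_inf (integrand x y) + residue (integrand x y) p)"
      using that center_idx top_idx by (intro triple_eq) auto
    moreover have "residue_inf (integrand x y) = 0" using that center_idx top_idx by (intro residue_inf_zero) auto
    ultimately show ?thesis by simp
  qed
  show "triple N k t (N+1, 0) (N+1, 0) (N+1, 1) = deriv (lam_regular N k t) p"
    using residue_slice_center_singular(1) *[of "(N+1, 0)" "(N+1, 0)"] by simp
  show "triple N k t (N+1, \<kappa>) (N+1, 0) (N+1, 1) = 0"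
    using residue_slice_center_singular(2) *[of "(N+1, \<kappa>)" "(N+1, 0)"] by simp
  show "triple N k t (N+1, \<kappa>) (N+1, \<kappa>) (N+1, 1) = 0"
    using residue_slice_center_singular(3) *[of "(N+1, \<kappa>)" "(N+1, \<kappa>)"] by simp
qed

end

section \<open>The right-hand side and its derivatives\<close>

text \<open>Dividing by \<open>n!\<close> removes the multinomial coefficients and produces the
  factors \<open>1 / \<alpha>!\<close> of \<open>correction\<close> directly.\<close>

definition divided_power :: "complex fps \<Rightarrow> nat \<Rightarrow> complex fps" where
  "divided_power f n = fps_const (1 / fact n) * f ^ n"

definition multi_exponents :: "'i set \<Rightarrow> nat \<Rightarrow> ('i \<Rightarrow> nat) set" where
  "multi_exponents I n = {\<alpha> \<in> I \<rightarrow>\<^sub>E UNIV. sum \<alpha> I = n}"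

lemma divided_power_add:
  "divided_power (f + g) n = (\<Sum>j\<le>n. divided_power f j * divided_power g (n - j))"
proof -
  have "divided_power (f + g) n = (\<Sum>j\<le>n. fps_const (1 / fact n) * (of_nat (n choose j) * f ^ j * g ^ (n - j)))"
    unfolding divided_power_def binomial_ring sum_distrib_left ..
  also have "\<dots> = (\<Sum>j\<le>n. divided_power f j * divided_power g (n - j))"
  proof (intro sum.cong refl)
    fix j assume "j \<in> {..n}"
    then have "of_nat (n choose j) = (fact n / (fact j * fact (n - j)) :: complex)"
      by (intro binomial_fact) simp
    then have c: "1 / fact n * of_nat (n choose j) = (1 / fact j * (1 / fact (n - j)) :: complex)" by simp
    have "fps_const (1 / fact n) * (of_nat (n choose j) * f ^ j * g ^ (n - j))
        = fps_const (1 / fact n * of_nat (n choose j)) * f ^ j * g ^ (n - j)"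
      by (simp only: fps_of_nat[symmetric] fps_const_mult[symmetric] mult.assoc)
    also have "\<dots> = divided_power f j * divided_power g (n - j)"
      unfolding c divided_power_def by (simp only: fps_const_mult[symmetric] mult_ac)
    finally show "fps_const (1 / fact n) * (of_nat (n choose j) * f ^ j * g ^ (n - j))
        = divided_power f j * divided_power g (n - j)" .
  qed
  finally show ?thesis .
qed

lemma finite_multi_exponents: "finite I \<Longrightarrow> finite (multi_exponents I n)"
proof -
  assume I: "finite I"
  have "multi_exponents I n \<subseteq> I \<rightarrow>\<^sub>E {..n}"
  proof
    fix \<alpha> assume \<alpha>: "\<alpha> \<in> multi_exponents I n"
    then have "\<alpha> i \<le> n" if "i \<in> I" for i
      using that I member_le_sum[of i I \<alpha>] by (auto simp: multi_exponents_def)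
    moreover have "\<alpha> \<in> extensional I" using \<alpha> by (simp add: multi_exponents_def PiE_iff)
    ultimately show "\<alpha> \<in> I \<rightarrow>\<^sub>E {..n}" by (simp add: PiE_iff)
  qed
  then show ?thesis using I by (meson finite_PiE finite_atMost finite_subset)
qed

lemma divided_power_sum:
  assumes "finite I"
  shows "divided_power (\<Sum>i\<in>I. f i) n = (\<Sum>\<alpha>\<in>multi_exponents I n. \<Prod>i\<in>I. divided_power (f i) (\<alpha> i))"
  using assms
proof (induction I arbitrary: n)
  case empty
  have "multi_exponents ({}::'a set) n = (if n = 0 then {\<lambda>_. undefined} else {})"
    by (auto simp: multi_exponents_def)
  then show ?case by (simp add: divided_power_def)
next
  case (insert i I)
  have "divided_power (\<Sum>i\<in>insert i I. f i) n = (\<Sum>j\<le>n. divided_power (f i) j * divided_power (\<Sum>i\<in>I. f i) (n - j))"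
    using insert.hyps by (simp add: divided_power_add)
  also have "\<dots> = (\<Sum>j\<le>n. \<Sum>\<beta>\<in>multi_exponents I (n - j). divided_power (f i) j * (\<Prod>i\<in>I. divided_power (f i) (\<beta> i)))"
    by (simp only: insert.IH sum_distrib_left)
  also have "\<dots> = (\<Sum>(j, \<beta>)\<in>Sigma {..n} (\<lambda>j. multi_exponents I (n - j)). divided_power (f i) j * (\<Prod>i\<in>I. divided_power (f i) (\<beta> i)))"
    using insert.hyps by (subst sum.Sigma) (auto simp: finite_multi_exponents)
  also have "\<dots> = (\<Sum>\<alpha>\<in>multi_exponents (insert i I) n. \<Prod>i\<in>insert i I. divided_power (f i) (\<alpha> i))"
  \<comment> \<open>Exponents on \<open>insert i I\<close> correspond to the exponent at
    \<open>i\<close> and a function on \<open>I\<close>; extensional functions are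
    \<open>undefined\<close> outside their domain, so the value at \<open>i\<close> is reset to
    that.\<close>
  proof (rule sum.reindex_bij_witness[where j = "\<lambda>(j, \<beta>). \<beta>(i := j)" and i = "\<lambda>\<alpha>. (\<alpha> i, \<alpha>(i := undefined))"])
    fix x assume "x \<in> Sigma {..n} (\<lambda>j. multi_exponents I (n - j))"
    then obtain j \<beta> where x: "x = (j, \<beta>)" "j \<le> n" "\<beta> \<in> multi_exponents I (n - j)" by auto
    have bi: "\<beta> i = undefined" using x insert.hyps by (auto simp: multi_exponents_def PiE_iff extensional_def)
    show "(\<lambda>\<alpha>. (\<alpha> i, \<alpha>(i := undefined))) (case x of (j, \<beta>) \<Rightarrow> \<beta>(i := j)) = x"
      using x bi by (auto simp: fun_eq_iff)
    have s: "(\<Sum>l\<in>I. (\<beta>(i := j)) l) = sum \<beta> I" using insert.hyps by (intro sum.cong) auto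
    show "(case x of (j, \<beta>) \<Rightarrow> \<beta>(i := j)) \<in> multi_exponents (insert i I) n"
      using x insert.hyps s by (auto simp: multi_exponents_def PiE_iff extensional_def)
    have "(\<Prod>l\<in>I. divided_power (f l) ((\<beta>(i := j)) l)) = (\<Prod>l\<in>I. divided_power (f l) (\<beta> l))"
      using insert.hyps by (intro prod.cong) auto
    then show "(\<Prod>l\<in>insert i I. divided_power (f l) ((case x of (j, \<beta>) \<Rightarrow> \<beta>(i := j)) l))
      = (case x of (j, \<beta>) \<Rightarrow> divided_power (f i) j * (\<Prod>i\<in>I. divided_power (f i) (\<beta> i)))"
      using x insert.hyps by simp
  next
    fix \<alpha> assume \<alpha>: "\<alpha> \<in> multi_exponents (insert i I) n"
    show "(case (\<alpha> i, \<alpha>(i := undefined)) of (j, \<beta>) \<Rightarrow> \<beta>(i := j)) = \<alpha>" by simp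
    have "(\<Sum>l\<in>I. (\<alpha>(i := undefined)) l) = sum \<alpha> I" using insert.hyps by (intro sum.cong) auto
    then show "(\<alpha> i, \<alpha>(i := undefined)) \<in> Sigma {..n} (\<lambda>j. multi_exponents I (n - j))"
      using \<alpha> insert.hyps by (auto simp: multi_exponents_def PiE_iff extensional_def)
  qed
  finally show ?case .
qed

lemma theta_sum: "theta k t = (\<Sum>\<gamma>=1..k 0 - 1. fps_const (t (0, \<gamma>)) * fps_X ^ (k 0 + 1 - \<gamma>))"
proof (rule fps_ext)
  fix m
  have "(\<Sum>\<gamma>=1..k 0 - 1. fps_const (t (0, \<gamma>)) * fps_X ^ (k 0 + 1 - \<gamma>)) $ m
     = (\<Sum>\<gamma>=1..k 0 - 1. if \<gamma> = k 0 + 1 - m \<and> m \<le> k 0 then t (0, \<gamma>) else 0)"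
    unfolding fps_sum_nth by (intro sum.cong refl) auto
  also have "\<dots> = theta k t $ m"
  proof (cases "m \<in> {2..k 0}")
    case True
    then have "k 0 + 1 - m \<in> {1..k 0 - 1}" by auto
    then show ?thesis using True by (simp add: theta_def del: Suc_diff_le)
  next
    case False
    then have "(\<Sum>\<gamma>=1..k 0 - 1. if \<gamma> = k 0 + 1 - m \<and> m \<le> k 0 then t (0, \<gamma>) else 0) = 0"
      by (intro sum.neutral) auto
    then show ?thesis using False by (auto simp: theta_def)
  qed
  finally show "theta k t $ m = (\<Sum>\<gamma>=1..k 0 - 1. fps_const (t (0, \<gamma>)) * fps_X ^ (k 0 + 1 - \<gamma>)) $ m" by simp
qed

lemma theta_power_coeff:
  "(theta k t ^ n) $ m / fact n = (\<Sum>\<alpha>\<in>{\<alpha> \<in> multi_exponents {1..k 0 - 1} n. (\<Sum>i=1..k 0 - 1. (k 0 + 1 - i) * \<alpha> i) = m}.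
      \<Prod>i=1..k 0 - 1. t (0, i) ^ \<alpha> i / fact (\<alpha> i))"
proof -
  let ?I = "{1..k 0 - 1}"
  have d: "(\<Prod>i\<in>?I. divided_power (fps_const (t (0, i)) * fps_X ^ (k 0 + 1 - i)) (\<alpha> i))
     = fps_const (\<Prod>i\<in>?I. t (0, i) ^ \<alpha> i / fact (\<alpha> i)) * fps_X ^ (\<Sum>i\<in>?I. (k 0 + 1 - i) * \<alpha> i)" for \<alpha>
  proof -
    have "divided_power (fps_const (t (0, i)) * fps_X ^ (k 0 + 1 - i)) (\<alpha> i)
        = fps_const (t (0, i) ^ \<alpha> i / fact (\<alpha> i)) * fps_X ^ ((k 0 + 1 - i) * \<alpha> i)" for i
    proof -
      have "t (0, i) ^ \<alpha> i / fact (\<alpha> i) = 1 / fact (\<alpha> i) * t (0, i) ^ \<alpha> i" by simp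
      then show ?thesis
        by (simp only: divided_power_def power_mult_distrib fps_const_power power_mult fps_const_mult[symmetric] mult.assoc)
    qed
    moreover have "(\<Prod>i\<in>J. fps_const (c i) * fps_X ^ (e i)) = fps_const (prod c J) * fps_X ^ (sum e J)"
      if "finite J" for J :: "nat set" and c :: "nat \<Rightarrow> complex" and e
      using that by (induction J) (simp_all add: power_add fps_const_mult[symmetric] mult_ac del: fps_const_mult)
    ultimately show ?thesis by simp
  qed
  have "(theta k t ^ n) $ m / fact n = divided_power (theta k t) n $ m" by (simp add: divided_power_def)
  also have "\<dots> = (\<Sum>\<alpha>\<in>multi_exponents ?I n.
      if (\<Sum>i\<in>?I. (k 0 + 1 - i) * \<alpha> i) = m then \<Prod>i\<in>?I. t (0, i) ^ \<alpha> i / fact (\<alpha> i) else 0)"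
    unfolding theta_sum divided_power_sum[OF finite_atLeastAtMost] d fps_sum_nth by (intro sum.cong refl) auto
  also have "\<dots> = (\<Sum>\<alpha>\<in>{\<alpha> \<in> multi_exponents ?I n. (\<Sum>i\<in>?I. (k 0 + 1 - i) * \<alpha> i) = m}.
      \<Prod>i\<in>?I. t (0, i) ^ \<alpha> i / fact (\<alpha> i))"
    by (rule sum.inter_filter[symmetric]) (simp add: finite_multi_exponents)
  finally show ?thesis .
qed

lemma multi_indices_size:
  assumes k: "k 0 \<ge> 2" and \<alpha>: "\<alpha> \<in> multi_indices k"
  shows "(\<Sum>i=1..k 0 - 1. \<alpha> i) \<in> {2..k 0 + 1}"
proof -
  let ?I = "{1..k 0 - 1}"
  have w: "(\<Sum>i\<in>?I. (k 0 + 1 - i) * \<alpha> i) = k 0 + 1" using \<alpha> by (simp add: multi_indices_def)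
  have "(\<Sum>i\<in>?I. \<alpha> i) \<le> (\<Sum>i\<in>?I. (k 0 + 1 - i) * \<alpha> i)" by (intro sum_mono) auto
  moreover have "(\<Sum>i\<in>?I. (k 0 + 1 - i) * \<alpha> i) \<le> k 0 * (\<Sum>i\<in>?I. \<alpha> i)"
    unfolding sum_distrib_left by (intro sum_mono mult_right_mono) auto
  then have "\<not> (\<Sum>i\<in>?I. \<alpha> i) < 2"
    unfolding w using mult_le_mono2[of "\<Sum>i\<in>?I. \<alpha> i" 1 "k 0"] by linarith
  ultimately show ?thesis using w by simp
qed

text \<open>Grouping by the length \<open>n\<close> of the multi-index leaves the factor
  \<open>(n - 2)! / n! = 1 / (n (n - 1))\<close>. These are the Taylor coefficients of
  \<open>(1 - x) log (1 - x) + x\<close>, and \<open>\<theta> ^ n\<close> has order at least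
  \<open>2 n\<close>, so the finite range of \<open>n\<close> is enough.\<close>

lemma correction_eq:
  assumes k: "k 0 \<ge> 2"
  shows "correction k t = (\<Sum>n=2..k 0 + 1. (theta k t ^ n) $ (k 0 + 1) / (of_nat n * of_nat (n - 1)))"
proof -
  let ?I = "{1..k 0 - 1}"
  let ?P = "\<lambda>\<alpha>. \<Prod>i\<in>?I. t (0, i) ^ \<alpha> i / fact (\<alpha> i)"
  have grp: "{\<alpha> \<in> multi_indices k. sum \<alpha> ?I = n} = {\<alpha> \<in> multi_exponents ?I n. (\<Sum>i\<in>?I. (k 0 + 1 - i) * \<alpha> i) = k 0 + 1}" for n
    by (auto simp: multi_indices_def multi_exponents_def)
  have "multi_indices k \<subseteq> (\<Union>n\<in>{2..k 0 + 1}. multi_exponents ?I n)"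
    using multi_indices_size[where k = k, OF k] by (auto simp: multi_exponents_def multi_indices_def)
  then have fin: "finite (multi_indices k)" by (rule finite_subset) (simp add: finite_multi_exponents)
  have "correction k t = (\<Sum>\<alpha>\<in>multi_indices k. fact (sum \<alpha> ?I - 2) * ?P \<alpha>)" by (simp add: correction_def)
  also have "\<dots> = (\<Sum>n\<in>{2..k 0 + 1}. \<Sum>\<alpha>\<in>{\<alpha> \<in> multi_indices k. sum \<alpha> ?I = n}. fact (sum \<alpha> ?I - 2) * ?P \<alpha>)"
    using multi_indices_size[where k = k, OF k] fin by (intro sum.group[symmetric]) auto
  also have "\<dots> = (\<Sum>n\<in>{2..k 0 + 1}. fact (n - 2) * ((theta k t ^ n) $ (k 0 + 1) / fact n))"
  proof (intro sum.cong refl)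
    fix n
    have "(\<Sum>\<alpha>\<in>{\<alpha> \<in> multi_indices k. sum \<alpha> ?I = n}. fact (sum \<alpha> ?I - 2) * ?P \<alpha>)
      = (\<Sum>\<alpha>\<in>{\<alpha> \<in> multi_indices k. sum \<alpha> ?I = n}. fact (n - 2) * ?P \<alpha>)"
      by (intro sum.cong) auto
    also have "\<dots> = fact (n - 2) * ((theta k t ^ n) $ (k 0 + 1) / fact n)"
      unfolding theta_power_coeff grp by (rule sum_distrib_left[symmetric])
    finally show "(\<Sum>\<alpha>\<in>{\<alpha> \<in> multi_indices k. sum \<alpha> ?I = n}. fact (sum \<alpha> ?I - 2) * ?P \<alpha>)
      = fact (n - 2) * ((theta k t ^ n) $ (k 0 + 1) / fact n)" .
  qed
  also have "\<dots> = (\<Sum>n=2..k 0 + 1. (theta k t ^ n) $ (k 0 + 1) / (of_nat n * of_nat (n - 1)))"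
  proof (intro sum.cong refl)
    fix n assume "n \<in> {2..k 0 + 1}"
    then obtain m where m: "n = Suc (Suc m)" by (metis add_2_eq_Suc atLeastAtMost_iff le_Suc_ex)
    have f: "fact n = (of_nat n * of_nat (n - 1) * fact m :: complex)" unfolding m by (simp del: of_nat_Suc)
    have "fact m * (x / (a * fact m)) = x / a" for x a :: complex by simp
    then show "fact (n - 2) * ((theta k t ^ n) $ (k 0 + 1) / fact n) = (theta k t ^ n) $ (k 0 + 1) / (of_nat n * of_nat (n - 1))"
      unfolding f by (simp add: m del: of_nat_Suc power_Suc)
  qed
  finally show ?thesis .
qed

text \<open>\<open>l t i\<close> stands for \<open>log (t\<^sub>N\<^sub>+\<^sub>1\<^sub>,\<^sub>0 - t\<^sub>i\<^sub>,\<^sub>0)\<close>, and \<open>r_corr\<close> is \<open>correction\<close> after the multinomial theorem.\<close>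

definition r_poly :: "nat \<Rightarrow> (nat \<Rightarrow> nat) \<Rightarrow> point \<Rightarrow> complex" where
  "r_poly N k t = t (N+1, 0) ^ (k 0 + 1) / (of_nat (k 0) * of_nat (k 0 + 1))
     + (\<Sum>a=1..k 0 - 1. inf_coeff (k 0) (theta k t) a * t (N+1, 0) ^ a / of_nat a)"

text \<open>With \<open>c = t (N+1, 0) - t (i, 0)\<close> this is \<open>k i\<close> times the
  coefficient of degree \<open>k i\<close> in the antiderivative
  \<open>\<psi> log c - \<Sum> \<psi> ^ a / (a (a - 1) c ^ (a - 1))\<close> of
  \<open>log (c - \<psi>)\<close> with respect to \<open>\<psi>\<close>.\<close>

definition r_polar :: "nat \<Rightarrow> (nat \<Rightarrow> nat) \<Rightarrow> (point \<Rightarrow> nat \<Rightarrow> complex) \<Rightarrow> nat \<Rightarrow> point \<Rightarrow> complex" where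
  "r_polar N k l i t = polar_coeff (k i) (cpsi k t i) 1 * l t i
     - (\<Sum>a=2..k i. polar_coeff (k i) (cpsi k t i) a / (of_nat (a - 1) * (t (N+1, 0) - t (i, 0)) ^ (a - 1)))"

definition r_corr :: "(nat \<Rightarrow> nat) \<Rightarrow> point \<Rightarrow> complex" where
  "r_corr k t = (\<Sum>n=2..k 0 + 1. (theta k t ^ n) $ (k 0 + 1) / (of_nat n * of_nat (n - 1)))"

definition r_rhs :: "nat \<Rightarrow> (nat \<Rightarrow> nat) \<Rightarrow> (point \<Rightarrow> nat \<Rightarrow> complex) \<Rightarrow> point \<Rightarrow> complex" where
  "r_rhs N k l t = r_poly N k t + r_corr k t + (\<Sum>i=1..N. r_polar N k l i t)"

text \<open>For \<open>\<delta> < k 0\<close> this is the coefficient of degree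
  \<open>\<delta>\<close> in \<open>- log (1 - p \<psi>) - log (1 - \<theta>) = - log (1 - \<theta>
  - p q)\<close>, where \<open>\<psi> = q / (1 - \<theta>)\<close> and
  \<open>p = t (N+1, 0)\<close>; the sums stop where the powers no longer reach this degree.\<close>

definition dr_inf :: "nat \<Rightarrow> (nat \<Rightarrow> nat) \<Rightarrow> nat \<Rightarrow> point \<Rightarrow> complex" where
  "dr_inf N k \<delta> t = (\<Sum>a=1..k 0 - 1. (inf_psi (theta k t) ^ a) $ \<delta> * t (N+1, 0) ^ a / of_nat a)
     + (\<Sum>n=1..k 0. (theta k t ^ n) $ \<delta> / of_nat n)"

text \<open>This is \<open>k i\<close> times the coefficient of degree \<open>k i\<close> in
  \<open>zco * log (c - \<psi>)\<close> with \<open>c = t (N+1, 0) - t (i, 0)\<close>, the logarithm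
  being expanded at \<open>\<psi> = 0\<close>.\<close>

definition dr_pole :: "nat \<Rightarrow> (nat \<Rightarrow> nat) \<Rightarrow> (point \<Rightarrow> nat \<Rightarrow> complex) \<Rightarrow> nat \<Rightarrow> nat \<Rightarrow> point \<Rightarrow> complex" where
  "dr_pole N k l i \<beta> t = of_nat (k i) * (zco k i \<beta> $ k i * l t i
     - (\<Sum>j=1..k i. (zco k i \<beta> * cpsi k t i ^ j) $ k i / (of_nat j * (t (N+1, 0) - t (i, 0)) ^ j)))"

lemma fps_geometric_coeff:
  assumes f: "f $ 0 = 0" and m: "n \<le> m"
  shows "(G * inverse (1 - f)) $ n = (\<Sum>j\<le>m. (G * f ^ j) $ n :: complex)"
proof -
  have inv: "(1 - f) * inverse (1 - f) = 1" by (rule inverse_mult_eq_1') (simp add: f)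
  have "(1 - f) * (\<Sum>j\<le>m. f ^ j) = 1 - f ^ Suc m"
    using one_diff_power_eq[of f "Suc m"] by (simp only: lessThan_Suc_atMost)
  then have "inverse (1 - f) * ((1 - f) * (\<Sum>j\<le>m. f ^ j)) = inverse (1 - f) * (1 - f ^ Suc m)" by (simp only:)
  moreover have "inverse (1 - f) * ((1 - f) * (\<Sum>j\<le>m. f ^ j)) = ((1 - f) * inverse (1 - f)) * (\<Sum>j\<le>m. f ^ j)"
    by (simp only: mult_ac)
  ultimately have "(\<Sum>j\<le>m. f ^ j) = inverse (1 - f) - f ^ Suc m * inverse (1 - f)"
    by (simp only: inv mult_1_left right_diff_distrib mult_1_right mult.commute)
  then have w: "(\<Sum>j\<le>m. f ^ j) + f ^ Suc m * inverse (1 - f) = inverse (1 - f)" by (simp only: diff_add_cancel)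
  have "G * (\<Sum>j\<le>m. f ^ j) + f ^ Suc m * (G * inverse (1 - f)) = G * ((\<Sum>j\<le>m. f ^ j) + f ^ Suc m * inverse (1 - f))"
    by (simp only: distrib_left mult.left_commute)
  then have "G * inverse (1 - f) = G * (\<Sum>j\<le>m. f ^ j) + f ^ Suc m * (G * inverse (1 - f))" by (simp only: w)
  then have "(G * inverse (1 - f)) $ n = (G * (\<Sum>j\<le>m. f ^ j)) $ n + (f ^ Suc m * (G * inverse (1 - f))) $ n"
    by (metis fps_add_nth)
  also have "(f ^ Suc m * (G * inverse (1 - f))) $ n = 0"
    using f m by (intro fps_power_mult_nth_low) auto
  finally show ?thesis by (simp add: sum_distrib_left fps_sum_nth)
qed

lemma fps_power_deriv_coeff:
  assumes "fps_has_deriv f D x" "n \<ge> 1"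
  shows "((\<lambda>s. (f s ^ n) $ m / of_nat n) has_field_derivative (D * f x ^ (n - 1)) $ m) (at x)"
proof -
  have "((\<lambda>s. (f s ^ n) $ m) has_field_derivative (of_nat n * f x ^ (n - 1) * D) $ m) (at x)"
    by (intro fps_has_derivD fps_has_deriv_power assms)
  moreover have "of_nat n * f x ^ (n - 1) * D = fps_const (of_nat n) * (D * f x ^ (n - 1))"
    by (simp only: fps_of_nat[symmetric] mult_ac)
  ultimately have "((\<lambda>s. (f s ^ n) $ m / of_nat n) has_field_derivative of_nat n * (D * f x ^ (n - 1)) $ m / of_nat n) (at x)"
    by (intro DERIV_cdivide) (simp only: fps_mult_left_const_nth)
  then show ?thesis using assms(2) by simp
qed

lemma r_corr_deriv:
  assumes \<delta>: "\<delta> \<in> {1..k 0 - 1}"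
  shows "((\<lambda>s. r_corr k (t((0, \<delta>) := s))) has_field_derivative (\<Sum>n=1..k 0. (theta k t ^ n) $ \<delta> / of_nat n)) (at (t (0, \<delta>)))"
proof -
  let ?f = "\<lambda>s. theta k (t((0, \<delta>) := s))"
  have low: "(fps_X ^ (k 0 + 1 - \<delta>) * P) $ (k 0 + 1) = P $ \<delta>" for P :: "complex fps"
    using \<delta> by (auto simp: fps_X_power_mult_nth)
  have 1: "((\<lambda>s. (?f s ^ n) $ (k 0 + 1) / (of_nat n * of_nat (n - 1))) has_field_derivative
      (theta k t ^ (n - 1)) $ \<delta> / of_nat (n - 1)) (at (t (0, \<delta>)))" if n: "n \<in> {2..k 0 + 1}" for n
  proof -
    have "((\<lambda>s. (?f s ^ n) $ (k 0 + 1) / of_nat n / of_nat (n - 1)) has_field_derivative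
       (fps_X ^ (k 0 + 1 - \<delta>) * ?f (t (0, \<delta>)) ^ (n - 1)) $ (k 0 + 1) / of_nat (n - 1)) (at (t (0, \<delta>)))"
      using n by (intro DERIV_cdivide fps_power_deriv_coeff theta_deriv \<delta>) auto
    then show ?thesis unfolding low by (simp add: divide_divide_eq_left)
  qed
  have "((\<lambda>s. r_corr k (t((0, \<delta>) := s))) has_field_derivative
      (\<Sum>n=2..k 0 + 1. (theta k t ^ (n - 1)) $ \<delta> / of_nat (n - 1))) (at (t (0, \<delta>)))"
    unfolding r_corr_def by (intro DERIV_sum 1)
  also have "(\<Sum>n=2..k 0 + 1. (theta k t ^ (n - 1)) $ \<delta> / of_nat (n - 1)) = (\<Sum>n=1..k 0. (theta k t ^ n) $ \<delta> / of_nat n)"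
    by (rule sum.reindex_bij_witness[of _ Suc "\<lambda>n. n - 1"]) auto
  finally show ?thesis .
qed

lemma r_poly_deriv_inf:
  assumes \<delta>: "\<delta> \<in> {1..k 0 - 1}"
  shows "((\<lambda>s. r_poly N k (t((0, \<delta>) := s))) has_field_derivative
     (\<Sum>a=1..k 0 - 1. (inf_psi (theta k t) ^ a) $ \<delta> * t (N+1, 0) ^ a / of_nat a)) (at (t (0, \<delta>)))"
proof -
  have "((\<lambda>s. t (N+1, 0) ^ (k 0 + 1) / (of_nat (k 0) * of_nat (k 0 + 1))
     + (\<Sum>a=1..k 0 - 1. inf_coeff (k 0) (theta k (t((0, \<delta>) := s))) a * t (N+1, 0) ^ a / of_nat a)) has_field_derivative
     0 + (\<Sum>a=1..k 0 - 1. (inf_psi (theta k t) ^ a) $ \<delta> * t (N+1, 0) ^ a / of_nat a)) (at (t (0, \<delta>)))"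
    by (intro DERIV_add DERIV_const DERIV_sum DERIV_cdivide DERIV_cmult_right inf_coeff_flat_deriv \<delta>)
  then show ?thesis by (simp add: r_poly_def)
qed

lemma DERIV_power_divide:
  fixes c z :: complex
  assumes "a \<ge> 1"
  shows "((\<lambda>s. c * s ^ a / of_nat a) has_field_derivative c * z ^ (a - 1)) (at z)"
proof -
  have "((\<lambda>s. c * s ^ a / of_nat a) has_field_derivative c * (of_nat a * z ^ (a - 1)) / of_nat a) (at z)"
    by (intro DERIV_cdivide DERIV_cmult) (auto intro!: derivative_eq_intros)
  then show ?thesis using assms by simp
qed

lemma r_poly_deriv_center:
  assumes "k 0 \<ge> 1"
  shows "((\<lambda>s. r_poly N k (t((N+1, 0) := s))) has_field_derivative lam_poly k t (t (N+1, 0))) (at (t (N+1, 0)))"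
proof -
  let ?p = "t (N+1, 0)"
  have "((\<lambda>s. 1 / of_nat (k 0) * s ^ (k 0 + 1) / of_nat (k 0 + 1) + (\<Sum>a=1..k 0 - 1. inf_coeff (k 0) (theta k t) a * s ^ a / of_nat a))
     has_field_derivative 1 / of_nat (k 0) * ?p ^ (k 0 + 1 - 1) + (\<Sum>a=1..k 0 - 1. inf_coeff (k 0) (theta k t) a * ?p ^ (a - 1))) (at ?p)"
    by (intro DERIV_add DERIV_sum DERIV_power_divide) auto
  moreover have "r_poly N k (t((N+1, 0) := s)) = 1 / of_nat (k 0) * s ^ (k 0 + 1) / of_nat (k 0 + 1)
      + (\<Sum>a=1..k 0 - 1. inf_coeff (k 0) (theta k t) a * s ^ a / of_nat a)" for s
    by (simp add: r_poly_def theta_const)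
  ultimately show ?thesis by (simp add: lam_poly_def)
qed

lemma DERIV_inverse_power:
  fixes x s c b :: complex
  assumes "x - s \<noteq> 0" "j \<ge> 1"
  shows "((\<lambda>s. c / (of_nat j * (x - s) ^ j)) has_field_derivative c / (x - s) ^ Suc j) (at s)"
    "((\<lambda>x. c / (of_nat j * (x - s) ^ j)) has_field_derivative - (c / (x - s) ^ Suc j)) (at x)"
proof -
  have xs: "x \<noteq> s" using assms by auto
  have e: "of_nat j * (c / of_nat j) = c" using assms by simp
  show "((\<lambda>s. c / (of_nat j * (x - s) ^ j)) has_field_derivative c / (x - s) ^ Suc j) (at s)"
    using DERIV_polar(1)[OF xs, of "c / of_nat j" j] unfolding e by (simp only: divide_divide_eq_left)
  show "((\<lambda>x. c / (of_nat j * (x - s) ^ j)) has_field_derivative - (c / (x - s) ^ Suc j)) (at x)"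
    using DERIV_polar(2)[OF xs, of "c / of_nat j" j] unfolding e by (simp only: divide_divide_eq_left)
qed

text \<open>For \<open>\<beta> \<noteq> 0\<close> the factor \<open>zco k i \<beta>\<close> has
  positive order, which lifts the product above degree \<open>k i\<close>. For
  \<open>\<beta> = 0\<close> it is 1, hence the case distinctions in the derivatives below.\<close>

lemma zco_power_low: "\<beta> \<le> k i \<Longrightarrow> \<beta> \<noteq> 0 \<Longrightarrow> f $ 0 = 0 \<Longrightarrow> (zco k i \<beta> * f ^ k i * g) $ k i = 0"
proof -
  assume b: "\<beta> \<le> k i" "\<beta> \<noteq> 0" and f: "f $ 0 = 0"
  obtain m where m: "k i + 1 - \<beta> = Suc m" using b by (cases "k i + 1 - \<beta>") auto
  have "zco k i \<beta> * f ^ k i * g = fps_const (1 / of_nat (k i)) * (fps_X * (f ^ k i * (fps_X ^ m * g)))"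
    using b by (simp only: zco_def m power_Suc if_False mult_ac)
  moreover have "(fps_X * (f ^ k i * h)) $ k i = 0" for h :: "complex fps"
    using fps_power_mult_nth_low[OF f, of "k i - 1" "k i" h] b by simp
  ultimately show ?thesis by (simp only: fps_mult_left_const_nth mult_zero_right)
qed

context slice_point
begin

lemma center_ne: "i \<in> {1..N} \<Longrightarrow> p - t (i, 0) \<noteq> 0"
  using distinct[of "N+1" i] by auto

text \<open>Moving the centre differentiates the logarithm and the powers of
  \<open>p - t (i, 0)\<close>; moving another coordinate of the pole leaves these fixed and
  differentiates the coefficients of \<open>cpsi\<close>.\<close>

lemma r_polar_deriv_pole:
  assumes i: "i \<in> {1..N}" and \<beta>: "\<beta> \<le> k i"
    and l: "((\<lambda>s. l (t((i, \<beta>) := s)) i) has_field_derivative (if \<beta> = 0 then - 1 / (p - t (i, 0)) else 0)) (at (t (i, \<beta>)))"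
  shows "((\<lambda>s. r_polar N k l i (t((i, \<beta>) := s))) has_field_derivative dr_pole N k l i \<beta> t) (at (t (i, \<beta>)))"
proof -
  let ?c = "p - t (i, 0)"
  have c: "?c \<noteq> 0" using i by (rule center_ne)
  have ki1: "k i \<ge> 1" using ki i by simp
  have pne: "(N+1, 0) \<noteq> (i, \<beta>)" using i by auto
  show ?thesis
  proof (cases "\<beta> = 0")
    case True
    let ?V = "polar_coeff (k i) (\<psi> i)"
    have V: "?V a / ?c ^ a = of_nat (k i) * (\<psi> i ^ a) $ k i / (of_nat a * ?c ^ a)" for a
      by (simp add: polar_coeff_def)
    have P: "((\<lambda>s. ?V a / (of_nat (a - 1) * (p - s) ^ (a - 1))) has_field_derivative ?V a / ?c ^ Suc (a - 1)) (at (t (i, \<beta>)))"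
      if "a \<in> {2..k i}" for a
      unfolding True by (rule DERIV_inverse_power(1)) (use c that in auto)
    note L = l[unfolded if_P[OF True]]
    have "r_polar N k l i (t((i, \<beta>) := s)) = ?V 1 * l (t((i, \<beta>) := s)) i
        - (\<Sum>a=2..k i. ?V a / (of_nat (a - 1) * (p - s) ^ (a - 1)))" for s
      using True pne by (simp add: r_polar_def cpsi_const)
    moreover have "((\<lambda>s. ?V 1 * l (t((i, \<beta>) := s)) i - (\<Sum>a=2..k i. ?V a / (of_nat (a - 1) * (p - s) ^ (a - 1))))
      has_field_derivative ?V 1 * (- 1 / ?c) - (\<Sum>a=2..k i. ?V a / ?c ^ Suc (a - 1))) (at (t (i, \<beta>)))"
      by (intro DERIV_diff DERIV_cmult DERIV_sum P L)
    moreover have "?V 1 * (- 1 / ?c) - (\<Sum>a=2..k i. ?V a / ?c ^ Suc (a - 1)) = dr_pole N k l i \<beta> t"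
    proof -
      have "(\<Sum>a=2..k i. ?V a / ?c ^ Suc (a - 1)) = (\<Sum>a=2..k i. ?V a / ?c ^ a)" by (intro sum.cong) auto
      moreover have "(\<Sum>a=1..k i. ?V a / ?c ^ a) = ?V 1 / ?c ^ 1 + (\<Sum>a=Suc 1..k i. ?V a / ?c ^ a)"
        using ki1 by (rule sum.atLeast_Suc_atMost)
      ultimately have "?V 1 * (- 1 / ?c) - (\<Sum>a=2..k i. ?V a / ?c ^ Suc (a - 1)) = - (\<Sum>a=1..k i. ?V a / ?c ^ a)"
        by (simp add: numeral_2_eq_2)
      also have "\<dots> = dr_pole N k l i \<beta> t"
        unfolding V using True ki1 by (simp add: dr_pole_def zco_def sum_distrib_left)
      finally show ?thesis .
    qed
    ultimately show ?thesis by simp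
  next
    case False
    let ?f = "\<lambda>s. cpsi k (t((i, \<beta>) := s)) i"
    have zc: "zco k i \<beta> = fps_const (1 / of_nat (k i)) * fps_X ^ (k i + 1 - \<beta>)" using False by (simp add: zco_def)
    have D: "fps_has_deriv ?f (zco k i \<beta>) (t (i, \<beta>))"
      unfolding zc using False \<beta> by (intro cpsi_deriv) auto
    have Vd: "((\<lambda>s. polar_coeff (k i) (?f s) a) has_field_derivative of_nat (k i) * (\<psi> i ^ (a - 1) * zco k i \<beta>) $ k i) (at (t (i, \<beta>)))"
      if "a \<ge> 1" for a
      using polar_coeff_deriv[OF D that, of "k i"] by simp
    have "r_polar N k l i (t((i, \<beta>) := s)) = polar_coeff (k i) (?f s) 1 * l (t((i, \<beta>) := s)) i
        - (\<Sum>a=2..k i. polar_coeff (k i) (?f s) a / (of_nat (a - 1) * ?c ^ (a - 1)))" for s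
      using False pne by (simp add: r_polar_def)
    moreover have "((\<lambda>s. polar_coeff (k i) (?f s) 1 * l (t((i, \<beta>) := s)) i
        - (\<Sum>a=2..k i. polar_coeff (k i) (?f s) a / (of_nat (a - 1) * ?c ^ (a - 1)))) has_field_derivative
        (of_nat (k i) * (\<psi> i ^ (1 - 1) * zco k i \<beta>) $ k i * l (t((i, \<beta>) := t (i, \<beta>))) i
           + 0 * polar_coeff (k i) (?f (t (i, \<beta>))) 1)
         - (\<Sum>a=2..k i. of_nat (k i) * (\<psi> i ^ (a - 1) * zco k i \<beta>) $ k i / (of_nat (a - 1) * ?c ^ (a - 1)))) (at (t (i, \<beta>)))"
      using l False by (intro DERIV_diff DERIV_mult DERIV_sum DERIV_cdivide Vd) auto
    moreover have "(\<Sum>a=2..k i. of_nat (k i) * (\<psi> i ^ (a - 1) * zco k i \<beta>) $ k i / (of_nat (a - 1) * ?c ^ (a - 1)))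
      = of_nat (k i) * (\<Sum>j=1..k i. (zco k i \<beta> * \<psi> i ^ j) $ k i / (of_nat j * ?c ^ j))"
    proof -
      have "(\<Sum>a=2..k i. of_nat (k i) * (\<psi> i ^ (a - 1) * zco k i \<beta>) $ k i / (of_nat (a - 1) * ?c ^ (a - 1)))
        = (\<Sum>j=1..k i - 1. of_nat (k i) * ((zco k i \<beta> * \<psi> i ^ j) $ k i / (of_nat j * ?c ^ j)))"
        by (rule sum.reindex_bij_witness[of _ Suc "\<lambda>a. a - 1"]) (auto simp: mult.commute)
      also have "\<dots> = (\<Sum>j=1..k i. of_nat (k i) * ((zco k i \<beta> * \<psi> i ^ j) $ k i / (of_nat j * ?c ^ j)))"
      proof -
        \<comment> \<open>Shifting the index stops one short of \<open>k i\<close>; the term missing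
          for \<open>dr_pole\<close> is zero.\<close>
        have "(zco k i \<beta> * \<psi> i ^ k i) $ k i = 0" using zco_power_low[where k = k and i = i and f = "\<psi> i" and g = 1, OF \<beta> False] by simp
        then show ?thesis using ki1 by (cases "k i") auto
      qed
      finally show ?thesis by (simp only: sum_distrib_left)
    qed
    ultimately show ?thesis by (simp add: dr_pole_def right_diff_distrib mult.assoc)
  qed
qed

lemma r_polar_deriv_center:
  assumes i: "i \<in> {1..N}"
    and l: "((\<lambda>s. l (t((N+1, 0) := s)) i) has_field_derivative 1 / (p - t (i, 0))) (at p)"
  shows "((\<lambda>s. r_polar N k l i (t((N+1, 0) := s))) has_field_derivative lam_polar k t i p) (at p)"
proof -
  let ?c = "p - t (i, 0)" and ?V = "polar_coeff (k i) (\<psi> i)"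
  have c: "?c \<noteq> 0" using i by (rule center_ne)
  have ki1: "k i \<ge> 1" using ki i by simp
  have ine: "i \<noteq> N+1" "(i, 0) \<noteq> (N+1, 0)" using i by auto
  have P: "((\<lambda>s. ?V a / (of_nat (a - 1) * (s - t (i, 0)) ^ (a - 1))) has_field_derivative - (?V a / ?c ^ Suc (a - 1))) (at p)"
    if "a \<in> {2..k i}" for a
    by (rule DERIV_inverse_power(2)) (use c that in auto)
  have "r_polar N k l i (t((N+1, 0) := s)) = ?V 1 * l (t((N+1, 0) := s)) i
        - (\<Sum>a=2..k i. ?V a / (of_nat (a - 1) * (s - t (i, 0)) ^ (a - 1)))" for s
    using ine by (simp add: r_polar_def cpsi_const)
  moreover have "((\<lambda>s. ?V 1 * l (t((N+1, 0) := s)) i - (\<Sum>a=2..k i. ?V a / (of_nat (a - 1) * (s - t (i, 0)) ^ (a - 1))))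
      has_field_derivative ?V 1 * (1 / ?c) - (\<Sum>a=2..k i. - (?V a / ?c ^ Suc (a - 1)))) (at p)"
    by (intro DERIV_diff DERIV_cmult DERIV_sum P l)
  moreover have "?V 1 * (1 / ?c) - (\<Sum>a=2..k i. - (?V a / ?c ^ Suc (a - 1))) = lam_polar k t i p"
  proof -
    have "(\<Sum>a=2..k i. - (?V a / ?c ^ Suc (a - 1))) = - (\<Sum>a=2..k i. ?V a / ?c ^ a)"
      unfolding sum_negf[symmetric] by (intro sum.cong) auto
    moreover have "lam_polar k t i p = ?V 1 / ?c ^ 1 + (\<Sum>a=Suc 1..k i. ?V a / ?c ^ a)"
      unfolding lam_polar_def using ki1 by (rule sum.atLeast_Suc_atMost)
    ultimately show ?thesis by (simp add: numeral_2_eq_2)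
  qed
  ultimately show ?thesis by simp
qed

text \<open>The geometric expansion of \<open>1 / (\<psi> - c)\<close> in powers of
  \<open>\<psi> / c\<close>, whose terms beyond \<open>k i\<close> have order above
  \<open>k i\<close>.\<close>

lemma inverse_psi_shift_coeff:
  assumes i: "i \<in> {1..N}"
  shows "of_nat (k i) * (G * inverse (\<psi> i - fps_const (p - t (i, 0)))) $ k i
    = - (of_nat (k i) * (\<Sum>j\<le>k i. (G * \<psi> i ^ j) $ k i / (p - t (i, 0)) ^ Suc j))"
proof -
  define c where "c = p - t (i, 0)"
  have c: "c \<noteq> 0" using center_ne[OF i] by (simp add: c_def)
  let ?f = "fps_const (1 / c) * \<psi> i"
  have e: "\<psi> i - fps_const c = fps_const (- c) * (1 - ?f)"
  proof -
    have "fps_const (- c) * fps_const (1 / c) = - 1" using c fps_const_neg[of "1::complex"] by simp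
    then have "fps_const (- c) * (fps_const (1 / c) * \<psi> i) = - \<psi> i" by (simp only: mult.assoc[symmetric]) simp
    moreover have "fps_const (- c) = - fps_const c" by simp
    moreover have "fps_const (- c) * (1 - ?f) = fps_const (- c) - fps_const (- c) * ?f"
      by (simp only: right_diff_distrib mult_1_right)
    ultimately have "fps_const (- c) * (1 - ?f) = - fps_const c - (- \<psi> i)" by (simp only:)
    then show ?thesis by (simp only: minus_diff_eq diff_minus_eq_add add.commute uminus_add_conv_diff)
  qed
  have "inverse (\<psi> i - fps_const c) = fps_const (- (1 / c)) * inverse (1 - ?f)"
    unfolding e fps_inverse_mult using c by (simp add: fps_const_inverse divide_inverse)
  then have "(G * inverse (\<psi> i - fps_const c)) $ k i = - (1 / c) * (G * inverse (1 - ?f)) $ k i"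
    by (simp only: mult.left_commute[of G] fps_mult_left_const_nth)
  also have "(G * inverse (1 - ?f)) $ k i = (\<Sum>j\<le>k i. (G * ?f ^ j) $ k i)"
    by (rule fps_geometric_coeff) simp_all
  also have "\<dots> = (\<Sum>j\<le>k i. (G * \<psi> i ^ j) $ k i / c ^ j)"
  proof (intro sum.cong refl)
    fix j
    have "G * ?f ^ j = fps_const ((1 / c) ^ j) * (G * \<psi> i ^ j)"
      by (simp only: power_mult_distrib fps_const_power mult_ac)
    then show "(G * ?f ^ j) $ k i = (G * \<psi> i ^ j) $ k i / c ^ j"
      by (simp only: fps_mult_left_const_nth) (simp add: power_divide)
  qed
  also have "- (1 / c) * (\<Sum>j\<le>k i. (G * \<psi> i ^ j) $ k i / c ^ j) = - (\<Sum>j\<le>k i. (G * \<psi> i ^ j) $ k i / c ^ Suc j)"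
    by (simp add: sum_divide_distrib mult.commute)
  finally show ?thesis by (simp add: c_def)
qed

lemma lam_deriv_center:
  assumes i: "i \<in> {1..N}"
  shows "lam_deriv k t (i, \<beta>) p = of_nat (k i) * (\<Sum>j\<le>k i. (zco k i \<beta> * \<psi> i ^ j) $ k i / (p - t (i, 0)) ^ Suc j)"
proof -
  have "lam_deriv k t (i, \<beta>) p = (\<Sum>a=1..k i + 1. of_nat (k i) * (\<psi> i ^ (a - 1) * zco k i \<beta>) $ k i / (p - t (i, 0)) ^ a)"
    using i by (simp add: lam_deriv_def)
  also have "\<dots> = (\<Sum>j\<le>k i. of_nat (k i) * ((zco k i \<beta> * \<psi> i ^ j) $ k i / (p - t (i, 0)) ^ Suc j))"
    by (rule sum.reindex_bij_witness[of _ Suc "\<lambda>a. a - 1"]) (auto simp: mult.commute)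
  finally show ?thesis by (simp only: sum_distrib_left)
qed

text \<open>Whether the centre or a coefficient of \<open>cpsi\<close> moves,
  \<open>c - \<psi>\<close> changes by \<open>- zco k i \<alpha>\<close>, so
  \<open>log (c - \<psi>)\<close> changes by \<open>zco k i \<alpha> / (\<psi> - c)\<close>, as in
  \<open>triple_pole\<close>.\<close>

lemma dr_pole_deriv_pole:
  assumes i: "i \<in> {1..N}" and \<alpha>: "\<alpha> \<le> k i" and \<beta>: "\<beta> \<le> k i"
    and l: "((\<lambda>s. l (t((i, \<alpha>) := s)) i) has_field_derivative (if \<alpha> = 0 then - 1 / (p - t (i, 0)) else 0)) (at (t (i, \<alpha>)))"
  shows "((\<lambda>s. dr_pole N k l i \<beta> (t((i, \<alpha>) := s))) has_field_derivative triple N k t (i, \<alpha>) (i, \<beta>) (N+1, 1)) (at (t (i, \<alpha>)))"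
proof -
  let ?c = "p - t (i, 0)" and ?Z = "zco k i \<beta>"
  have c: "?c \<noteq> 0" using i by (rule center_ne)
  have pne: "(N+1, 0) \<noteq> (i, \<alpha>)" using i by auto
  have tr: "triple N k t (i, \<alpha>) (i, \<beta>) (N+1, 1)
     = of_nat (k i) * (- (\<Sum>j\<le>k i. (zco k i \<alpha> * ?Z * \<psi> i ^ j) $ k i / ?c ^ Suc j))"
    unfolding triple_pole[OF i \<alpha> \<beta>] inverse_psi_shift_coeff[OF i] by simp
  show ?thesis
  proof (cases "\<alpha> = 0")
    case True
    have P: "((\<lambda>s. (?Z * \<psi> i ^ j) $ k i / (of_nat j * (p - s) ^ j)) has_field_derivative
        (?Z * \<psi> i ^ j) $ k i / ?c ^ Suc j) (at (t (i, \<alpha>)))" if "j \<in> {1..k i}" for j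
      unfolding True by (rule DERIV_inverse_power(1)) (use c that in auto)
    note L = l[unfolded if_P[OF True]]
    have "dr_pole N k l i \<beta> (t((i, \<alpha>) := s)) = of_nat (k i) * (?Z $ k i * l (t((i, \<alpha>) := s)) i
        - (\<Sum>j=1..k i. (?Z * \<psi> i ^ j) $ k i / (of_nat j * (p - s) ^ j)))" for s
      using True pne by (simp add: dr_pole_def cpsi_const)
    moreover have "((\<lambda>s. of_nat (k i) * (?Z $ k i * l (t((i, \<alpha>) := s)) i
        - (\<Sum>j=1..k i. (?Z * \<psi> i ^ j) $ k i / (of_nat j * (p - s) ^ j)))) has_field_derivative
        of_nat (k i) * (?Z $ k i * (- 1 / ?c) - (\<Sum>j=1..k i. (?Z * \<psi> i ^ j) $ k i / ?c ^ Suc j))) (at (t (i, \<alpha>)))"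
      by (intro DERIV_diff DERIV_cmult DERIV_sum P L)
    moreover have "?Z $ k i * (- 1 / ?c) - (\<Sum>j=1..k i. (?Z * \<psi> i ^ j) $ k i / ?c ^ Suc j)
      = - (\<Sum>j\<le>k i. (zco k i \<alpha> * ?Z * \<psi> i ^ j) $ k i / ?c ^ Suc j)"
    proof -
      have "{..k i} = insert 0 {1..k i}" by auto
      then show ?thesis using True by (simp add: zco_def[of k i 0])
    qed
    ultimately show ?thesis unfolding tr by simp
  next
    case False
    let ?f = "\<lambda>s. cpsi k (t((i, \<alpha>) := s)) i"
    have zc: "zco k i \<alpha> = fps_const (1 / of_nat (k i)) * fps_X ^ (k i + 1 - \<alpha>)" using False by (simp add: zco_def)
    have D: "fps_has_deriv ?f (zco k i \<alpha>) (t (i, \<alpha>))"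
      unfolding zc using False \<alpha> by (intro cpsi_deriv) auto
    have Pd: "((\<lambda>s. (?Z * ?f s ^ j) $ k i / (of_nat j * ?c ^ j)) has_field_derivative
        (zco k i \<alpha> * ?Z * \<psi> i ^ (j - 1)) $ k i / ?c ^ j) (at (t (i, \<alpha>)))" if j: "j \<ge> 1" for j
    proof -
      have "((\<lambda>s. (?Z * ?f s ^ j) $ k i) has_field_derivative
          (0 * ?f (t (i, \<alpha>)) ^ j + ?Z * (of_nat j * ?f (t (i, \<alpha>)) ^ (j - 1) * zco k i \<alpha>)) $ k i) (at (t (i, \<alpha>)))"
        by (intro fps_has_derivD fps_has_deriv_mult fps_has_deriv_const fps_has_deriv_power D)
      moreover have "0 * ?f (t (i, \<alpha>)) ^ j + ?Z * (of_nat j * ?f (t (i, \<alpha>)) ^ (j - 1) * zco k i \<alpha>)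
         = fps_const (of_nat j) * (zco k i \<alpha> * ?Z * \<psi> i ^ (j - 1))"
        by (simp only: fun_upd_triv fps_of_nat[symmetric] mult_ac mult_zero_left mult_zero_right add_0)
      ultimately have "((\<lambda>s. (?Z * ?f s ^ j) $ k i / (of_nat j * ?c ^ j)) has_field_derivative
          of_nat j * (zco k i \<alpha> * ?Z * \<psi> i ^ (j - 1)) $ k i / (of_nat j * ?c ^ j)) (at (t (i, \<alpha>)))"
        by (intro DERIV_cdivide) (simp only: fps_mult_left_const_nth)
      then show ?thesis using j by simp
    qed
    have "dr_pole N k l i \<beta> (t((i, \<alpha>) := s)) = of_nat (k i) * (?Z $ k i * l (t((i, \<alpha>) := s)) i
        - (\<Sum>j=1..k i. (?Z * ?f s ^ j) $ k i / (of_nat j * ?c ^ j)))" for s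
      using False pne by (simp add: dr_pole_def)
    moreover have "((\<lambda>s. of_nat (k i) * (?Z $ k i * l (t((i, \<alpha>) := s)) i
        - (\<Sum>j=1..k i. (?Z * ?f s ^ j) $ k i / (of_nat j * ?c ^ j)))) has_field_derivative
        of_nat (k i) * (?Z $ k i * 0 - (\<Sum>j=1..k i. (zco k i \<alpha> * ?Z * \<psi> i ^ (j - 1)) $ k i / ?c ^ j))) (at (t (i, \<alpha>)))"
      using l False by (intro DERIV_diff DERIV_cmult DERIV_sum Pd) auto
    moreover have "(\<Sum>j=1..k i. (zco k i \<alpha> * ?Z * \<psi> i ^ (j - 1)) $ k i / ?c ^ j)
      = (\<Sum>j\<le>k i. (zco k i \<alpha> * ?Z * \<psi> i ^ j) $ k i / ?c ^ Suc j)"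
    proof -
      have "(\<Sum>j=1..k i. (zco k i \<alpha> * ?Z * \<psi> i ^ (j - 1)) $ k i / ?c ^ j)
        = (\<Sum>j<k i. (zco k i \<alpha> * ?Z * \<psi> i ^ j) $ k i / ?c ^ Suc j)"
        by (rule sum.reindex_bij_witness[of _ Suc "\<lambda>a. a - 1"]) auto
      moreover have "(zco k i \<alpha> * ?Z * \<psi> i ^ k i) $ k i = 0"
        using zco_power_low[where k = k and i = i and f = "\<psi> i" and g = ?Z, OF \<alpha> False] by (simp add: mult_ac)
      ultimately show ?thesis by (simp flip: lessThan_Suc_atMost)
    qed
    ultimately show ?thesis unfolding tr by simp
  qed
qed

lemma dr_pole_deriv_center:
  assumes i: "i \<in> {1..N}"
    and l: "((\<lambda>s. l (t((N+1, 0) := s)) i) has_field_derivative 1 / (p - t (i, 0))) (at p)"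
  shows "((\<lambda>s. dr_pole N k l i \<beta> (t((N+1, 0) := s))) has_field_derivative lam_deriv k t (i, \<beta>) p) (at p)"
proof -
  let ?c = "p - t (i, 0)" and ?Z = "zco k i \<beta>"
  have c: "?c \<noteq> 0" using i by (rule center_ne)
  have ine: "i \<noteq> N+1" "(i, 0) \<noteq> (N+1, 0)" using i by auto
  have P: "((\<lambda>s. (?Z * \<psi> i ^ j) $ k i / (of_nat j * (s - t (i, 0)) ^ j)) has_field_derivative
      - ((?Z * \<psi> i ^ j) $ k i / ?c ^ Suc j)) (at p)" if "j \<in> {1..k i}" for j
    by (rule DERIV_inverse_power(2)) (use c that in auto)
  have "dr_pole N k l i \<beta> (t((N+1, 0) := s)) = of_nat (k i) * (?Z $ k i * l (t((N+1, 0) := s)) i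
      - (\<Sum>j=1..k i. (?Z * \<psi> i ^ j) $ k i / (of_nat j * (s - t (i, 0)) ^ j)))" for s
    using ine by (simp add: dr_pole_def cpsi_const)
  moreover have "((\<lambda>s. of_nat (k i) * (?Z $ k i * l (t((N+1, 0) := s)) i
      - (\<Sum>j=1..k i. (?Z * \<psi> i ^ j) $ k i / (of_nat j * (s - t (i, 0)) ^ j)))) has_field_derivative
      of_nat (k i) * (?Z $ k i * (1 / ?c) - (\<Sum>j=1..k i. - ((?Z * \<psi> i ^ j) $ k i / ?c ^ Suc j)))) (at p)"
    by (intro DERIV_diff DERIV_cmult DERIV_sum P l)
  moreover have "of_nat (k i) * (?Z $ k i * (1 / ?c) - (\<Sum>j=1..k i. - ((?Z * \<psi> i ^ j) $ k i / ?c ^ Suc j)))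
    = lam_deriv k t (i, \<beta>) p"
  proof -
    have "{..k i} = insert 0 {1..k i}" by auto
    then show ?thesis unfolding lam_deriv_center[OF i] by (simp add: sum_negf)
  qed
  ultimately show ?thesis by simp
qed

text \<open>This is where the correction becomes visible. Expanding the tensor in powers of
  \<open>p\<close>, the integral of \<open>\<lambda>\<close> accounts for the positive powers only;
  the term without \<open>p\<close> is \<open>?D / (1 - \<theta>)\<close>, the derivative of
  \<open>- log (1 - \<theta>)\<close>, and comes from \<open>r_corr\<close>.\<close>

lemma dr_inf_deriv_inf:
  assumes \<gamma>: "\<gamma> \<in> {1..k 0 - 1}" and \<delta>: "\<delta> \<in> {1..k 0 - 1}"
  shows "((\<lambda>s. dr_inf N k \<delta> (t((0, \<gamma>) := s))) has_field_derivative triple N k t (0, \<gamma>) (0, \<delta>) (N+1, 1)) (at (t (0, \<gamma>)))"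
proof -
  let ?f = "\<lambda>s. theta k (t((0, \<gamma>) := s))" and ?\<theta> = "theta k t"
  let ?D = "fps_X ^ (k 0 + 1 - \<gamma>) :: complex fps" and ?E = "fps_X ^ (k 0 - \<gamma>) :: complex fps"
  let ?w = "inverse (1 - ?\<theta>)"
  have D: "fps_has_deriv ?f ?D (t (0, \<gamma>))" by (rule theta_deriv[where k = k, OF \<gamma>])
  have "\<gamma> \<le> k 0" using \<gamma> by auto
  then have "k 0 + 1 - \<gamma> = Suc (k 0 - \<gamma>)" by (simp add: Suc_diff_le)
  then have DE: "?D = fps_X * ?E" by (simp only: power_Suc)
  have Dpsi: "fps_has_deriv (\<lambda>s. inf_psi (?f s)) (fps_X * (?w ^ 2 * ?D)) (t (0, \<gamma>))"
    using inf_psi_has_deriv[OF D] by simp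
  have e: "fps_X * (?w ^ 2 * ?D) = \<psi>\<^sub>0 ^ 2 * ?E"
    unfolding DE by (simp add: inf_psi_def power2_eq_square mult_ac)
  have A: "((\<lambda>s. (inf_psi (?f s) ^ a) $ \<delta> * p ^ a / of_nat a) has_field_derivative (?E * \<psi>\<^sub>0 ^ (a + 1)) $ \<delta> * p ^ a) (at (t (0, \<gamma>)))"
    if a: "a \<ge> 1" for a
  proof -
    have "((\<lambda>s. (inf_psi (?f s) ^ a) $ \<delta> / of_nat a * p ^ a) has_field_derivative
       (fps_X * (?w ^ 2 * ?D) * inf_psi (?f (t (0, \<gamma>))) ^ (a - 1)) $ \<delta> * p ^ a) (at (t (0, \<gamma>)))"
      by (intro DERIV_cmult_right fps_power_deriv_coeff Dpsi a)
    moreover have "fps_X * (?w ^ 2 * ?D) * inf_psi (?f (t (0, \<gamma>))) ^ (a - 1) = ?E * \<psi>\<^sub>0 ^ (a + 1)"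
    proof -
      have "\<psi>\<^sub>0 ^ (a + 1) = \<psi>\<^sub>0 ^ 2 * \<psi>\<^sub>0 ^ (a - 1)" using a by (simp flip: power_add)
      then show ?thesis unfolding e by (simp add: mult_ac)
    qed
    ultimately show ?thesis by simp
  qed
  have C: "((\<lambda>s. (?f s ^ n) $ \<delta> / of_nat n) has_field_derivative (?D * ?\<theta> ^ (n - 1)) $ \<delta>) (at (t (0, \<gamma>)))" if "n \<ge> 1" for n
    using fps_power_deriv_coeff[OF D that] by simp
  have "dr_inf N k \<delta> (t((0, \<gamma>) := s)) = (\<Sum>a=1..k 0 - 1. (inf_psi (?f s) ^ a) $ \<delta> * p ^ a / of_nat a)
      + (\<Sum>n=1..k 0. (?f s ^ n) $ \<delta> / of_nat n)" for s
    by (simp add: dr_inf_def)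
  moreover have "((\<lambda>s. (\<Sum>a=1..k 0 - 1. (inf_psi (?f s) ^ a) $ \<delta> * p ^ a / of_nat a)
      + (\<Sum>n=1..k 0. (?f s ^ n) $ \<delta> / of_nat n)) has_field_derivative
      (\<Sum>a=1..k 0 - 1. (?E * \<psi>\<^sub>0 ^ (a + 1)) $ \<delta> * p ^ a) + (\<Sum>n=1..k 0. (?D * ?\<theta> ^ (n - 1)) $ \<delta>)) (at (t (0, \<gamma>)))"
    by (intro DERIV_add DERIV_sum A C) auto
  moreover have "triple N k t (0, \<gamma>) (0, \<delta>) (N+1, 1)
     = (\<Sum>a=1..k 0 - 1. (?E * \<psi>\<^sub>0 ^ (a + 1)) $ \<delta> * p ^ a) + (\<Sum>n=1..k 0. (?D * ?\<theta> ^ (n - 1)) $ \<delta>)"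
  proof -
    have "triple N k t (0, \<gamma>) (0, \<delta>) (N+1, 1) = (fps_X ^ (k 0 - \<delta>) * (?E * \<psi>\<^sub>0 * inverse (1 - fps_const p * \<psi>\<^sub>0))) $ k 0"
      unfolding triple_inf[OF \<gamma> \<delta>] by (simp only: mult_ac)
    also have "\<dots> = (?E * \<psi>\<^sub>0 * inverse (1 - fps_const p * \<psi>\<^sub>0)) $ \<delta>"
      using \<delta> by (auto simp: fps_X_power_mult_nth)
    also have "\<dots> = (\<Sum>j\<le>k 0 - 1. (?E * \<psi>\<^sub>0 * (fps_const p * \<psi>\<^sub>0) ^ j) $ \<delta>)"
      using \<delta> by (intro fps_geometric_coeff) auto
    also have "\<dots> = (\<Sum>j\<le>k 0 - 1. (?E * \<psi>\<^sub>0 ^ (j + 1)) $ \<delta> * p ^ j)"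
    proof (intro sum.cong refl)
      fix j
      have "?E * \<psi>\<^sub>0 * (fps_const p * \<psi>\<^sub>0) ^ j = fps_const (p ^ j) * (?E * \<psi>\<^sub>0 ^ (j + 1))"
        by (simp add: power_mult_distrib fps_const_power mult_ac)
      then show "(?E * \<psi>\<^sub>0 * (fps_const p * \<psi>\<^sub>0) ^ j) $ \<delta> = (?E * \<psi>\<^sub>0 ^ (j + 1)) $ \<delta> * p ^ j"
        by (simp only: fps_mult_left_const_nth mult.commute)
    qed
    also have "\<dots> = (\<Sum>a=1..k 0 - 1. (?E * \<psi>\<^sub>0 ^ (a + 1)) $ \<delta> * p ^ a) + (?E * \<psi>\<^sub>0) $ \<delta>"
    proof -
      have "{..k 0 - 1} = insert 0 {1..k 0 - 1}" by auto
      then show ?thesis by simp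
    qed
    also have "(?E * \<psi>\<^sub>0) $ \<delta> = (?D * ?w) $ \<delta>" unfolding DE by (simp add: inf_psi_def mult_ac)
    also have "\<dots> = (\<Sum>n\<le>k 0 - 1. (?D * ?\<theta> ^ n) $ \<delta>)"
      using \<delta> by (intro fps_geometric_coeff) auto
    also have "\<dots> = (\<Sum>n=1..k 0. (?D * ?\<theta> ^ (n - 1)) $ \<delta>)"
      using k0 by (intro sum.reindex_bij_witness[of _ "\<lambda>n. n - 1" Suc]) auto
    finally show ?thesis .
  qed
  ultimately show ?thesis by simp
qed

lemma dr_inf_deriv_center:
  "((\<lambda>s. dr_inf N k \<delta> (t((N+1, 0) := s))) has_field_derivative lam_deriv k t (0, \<delta>) p) (at p)"
proof -
  have "dr_inf N k \<delta> (t((N+1, 0) := s)) = (\<Sum>a=1..k 0 - 1. (\<psi>\<^sub>0 ^ a) $ \<delta> * s ^ a / of_nat a)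
     + (\<Sum>n=1..k 0. (theta k t ^ n) $ \<delta> / of_nat n)" for s
    by (simp add: dr_inf_def theta_const)
  moreover have "((\<lambda>s. (\<Sum>a=1..k 0 - 1. (\<psi>\<^sub>0 ^ a) $ \<delta> * s ^ a / of_nat a)
     + (\<Sum>n=1..k 0. (theta k t ^ n) $ \<delta> / of_nat n)) has_field_derivative
     (\<Sum>a=1..k 0 - 1. (\<psi>\<^sub>0 ^ a) $ \<delta> * p ^ (a - 1)) + 0) (at p)"
    by (intro DERIV_add DERIV_sum DERIV_const DERIV_power_divide) auto
  ultimately show ?thesis by (simp add: lam_deriv_def)
qed

end

section \<open>Second derivatives of the right-hand side along the slice\<close>

definition slice_idx :: "nat \<Rightarrow> (nat \<Rightarrow> nat) \<Rightarrow> (nat \<times> nat) set" where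
  "slice_idx N k = {x \<in> idx N k. fst x \<le> N \<or> x = (N+1, 0) \<or> x = (N+1, k (N+1))}"

text \<open>The final 0 belongs to the top coordinate of the last pole: the right-hand side is
  constant in this direction.\<close>

definition dr_rhs :: "nat \<Rightarrow> (nat \<Rightarrow> nat) \<Rightarrow> (point \<Rightarrow> nat \<Rightarrow> complex) \<Rightarrow> nat \<times> nat \<Rightarrow> point \<Rightarrow> complex" where
  "dr_rhs N k l y t =
     (if fst y = 0 then dr_inf N k (snd y) t
      else if fst y \<le> N then dr_pole N k l (fst y) (snd y) t
      else if snd y = 0 then lam_regular N k t (t (N+1, 0)) else 0)"

lemma slice_idxE:
  assumes "x \<in> slice_idx N k"
  obtains (inf) \<gamma> where "x = (0, \<gamma>)" "\<gamma> \<in> {1..k 0 - 1}"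
  | (pole) i \<alpha> where "x = (i, \<alpha>)" "i \<in> {1..N}" "\<alpha> \<le> k i"
  | (center) "x = (N+1, 0)"
  | (top) "x = (N+1, k (N+1))"
  using assms by (auto simp: slice_idx_def idx_def)

lemma r_poly_const: "fst x \<noteq> 0 \<Longrightarrow> x \<noteq> (N+1, 0) \<Longrightarrow> r_poly N k (t(x := s)) = r_poly N k t"
  by (simp add: r_poly_def theta_const)

lemma r_corr_const: "fst x \<noteq> 0 \<Longrightarrow> r_corr k (t(x := s)) = r_corr k t"
  by (simp add: r_corr_def theta_const)

lemma dr_inf_const: "fst x \<noteq> 0 \<Longrightarrow> x \<noteq> (N+1, 0) \<Longrightarrow> dr_inf N k \<delta> (t(x := s)) = dr_inf N k \<delta> t"
  by (simp add: dr_inf_def theta_const)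

lemma lam_regular_const:
  "fst x \<noteq> 0 \<Longrightarrow> fst x \<notin> {1..N} \<Longrightarrow> lam_regular N k (t(x := s)) z = lam_regular N k t z"
  unfolding lam_regular_def by (intro arg_cong2[where f = "(+)"] sum.cong lam_poly_const lam_polar_const) auto

text \<open>Records the logarithms only through their derivatives in the directions of the slice, so
  that the choice of branches stays out of the computation.\<close>

locale log_point = slice_point +
  fixes l :: "point \<Rightarrow> nat \<Rightarrow> complex"
  assumes l_deriv: "\<And>i x. i \<in> {1..N} \<Longrightarrow> x \<in> slice_idx N k \<Longrightarrow>
    ((\<lambda>s. l (t(x := s)) i) has_field_derivative
       (if x = (N+1, 0) then 1 / (p - t (i, 0)) else if x = (i, 0) then - 1 / (p - t (i, 0)) else 0)) (at (t x))"
begin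

lemma l_deriv_center:
  assumes "i \<in> {1..N}"
  shows "((\<lambda>s. l (t((N+1, 0) := s)) i) has_field_derivative 1 / (p - t (i, 0))) (at p)"
proof -
  have "(N+1, 0) \<in> slice_idx N k" using center_idx by (simp add: slice_idx_def)
  from l_deriv[OF assms this] show ?thesis by simp
qed

lemma l_deriv_pole:
  assumes "i \<in> {1..N}" "\<alpha> \<le> k i"
  shows "((\<lambda>s. l (t((i, \<alpha>) := s)) i) has_field_derivative (if \<alpha> = 0 then - 1 / (p - t (i, 0)) else 0)) (at (t (i, \<alpha>)))"
proof -
  have x: "(i, \<alpha>) \<in> slice_idx N k" using assms by (auto simp: slice_idx_def idx_def)
  have "(i, \<alpha>) \<noteq> (N+1, 0)" using assms by auto
  then show ?thesis using l_deriv[OF assms(1) x] by (simp split: if_splits)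
qed

lemma l_deriv_other:
  assumes "i \<in> {1..N}" "x \<in> slice_idx N k" "fst x \<noteq> i" "x \<noteq> (N+1, 0)"
  shows "((\<lambda>s. l (t(x := s)) i) has_field_derivative 0) (at (t x))"
proof -
  have "x \<noteq> (i, 0)" using assms by auto
  then show ?thesis using l_deriv[OF assms(1,2)] assms(4) by simp
qed

lemma r_polar_deriv_other:
  assumes "i \<in> {1..N}" "x \<in> slice_idx N k" "fst x \<noteq> i" "x \<noteq> (N+1, 0)"
  shows "((\<lambda>s. r_polar N k l i (t(x := s))) has_field_derivative 0) (at (t x))"
proof -
  have x: "(N+1, 0) \<noteq> x" "(i, 0) \<noteq> x" "\<And>s. cpsi k (t(x := s)) i = \<psi> i"
    using assms(3,4) by (auto intro: cpsi_const)
  have "((\<lambda>s. r_polar N k l i (t(x := s))) has_field_derivative polar_coeff (k i) (\<psi> i) 1 * 0 - 0) (at (t x))"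
    unfolding r_polar_def x(3) fun_upd_other[OF x(1)] fun_upd_other[OF x(2)]
    by (intro DERIV_diff DERIV_cmult DERIV_const l_deriv_other assms)
  then show ?thesis by simp
qed

lemma dr_pole_deriv_other:
  assumes "i \<in> {1..N}" "x \<in> slice_idx N k" "fst x \<noteq> i" "x \<noteq> (N+1, 0)"
  shows "((\<lambda>s. dr_pole N k l i \<beta> (t(x := s))) has_field_derivative 0) (at (t x))"
proof -
  have x: "(N+1, 0) \<noteq> x" "(i, 0) \<noteq> x" "\<And>s. cpsi k (t(x := s)) i = \<psi> i"
    using assms(3,4) by (auto intro: cpsi_const)
  have "((\<lambda>s. dr_pole N k l i \<beta> (t(x := s))) has_field_derivative of_nat (k i) * (zco k i \<beta> $ k i * 0 - 0)) (at (t x))"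
    unfolding dr_pole_def x(3) fun_upd_other[OF x(1)] fun_upd_other[OF x(2)]
    by (intro DERIV_diff DERIV_cmult DERIV_const l_deriv_other assms)
  then show ?thesis by simp
qed

lemma r_rhs_deriv:
  assumes y: "y \<in> slice_idx N k"
  shows "((\<lambda>s. r_rhs N k l (t(y := s))) has_field_derivative dr_rhs N k l y t) (at (t y))"
  using y
proof (cases rule: slice_idxE)
  case (inf \<delta>)
  have "((\<lambda>s. r_polar N k l i (t(y := s))) has_field_derivative 0) (at (t y))" if "i \<in> {1..N}" for i
    using that y inf by (intro r_polar_deriv_other) auto
  then have "((\<lambda>s. r_poly N k (t(y := s)) + r_corr k (t(y := s)) + (\<Sum>i=1..N. r_polar N k l i (t(y := s)))) has_field_derivative
     (\<Sum>a=1..k 0 - 1. (inf_psi (theta k t) ^ a) $ \<delta> * t (N+1, 0) ^ a / of_nat a)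
     + (\<Sum>n=1..k 0. (theta k t ^ n) $ \<delta> / of_nat n) + (\<Sum>i=1..N. 0)) (at (t y))"
    unfolding inf(1) by (intro DERIV_add DERIV_sum r_poly_deriv_inf r_corr_deriv inf) auto
  then show ?thesis using inf by (simp add: r_rhs_def dr_rhs_def dr_inf_def)
next
  case (pole i \<beta>)
  have ne: "fst y \<noteq> 0" "y \<noteq> (N+1, 0)" using pole by auto
  have "((\<lambda>s. r_polar N k l j (t(y := s))) has_field_derivative (if j = i then dr_pole N k l i \<beta> t else 0)) (at (t y))"
    if j: "j \<in> {1..N}" for j
  proof (cases "j = i")
    case True
    then show ?thesis using r_polar_deriv_pole[where l = l, OF pole(2,3) l_deriv_pole[OF pole(2,3)]] pole by simp
  next
    case False
    then show ?thesis using r_polar_deriv_other[OF j y] ne pole by simp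
  qed
  then have "((\<lambda>s. r_poly N k t + r_corr k t + (\<Sum>i=1..N. r_polar N k l i (t(y := s)))) has_field_derivative
     0 + 0 + (\<Sum>j=1..N. if j = i then dr_pole N k l i \<beta> t else 0)) (at (t y))"
    by (intro DERIV_add DERIV_const DERIV_sum)
  moreover have "(\<Sum>j=1..N. if j = i then dr_pole N k l i \<beta> t else 0) = dr_rhs N k l y t"
    using pole by (simp add: dr_rhs_def)
  ultimately show ?thesis by (simp add: r_rhs_def r_poly_const[OF ne] r_corr_const[OF ne(1)])
next
  case center
  have "((\<lambda>s. r_poly N k (t(y := s)) + r_corr k t + (\<Sum>i=1..N. r_polar N k l i (t(y := s)))) has_field_derivative
     lam_poly k t p + 0 + (\<Sum>i=1..N. lam_polar k t i p)) (at (t y))"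
    unfolding center
    by (intro DERIV_add DERIV_const DERIV_sum r_poly_deriv_center r_polar_deriv_center l_deriv_center) (use k0 in auto)
  then show ?thesis using center by (simp add: r_rhs_def dr_rhs_def lam_regular_def r_corr_const)
next
  case top
  have ne: "fst y \<noteq> 0" "y \<noteq> (N+1, 0)" using top kN by auto
  have "((\<lambda>s. r_polar N k l i (t(y := s))) has_field_derivative 0) (at (t y))" if "i \<in> {1..N}" for i
    using that y ne top by (intro r_polar_deriv_other) auto
  then have "((\<lambda>s. r_poly N k t + r_corr k t + (\<Sum>i=1..N. r_polar N k l i (t(y := s)))) has_field_derivative
     0 + 0 + (\<Sum>i=1..N. 0)) (at (t y))"
    by (intro DERIV_add DERIV_const DERIV_sum)
  moreover have "dr_rhs N k l y t = 0" using top kN by (simp add: dr_rhs_def)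
  ultimately show ?thesis unfolding r_rhs_def r_poly_const[OF ne] r_corr_const[OF ne(1)] by simp
qed

text \<open>The Hessian of the right-hand side is matched with the tensor pair by pair. The symmetry
  \<open>tcom\<close> serves when the centre or top direction is \<open>x\<close>, because
  \<open>triple_center\<close> has it in the second place.\<close>

lemma dr_rhs_deriv:
  assumes x: "x \<in> slice_idx N k" and y: "y \<in> slice_idx N k"
  shows "((\<lambda>s. dr_rhs N k l y (t(x := s))) has_field_derivative triple N k t x y (N+1, 1)) (at (t x))"
proof -
  have xi: "x \<in> idx N k" and yi: "y \<in> idx N k" using x y by (auto simp: slice_idx_def)
  have tcom: "triple N k t x y (N+1, 1) = triple N k t y x (N+1, 1)" by (rule triple_commute)
  show ?thesis
    using y
  proof (cases rule: slice_idxE)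
    case (inf \<delta>)
    have dr: "dr_rhs N k l y t' = dr_inf N k \<delta> t'" for t' using inf by (simp add: dr_rhs_def)
    have yN: "fst y \<le> N" using inf by simp
    note yeq = inf
    show ?thesis
      using x
    proof (cases rule: slice_idxE)
      case (inf \<gamma>)
      show ?thesis
        unfolding dr unfolding inf(1) yeq(1) by (rule dr_inf_deriv_inf[OF inf(2) yeq(2)])
    next
      case (pole i \<alpha>)
      have "triple N k t x y (N+1, 1) = 0" using xi yi pole yeq by (intro triple_mixed) auto
      moreover have "dr_inf N k \<delta> (t(x := s)) = dr_inf N k \<delta> t" for s using pole by (intro dr_inf_const) auto
      ultimately show ?thesis unfolding dr by simp
    next
      case center
      have "triple N k t x y (N+1, 1) = lam_deriv k t (0, \<delta>) p"
        unfolding tcom unfolding center triple_center(1)[OF yi yN] unfolding yeq ..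
      then show ?thesis unfolding dr by (simp only: center dr_inf_deriv_center)
    next
      case top
      have "triple N k t x y (N+1, 1) = 0"
        unfolding tcom unfolding top by (rule triple_center(2)[OF yi yN])
      moreover have "dr_inf N k \<delta> (t(x := s)) = dr_inf N k \<delta> t" for s using top kN by (intro dr_inf_const) auto
      ultimately show ?thesis unfolding dr by simp
    qed
  next
    case (pole i \<beta>)
    have dr: "dr_rhs N k l y t' = dr_pole N k l i \<beta> t'" for t' using pole by (simp add: dr_rhs_def)
    have yN: "fst y \<le> N" using pole by simp
    note yeq = pole
    \<comment> \<open>Directions that move neither the pole \<open>i\<close> nor \<open>p\<close>:
      both the derivative and the tensor are zero.\<close>
    have other: ?thesis if "fst x \<noteq> i" "x \<noteq> (N+1, 0)"
    proof -
      have "triple N k t x y (N+1, 1) = 0"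
        using x
      proof (cases rule: slice_idxE)
        case top
        show ?thesis unfolding tcom unfolding top by (rule triple_center(2)[OF yi yN])
      next
        case (inf \<gamma>)
        then show ?thesis using that yeq by (intro triple_mixed xi yi) auto
      next
        case (pole j \<alpha>)
        then show ?thesis using that yeq by (intro triple_mixed xi yi) auto
      next
        case center
        then show ?thesis using that by simp
      qed
      moreover have "((\<lambda>s. dr_pole N k l i \<beta> (t(x := s))) has_field_derivative 0) (at (t x))"
        using yeq(2) x that by (rule dr_pole_deriv_other)
      ultimately show ?thesis unfolding dr by (simp only:)
    qed
    show ?thesis
      using x
    proof (cases rule: slice_idxE)
      case (inf \<gamma>)
      then show ?thesis using yeq by (intro other) auto
    next
      case (pole j \<alpha>)
      show ?thesis
      proof (cases "j = i")
        case True
        have \<alpha>: "\<alpha> \<le> k i" using pole True by simp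
        show ?thesis
          unfolding dr unfolding pole(1) yeq(1) True
          by (rule dr_pole_deriv_pole[where l = l, OF yeq(2) \<alpha> yeq(3) l_deriv_pole[OF yeq(2) \<alpha>]])
      next
        case False
        then show ?thesis using pole by (intro other) auto
      qed
    next
      case center
      have "triple N k t x y (N+1, 1) = lam_deriv k t (i, \<beta>) p"
        unfolding tcom unfolding center triple_center(1)[OF yi yN] unfolding yeq ..
      then show ?thesis
        unfolding dr using dr_pole_deriv_center[where l = l and \<beta> = \<beta>, OF yeq(2) l_deriv_center[OF yeq(2)]]
        by (simp only: center)
    next
      case top
      then show ?thesis using yeq kN by (intro other) auto
    qed
  next
    case center
    have dr: "dr_rhs N k l y t' = lam_regular N k t' (t' (N+1, 0))" for t' using center by (simp add: dr_rhs_def)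
    \<comment> \<open>The evaluation point \<open>p\<close> stays fixed here, and none of the poles
      of \<open>lam_regular\<close> lies at \<open>p\<close>.\<close>
    have small: ?thesis if xN: "fst x \<le> N"
    proof -
      have ne: "(N+1, 0) \<noteq> x" using xN by auto
      have "((\<lambda>s. lam_poly k (t(x := s)) p + (\<Sum>i\<in>{1..N}. lam_polar k (t(x := s)) i p)) has_field_derivative
         (if fst x \<in> insert 0 {1..N} then lam_deriv k t x p else 0)) (at (t x))"
        by (intro lam_sum_deriv[OF xi] ki) (use distinct[of "N+1"] in auto)
      moreover have "fst x \<in> insert 0 {1..N}" using xN by auto
      moreover have "triple N k t x y (N+1, 1) = lam_deriv k t x p"
        unfolding center by (rule triple_center(1)[OF xi xN])
      ultimately show ?thesis
        unfolding dr lam_regular_def fun_upd_other[OF ne] by (simp only: if_True)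
    qed
    show ?thesis
      using x
    proof (cases rule: slice_idxE)
      case c: center
      have an: "lam_regular N k t analytic_on {p}"
        using distinct[of "N+1"] k0 by (intro lam_regular_analytic) auto
      then have "(lam_regular N k t has_field_derivative deriv (lam_regular N k t) p) (at p)"
        using analytic_on_imp_differentiable_at field_differentiable_derivI by blast
      moreover have "lam_regular N k (t((N+1, 0) := s)) z = lam_regular N k t z" for s z
        by (intro lam_regular_const) auto
      moreover have "triple N k t x y (N+1, 1) = deriv (lam_regular N k t) p"
        unfolding center c by (rule triple_singular(1))
      ultimately show ?thesis unfolding dr by (simp only: c fun_upd_same)
    next
      case top
      have ne: "(N+1, 0) \<noteq> x" using top kN by auto
      have "lam_regular N k (t(x := s)) z = lam_regular N k t z" for s z
        using top by (intro lam_regular_const) auto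
      moreover have "triple N k t x y (N+1, 1) = 0"
        unfolding center top by (rule triple_singular(2))
      ultimately show ?thesis unfolding dr fun_upd_other[OF ne] by (simp only: DERIV_const)
    qed (use small in auto)
  next
    case top
    have dr: "dr_rhs N k l y t' = 0" for t' using top kN by (simp add: dr_rhs_def)
    have "triple N k t x y (N+1, 1) = 0"
    proof (cases "fst x \<le> N")
      case True
      then show ?thesis unfolding top by (rule triple_center(2)[OF xi])
    next
      case False
      then have "x = (N+1, 0) \<or> x = (N+1, \<kappa>)" using x by (auto simp: slice_idx_def)
      then show ?thesis
      proof
        assume c: "x = (N+1, 0)"
        show ?thesis unfolding tcom unfolding c top by (rule triple_singular(2))
      next
        assume c: "x = (N+1, \<kappa>)"
        show ?thesis unfolding c top by (rule triple_singular(3))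
      qed
    qed
    then show ?thesis unfolding dr by (simp only: DERIV_const)
  qed
qed

end

section \<open>Integration of second derivatives\<close>

text \<open>A point of an open set in the product topology may be moved in each coordinate by some
  radius; since only the finitely many coordinates in \<open>J\<close> vary, a minimum of radii
  works for all.\<close>

lemma open_fun_box:
  fixes t :: "'i \<Rightarrow> 'b::metric_space"
  assumes "open B" "t \<in> B" "finite J"
  obtains \<epsilon> where "\<epsilon> > 0" "\<And>t'. (\<And>x. x \<in> J \<Longrightarrow> dist (t' x) (t x) < \<epsilon>) \<Longrightarrow> (\<And>x. x \<notin> J \<Longrightarrow> t' x = t x) \<Longrightarrow> t' \<in> B"
proof -
  have "openin (product_topology (\<lambda>i. euclidean) UNIV) B" using assms(1) by (simp add: open_fun_def)
  then obtain X where X: "t \<in> Pi\<^sub>E UNIV X" "\<And>i. open (X i)" "Pi\<^sub>E UNIV X \<subseteq> B"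
    using product_topology_open_contains_basis[of "\<lambda>i. euclidean" UNIV B t] assms(2) by auto
  have "\<exists>e>0. \<forall>b. dist b (t x) < e \<longrightarrow> b \<in> X x" for x
    using X(1,2) by (simp add: open_dist PiE_iff)
  then obtain e where e: "\<And>x. e x > 0" "\<And>x b. dist b (t x) < e x \<Longrightarrow> b \<in> X x" by metis
  define \<epsilon> where "\<epsilon> = Min (insert 1 (e ` J))"
  have \<epsilon>: "\<epsilon> > 0" "\<And>x. x \<in> J \<Longrightarrow> \<epsilon> \<le> e x" using assms(3) e(1) by (auto simp: \<epsilon>_def)
  have "t' \<in> B" if near: "\<And>x. x \<in> J \<Longrightarrow> dist (t' x) (t x) < \<epsilon>" and off: "\<And>x. x \<notin> J \<Longrightarrow> t' x = t x" for t'
  proof -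
    have "t' x \<in> X x" for x
    proof (cases "x \<in> J")
      case True
      then show ?thesis using near[OF True] \<epsilon>(2)[OF True] by (intro e(2)) simp
    next
      case False
      then show ?thesis using off X(1) by (simp add: PiE_iff)
    qed
    then show ?thesis using X(3) by (auto simp: PiE_iff)
  qed
  then show ?thesis using \<epsilon>(1) that by blast
qed

lemma tendsto_coordinate: "((\<lambda>t :: 'i \<Rightarrow> 'b::topological_space. t x) \<longlongrightarrow> t x) (at t within A)"
proof -
  have "continuous_on UNIV (\<lambda>t :: 'i \<Rightarrow> 'b. t x)" by (rule continuous_on_product_coordinates)
  then have "((\<lambda>t :: 'i \<Rightarrow> 'b. t x) \<longlongrightarrow> t x) (at t within UNIV)" unfolding continuous_on_def by simp
  then show ?thesis by (rule tendsto_within_subset) simp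
qed

text \<open>Openness relative to the coordinates in \<open>J\<close>, the others being frozen. The
  slice is open only in this sense, as the lower coordinates of the last pole are 0 on it.\<close>

definition box_open :: "'i set \<Rightarrow> ('i \<Rightarrow> complex) set \<Rightarrow> bool" where
  "box_open J T \<longleftrightarrow> (\<forall>t\<in>T. \<exists>\<epsilon>>0. \<forall>t'. (\<forall>x\<in>J. dist (t' x) (t x) < \<epsilon>) \<longrightarrow> (\<forall>x. x \<notin> J \<longrightarrow> t' x = t x) \<longrightarrow> t' \<in> T)"

text \<open>Inside a box two points are joined by changing one coordinate after the other, each time
  along a disc on which the one-variable derivative vanishes. So \<open>f\<close> is locally
  constant, and connectedness does the rest.\<close>

lemma constant_of_zero_partials:
  fixes f :: "('i \<Rightarrow> complex) \<Rightarrow> complex"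
  assumes J: "finite J" and T: "connected T" "box_open J T"
    and off: "\<forall>t\<in>T. \<forall>t'\<in>T. \<forall>x. x \<notin> J \<longrightarrow> t' x = t x"
    and f: "\<And>t x. t \<in> T \<Longrightarrow> x \<in> J \<Longrightarrow> ((\<lambda>s. f (t(x := s))) has_field_derivative 0) (at (t x))"
    and "a \<in> T" "b \<in> T"
  shows "f a = f b"
proof (rule connected_local_const[OF T(1) assms(6,7)], rule ballI)
  fix t assume t: "t \<in> T"
  have "\<exists>\<epsilon>>0. \<forall>t'. (\<forall>x\<in>J. dist (t' x) (t x) < \<epsilon>) \<longrightarrow> (\<forall>x. x \<notin> J \<longrightarrow> t' x = t x) \<longrightarrow> t' \<in> T"
    using T(2)[unfolded box_open_def] t by (rule bspec)
  then obtain \<epsilon> where \<epsilon>: "\<epsilon> > 0"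
    "\<forall>t'. (\<forall>x\<in>J. dist (t' x) (t x) < \<epsilon>) \<longrightarrow> (\<forall>x. x \<notin> J \<longrightarrow> t' x = t x) \<longrightarrow> t' \<in> T"
    by (elim exE conjE)
  \<comment> \<open>Induction on the set \<open>A\<close> of coordinates in which \<open>t'\<close>
    may still differ from the centre \<open>t\<close>; resetting one coordinate to its central value
    stays in the box.\<close>
  have const: "f t' = f t"
    if "finite A" "A \<subseteq> J" "\<forall>x\<in>J. dist (t' x) (t x) < \<epsilon>" "\<forall>x. x \<notin> A \<longrightarrow> t' x = t x" for A t'
    using that
  proof (induction A arbitrary: t' rule: finite_induct)
    case empty
    then have "t' = t" by auto
    then show ?case by simp
  next
    case (insert a A)
    have a: "a \<in> J" using insert.prems by simp
    have "\<exists>c. \<forall>s\<in>ball (t a) \<epsilon>. f (t'(a := s)) = c"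
    proof (rule has_field_derivative_zero_constant)
      fix s assume s: "s \<in> ball (t a) \<epsilon>"
      have "t'(a := s) \<in> T"
      proof (rule \<epsilon>(2)[THEN spec, THEN mp, THEN mp])
        show "\<forall>x\<in>J. dist ((t'(a := s)) x) (t x) < \<epsilon>" using insert.prems(2) s by (simp add: dist_commute)
        show "\<forall>x. x \<notin> J \<longrightarrow> (t'(a := s)) x = t x" using insert.prems(1,3) by auto
      qed
      from f[OF this a] show "((\<lambda>s. f (t'(a := s))) has_field_derivative 0) (at s within ball (t a) \<epsilon>)"
        by (simp add: has_field_derivative_at_within)
    qed simp
    moreover have "t' a \<in> ball (t a) \<epsilon>" "t a \<in> ball (t a) \<epsilon>"
      using insert.prems(2) a \<epsilon>(1) by (simp_all add: dist_commute)
    ultimately have "f (t'(a := t' a)) = f (t'(a := t a))" by metis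
    moreover have "f (t'(a := t a)) = f t"
      using insert.prems \<epsilon>(1) by (intro insert.IH) auto
    ultimately show ?case by simp
  qed
  have "\<forall>x\<in>J. \<forall>\<^sub>F t' in at t within T. dist (t' x) (t x) < \<epsilon>"
    by (intro ballI tendstoD[OF tendsto_coordinate] \<epsilon>(1))
  then have "\<forall>\<^sub>F t' in at t within T. \<forall>x\<in>J. dist (t' x) (t x) < \<epsilon>"
    by (rule eventually_ball_finite[OF J])
  moreover have "\<forall>\<^sub>F t' in at t within T. t' \<in> T" by (simp add: eventually_at_filter)
  ultimately show "\<forall>\<^sub>F t' in at t within T. f t = f t'"
  proof eventually_elim
    case (elim t')
    then show ?case using const[OF J subset_refl, of t'] off t by simp
  qed
qed

text \<open>The first partials are constant; subtracting the linear function with these slopes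
  leaves a function with vanishing partials, to which \<open>constant_of_zero_partials\<close>
  applies again.\<close>

lemma affine_of_zero_second_partials:
  fixes f :: "('i \<Rightarrow> complex) \<Rightarrow> complex"
  assumes J: "finite J" and T: "connected T" "box_open J T"
    and off: "\<forall>t\<in>T. \<forall>t'\<in>T. \<forall>x. x \<notin> J \<longrightarrow> t' x = t x"
    and f: "\<And>t y. t \<in> T \<Longrightarrow> y \<in> J \<Longrightarrow> ((\<lambda>s. f (t(y := s))) has_field_derivative g y t) (at (t y))"
    and g: "\<And>t x y. t \<in> T \<Longrightarrow> x \<in> J \<Longrightarrow> y \<in> J \<Longrightarrow> ((\<lambda>s. g y (t(x := s))) has_field_derivative 0) (at (t x))"
  obtains c0 c where "\<And>t. t \<in> T \<Longrightarrow> f t = c0 + (\<Sum>y\<in>J. c y * t y)"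
proof (cases "T = {}")
  case False
  then obtain t0 where t0: "t0 \<in> T" by blast
  define h where "h = (\<lambda>t. f t - (\<Sum>y\<in>J. g y t0 * t y))"
  have gc: "g y t = g y t0" if "y \<in> J" "t \<in> T" for y t
    by (rule constant_of_zero_partials[where f = "g y", OF J T off]) (use g that t0 in simp_all)
  have h: "((\<lambda>s. h (t(x := s))) has_field_derivative 0) (at (t x))" if t: "t \<in> T" and x: "x \<in> J" for t x
  proof -
    have "((\<lambda>s. g y t0 * (t(x := s)) y) has_field_derivative (if y = x then g x t0 else 0)) (at (t x))" for y
      by (auto intro!: derivative_eq_intros)
    then have "((\<lambda>s. h (t(x := s))) has_field_derivative g x t - (\<Sum>y\<in>J. if y = x then g x t0 else 0)) (at (t x))"
      unfolding h_def by (intro DERIV_diff DERIV_sum f t x)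
    then show ?thesis using J x gc[OF x t] by simp
  qed
  have "h t = h t0" if "t \<in> T" for t
    by (rule constant_of_zero_partials[where f = h, OF J T off]) (use h that t0 in simp_all)
  then have "f t = h t0 + (\<Sum>y\<in>J. g y t0 * t y)" if "t \<in> T" for t
    using that unfolding h_def by (metis diff_add_cancel)
  then show ?thesis by (rule that)
qed (use that in blast)

text \<open>Near \<open>a\<close> the difference of \<open>f\<close> and \<open>f a\<close> has
  imaginary part below \<open>pi\<close> by continuity, so \<open>Ln\<close> inverts
  \<open>exp\<close> there and \<open>f\<close> is \<open>f a + Ln (h s / h a)\<close>, with
  \<open>h s / h a\<close> close to 1.\<close>

lemma log_branch_has_derivative:
  fixes f h :: "complex \<Rightarrow> complex"
  assumes f: "isCont f a" and e: "\<forall>\<^sub>F s in nhds a. exp (f s) = h s" and h: "(h has_field_derivative h') (at a)"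
  shows "(f has_field_derivative h' / h a) (at a)"
proof -
  have ha: "h a = exp (f a)" using eventually_nhds_x_imp_x[OF e] by simp
  have "((\<lambda>s. h s / h a) has_field_derivative h' / h a) (at a)" by (intro DERIV_cdivide h)
  moreover have "(Ln has_field_derivative 1) (at (h a / h a))"
    using has_field_derivative_Ln[of 1] ha by simp
  ultimately have "((\<lambda>s. Ln (h s / h a)) has_field_derivative 1 * (h' / h a)) (at a)"
    by (intro DERIV_chain2)
  from DERIV_add[OF DERIV_const this]
  have d: "((\<lambda>s. f a + Ln (h s / h a)) has_field_derivative h' / h a) (at a)"
    by simp
  have "(f \<longlongrightarrow> f a) (nhds a)" using f by (simp add: isCont_def tendsto_at_iff_tendsto_nhds)
  then have "\<forall>\<^sub>F s in nhds a. dist (f s) (f a) < pi" by (rule tendstoD) simp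
  with e have "\<forall>\<^sub>F s in nhds a. f a + Ln (h s / h a) = f s"
  proof eventually_elim
    case (elim s)
    have "\<bar>Im (f s - f a)\<bar> < pi" using abs_Im_le_cmod[of "f s - f a"] elim(2) by (simp add: dist_norm)
    then have "Ln (exp (f s - f a)) = f s - f a" by (intro Ln_exp) auto
    then show ?case using elim(1) ha by (simp add: exp_diff)
  qed
  then show ?thesis using d by (simp add: DERIV_cong_ev)
qed

section \<open>The limit at the stratum\<close>

lemma continuous_on_if_const:
  "(P \<Longrightarrow> continuous_on A f) \<Longrightarrow> (\<not> P \<Longrightarrow> continuous_on A g) \<Longrightarrow> continuous_on A (\<lambda>x. if P then f x else g x)"
  by (cases P) simp_all

definition fps_continuous :: "('a::topological_space \<Rightarrow> complex fps) \<Rightarrow> bool" where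
  "fps_continuous f \<longleftrightarrow> (\<forall>n. continuous_on UNIV (\<lambda>t. f t $ n))"

lemma fps_continuous_const: "fps_continuous (\<lambda>_. c)"
  by (simp add: fps_continuous_def)

lemma fps_continuous_mult: "fps_continuous f \<Longrightarrow> fps_continuous g \<Longrightarrow> fps_continuous (\<lambda>t. f t * g t)"
  unfolding fps_continuous_def fps_mult_nth by (auto intro!: continuous_intros)

lemma fps_continuous_power: "fps_continuous f \<Longrightarrow> fps_continuous (\<lambda>t. f t ^ n)"
  by (induction n) (auto intro: fps_continuous_const fps_continuous_mult)

lemma fps_continuous_theta: "fps_continuous (theta k)"
  unfolding fps_continuous_def theta_def by (auto intro!: continuous_intros continuous_on_if_const)

lemma fps_continuous_cpsi: "fps_continuous (\<lambda>t. cpsi k t i)"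
  unfolding fps_continuous_def cpsi_def by (auto intro!: continuous_intros continuous_on_if_const)

lemma fps_continuous_inverse:
  assumes f: "fps_continuous f" and 0: "\<And>t. f t $ 0 = 0"
  shows "fps_continuous (\<lambda>t. inverse (1 - f t))"
  unfolding fps_continuous_def
proof
  fix n
  have "inverse (1 - f t) $ n = (\<Sum>j\<le>n. (f t ^ j) $ n)" for t
    using fps_geometric_coeff[OF 0, of n n 1 t] by simp
  then show "continuous_on UNIV (\<lambda>t. inverse (1 - f t) $ n)"
    using fps_continuous_power[OF f] by (auto simp: fps_continuous_def intro!: continuous_on_sum)
qed

lemma continuous_on_inf_coeff: "continuous_on UNIV (\<lambda>t. inf_coeff (k 0) (theta k t) a)"
proof -
  have "fps_continuous (\<lambda>t. 1 - theta k t + fps_X * fps_deriv (theta k t))"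
    using fps_continuous_theta[of k] by (auto simp: fps_continuous_def intro!: continuous_intros)
  moreover have "fps_continuous (\<lambda>t. inf_psi (theta k t) ^ a)"
    unfolding inf_psi_def
    by (intro fps_continuous_power fps_continuous_mult fps_continuous_const fps_continuous_inverse fps_continuous_theta) simp
  ultimately have "fps_continuous (\<lambda>t. (1 - theta k t + fps_X * fps_deriv (theta k t)) * inf_psi (theta k t) ^ a)"
    by (rule fps_continuous_mult)
  then show ?thesis unfolding inf_coeff_def divide_inverse
    by (intro continuous_on_mult_right) (simp only: fps_continuous_def)
qed

lemma continuous_on_vpar: "continuous_on UNIV (\<lambda>t. vpar N k t x)"
proof (cases x)
  case (Pair i a)
  have "continuous_on UNIV (\<lambda>t. polar_coeff (k i) (cpsi k t i) a)"
    unfolding polar_coeff_def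
    using fps_continuous_power[OF fps_continuous_cpsi] by (intro continuous_on_mult_left) (simp only: fps_continuous_def)
  then show ?thesis
    unfolding Pair vpar_def prod.case
    by (intro continuous_on_if_const continuous_on_inf_coeff continuous_on_const continuous_on_product_coordinates)
qed

lemma continuous_on_toward: "continuous_on A (\<lambda>x. toward N k (fst x) (snd x))"
proof (rule continuous_on_coordinatewise_then_product)
  fix y
  show "continuous_on A (\<lambda>x. toward N k (fst x) (snd x) y)"
  proof (cases "y = (N+1, k (N+1))")
    case True
    then show ?thesis by (simp add: toward_def continuous_on_snd)
  next
    case False
    have "continuous_on A (\<lambda>x. fst x y)"
      by (rule continuous_on_product_then_coordinatewise) (intro continuous_intros)
    then show ?thesis using False by (simp add: toward_def)
  qed
qed

lemma stratum_top: "k (N+1) \<ge> 1 \<Longrightarrow> t \<in> stratum N k \<Longrightarrow> t (N+1, k (N+1)) = 0"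
  by (simp add: stratum_def)

lemma toward_0: "k (N+1) \<ge> 1 \<Longrightarrow> t \<in> stratum N k \<Longrightarrow> toward N k t 0 = t"
  using stratum_top[of k N t] by (simp add: toward_def fun_upd_idem)

lemma toward_flat_dom:
  assumes k: "k (N+1) \<ge> 1" and t: "t \<in> stratum N k" and s: "s \<noteq> 0"
  shows "toward N k t s \<in> flat_dom N k"
proof -
  have "toward N k t s (i, k i) \<noteq> 0" if "i \<in> {1..N+1}" for i
    using that t s by (cases "i = N+1") (auto simp: toward_def stratum_def)
  moreover have "toward N k t s (i, 0) = t (i, 0)" for i
    using k by (auto simp: toward_def)
  moreover have "toward N k t s \<in> points N k"
    using t k by (auto simp: toward_def stratum_def points_def idx_def)
  ultimately show ?thesis using t unfolding flat_dom_def stratum_def by simp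
qed

lemma tendsto_toward: "((\<lambda>s. toward N k t s x) \<longlongrightarrow> toward N k t s0 x) (at s0 within S)"
  by (cases "x = (N+1, k (N+1))") (auto simp: toward_def)

text \<open>Off the stratum \<open>params\<close> is \<open>vpar\<close>, which is continuous
  everywhere, so its limit is its value.\<close>

lemma (in hurwitz_data) params_tilde_eq:
  assumes t: "t \<in> stratum N k"
  shows "params_tilde N k t = vpar N k t"
proof
  fix x
  have k1: "k (N+1) \<ge> 1" by (rule ki) simp
  have "continuous_on UNIV (\<lambda>s. (t, s :: complex))" by (intro continuous_on_Pair continuous_on_const continuous_on_id)
  from continuous_on_compose2[OF continuous_on_toward this, of UNIV N k]
  have "continuous_on UNIV (\<lambda>s. toward N k t s)" by simp
  then have "((\<lambda>s. toward N k t s) \<longlongrightarrow> toward N k t 0) (at 0)"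
    unfolding continuous_on_def by (rule bspec) simp
  then have lim: "((\<lambda>s. toward N k t s) \<longlongrightarrow> t) (at 0)"
    by (simp only: toward_0[of k N t, OF k1 t])
  have ev: "\<forall>\<^sub>F s in at 0. toward N k t s \<in> flat_dom N k \<and> toward N k t s \<noteq> t"
    unfolding eventually_at_filter
  proof (intro always_eventually allI impI conjI)
    fix s :: complex assume s: "s \<noteq> 0"
    then show "toward N k t s \<in> flat_dom N k" by (intro toward_flat_dom k1 t)
    have "toward N k t s (N+1, k (N+1)) = s" by (simp add: toward_def)
    then show "toward N k t s \<noteq> t" using s stratum_top[of k N t, OF k1 t] by auto
  qed
  have fl: "filterlim (toward N k t) (at t within flat_dom N k) (at 0)"
    using lim ev by (simp add: filterlim_at)
  \<comment> \<open>\<open>Lim\<close> is meaningful only if \<open>t\<close> is a limit point of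
    the domain; the curve \<open>toward N k t s\<close> with \<open>s\<close> tending to 0 supplies
    the approximating points.\<close>
  have nt: "\<not> trivial_limit (at t within flat_dom N k)"
  proof
    assume "trivial_limit (at t within flat_dom N k)"
    then have "\<forall>\<^sub>F t' in at t within flat_dom N k. False" by (simp add: trivial_limit_def)
    from eventually_compose_filterlim[OF this fl] show False by simp
  qed
  have "((\<lambda>t'. vpar N k t' x) \<longlongrightarrow> vpar N k t x) (at t within UNIV)"
    by (rule bspec[OF continuous_on_vpar[unfolded continuous_on_def]]) simp
  then have "((\<lambda>t'. vpar N k t' x) \<longlongrightarrow> vpar N k t x) (at t within flat_dom N k)"
    by (rule tendsto_within_subset) simp
  moreover have "\<forall>\<^sub>F t' in at t within flat_dom N k. vpar N k t' x = params N k t' x"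
    by (simp add: eventually_at_filter params_eq)
  ultimately have "((\<lambda>t'. params N k t' x) \<longlongrightarrow> vpar N k t x) (at t within flat_dom N k)"
    by (rule Lim_transform_eventually)
  then show "params_tilde N k t x = vpar N k t x"
    unfolding params_tilde_def flat_domain_eq by (rule tendsto_Lim[OF nt])
qed

lemma box_open_stratum:
  assumes k: "k (N+1) \<ge> 1" and W: "openin (top_of_set (stratum N k)) W"
  shows "box_open (slice_idx N k - {(N+1, k (N+1))}) W"
  unfolding box_open_def
proof
  let ?J = "slice_idx N k - {(N+1, k (N+1))}"
  fix t assume t: "t \<in> W"
  obtain B where B: "open B" "W = stratum N k \<inter> B" using W by (auto simp: openin_open)
  \<comment> \<open>Collects the inequalities among the conditions of \<open>stratum\<close>. The
    equations among them concern frozen coordinates and survive any move within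
    \<open>?J\<close>.\<close>
  define \<Omega> where "\<Omega> = (\<Inter>i\<in>{1..N}. {t :: point. t (i, k i) \<noteq> 0})
     \<inter> (\<Inter>i\<in>{1..N+1}. \<Inter>j\<in>{1..N+1} - {i}. {t. t (i, 0) \<noteq> t (j, 0)})"
  have \<Omega>: "open \<Omega>"
    unfolding \<Omega>_def
    by (intro open_Int open_INT open_Collect_neq ballI continuous_on_const continuous_on_product_coordinates) auto
  have "t \<in> B \<inter> \<Omega>" using t B(2) by (auto simp: \<Omega>_def stratum_def)
  moreover have "finite ?J" by (rule finite_subset[OF _ finite_idx[of N k]]) (auto simp: slice_idx_def)
  ultimately obtain \<epsilon> where \<epsilon>: "\<epsilon> > 0"
    "\<And>t'. (\<And>x. x \<in> ?J \<Longrightarrow> dist (t' x) (t x) < \<epsilon>) \<Longrightarrow> (\<And>x. x \<notin> ?J \<Longrightarrow> t' x = t x) \<Longrightarrow> t' \<in> B \<inter> \<Omega>"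
    using open_fun_box[OF open_Int[OF B(1) \<Omega>]] by metis
  have "t' \<in> W" if near: "\<forall>x\<in>?J. dist (t' x) (t x) < \<epsilon>" and off: "\<forall>x. x \<notin> ?J \<longrightarrow> t' x = t x" for t'
  proof -
    have *: "t' \<in> B" "t' \<in> \<Omega>" using \<epsilon>(2)[of t'] near off by blast+
    have ts: "t \<in> stratum N k" using t B(2) by simp
    have "t' \<in> points N k"
      using ts off by (auto simp: stratum_def points_def slice_idx_def)
    moreover have "t' (N+1, a) = 0" if "a \<in> {1..k (N+1)}" for a
    proof -
      have "(N+1, a) \<notin> ?J" using that by (auto simp: slice_idx_def)
      then show ?thesis using off ts that by (simp add: stratum_def)
    qed
    moreover have "t' (i, k i) \<noteq> 0" if "i \<in> {1..N}" for i
      using *(2) that by (simp add: \<Omega>_def)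
    moreover have "t' (i, 0) \<noteq> t' (j, 0)" if "i \<in> {1..N+1}" "j \<in> {1..N+1}" "i \<noteq> j" for i j
      using *(2) that unfolding \<Omega>_def by blast
    ultimately have "t' \<in> stratum N k" by (simp only: stratum_def mem_Collect_eq) blast
    then show ?thesis using *(1) B(2) by simp
  qed
  then show "\<exists>\<epsilon>>0. \<forall>t'. (\<forall>x\<in>?J. dist (t' x) (t x) < \<epsilon>) \<longrightarrow> (\<forall>x. x \<notin> ?J \<longrightarrow> t' x = t x) \<longrightarrow> t' \<in> W"
    using \<epsilon>(1) by blast
qed

definition slice :: "nat \<Rightarrow> (nat \<Rightarrow> nat) \<Rightarrow> point set \<Rightarrow> complex set \<Rightarrow> point set" where
  "slice N k W S = {toward N k t s | t s. t \<in> W \<and> s \<in> S}"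

lemma connected_slice: "connected W \<Longrightarrow> connected S \<Longrightarrow> connected (slice N k W S)"
proof -
  assume "connected W" "connected S"
  then have "connected ((\<lambda>x. toward N k (fst x) (snd x)) ` (W \<times> S))"
    by (intro connected_continuous_image continuous_on_toward connected_Times)
  moreover have "(\<lambda>x. toward N k (fst x) (snd x)) ` (W \<times> S) = slice N k W S"
    by (force simp: slice_def)
  ultimately show ?thesis by simp
qed

lemma box_open_slice:
  assumes k: "k (N+1) \<ge> 1" and W: "openin (top_of_set (stratum N k)) W" and S: "open S"
  shows "box_open (slice_idx N k) (slice N k W S)"
  unfolding box_open_def
proof
  let ?top = "(N+1, k (N+1))"
  let ?J = "slice_idx N k - {?top}"
  fix u assume "u \<in> slice N k W S"
  then obtain t s where u: "u = toward N k t s" "t \<in> W" "s \<in> S" by (auto simp: slice_def)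
  have t0: "t ?top = 0"
    using openin_imp_subset[OF W] u(2) stratum_top[of k N t, OF k] by auto
  have "\<exists>\<epsilon>>0. \<forall>t'. (\<forall>x\<in>?J. dist (t' x) (t x) < \<epsilon>) \<longrightarrow> (\<forall>x. x \<notin> ?J \<longrightarrow> t' x = t x) \<longrightarrow> t' \<in> W"
    using box_open_stratum[of k N, OF k W, unfolded box_open_def] u(2) by (rule bspec)
  then obtain e where e: "e > 0"
    "\<forall>t'. (\<forall>x\<in>?J. dist (t' x) (t x) < e) \<longrightarrow> (\<forall>x. x \<notin> ?J \<longrightarrow> t' x = t x) \<longrightarrow> t' \<in> W"
    by (elim exE conjE)
  obtain d where d: "d > 0" "\<And>s'. dist s' s < d \<Longrightarrow> s' \<in> S" using S u(3) by (auto simp: open_dist)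
  have ut: "u ?top = s" "\<And>x. x \<noteq> ?top \<Longrightarrow> u x = t x" by (auto simp: u(1) toward_def)
  have "u' \<in> slice N k W S"
    if near: "\<forall>x\<in>slice_idx N k. dist (u' x) (u x) < min e d" and off: "\<forall>x. x \<notin> slice_idx N k \<longrightarrow> u' x = u x" for u'
  proof -
    have "?top \<in> slice_idx N k" by (auto simp: slice_idx_def idx_def)
    then have "u' ?top \<in> S" using near ut(1) by (intro d(2)) auto
    moreover have "u'(?top := 0) \<in> W"
    proof (rule e(2)[THEN spec, THEN mp, THEN mp])
      show "\<forall>x\<in>?J. dist ((u'(?top := 0)) x) (t x) < e"
      proof
        fix x assume "x \<in> ?J"
        then have "dist (u' x) (u x) < e" "x \<noteq> ?top" using near by simp_all
        then show "dist ((u'(?top := 0)) x) (t x) < e" using ut(2)[of x] by simp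
      qed
      show "\<forall>x. x \<notin> ?J \<longrightarrow> (u'(?top := 0)) x = t x"
      proof (intro allI impI)
        fix x assume "x \<notin> ?J"
        then have "x = ?top \<or> x \<noteq> ?top \<and> u' x = u x" using off by blast
        then show "(u'(?top := 0)) x = t x" using ut(2)[of x] t0 by auto
      qed
    qed
    moreover have "u' = toward N k (u'(?top := 0)) (u' ?top)" by (simp add: toward_def)
    ultimately show ?thesis unfolding slice_def by blast
  qed
  then show "\<exists>\<epsilon>>0. \<forall>u'. (\<forall>x\<in>slice_idx N k. dist (u' x) (u x) < \<epsilon>)
      \<longrightarrow> (\<forall>x. x \<notin> slice_idx N k \<longrightarrow> u' x = u x) \<longrightarrow> u' \<in> slice N k W S"
    using e(1) d(1) by (intro exI[of _ "min e d"]) simp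
qed

text \<open>Resetting the top coordinate to 0 projects the slice back to \<open>W\<close>, where the
  branches are given.\<close>

definition slice_log :: "nat \<Rightarrow> (nat \<Rightarrow> nat) \<Rightarrow> (point \<Rightarrow> nat \<Rightarrow> complex \<Rightarrow> complex) \<Rightarrow> point \<Rightarrow> nat \<Rightarrow> complex" where
  "slice_log N k lg t i = lg (t((N+1, k (N+1)) := 0)) i (t (N+1, 0))"

lemma slice_log_toward:
  assumes "k (N+1) \<ge> 1" "t \<in> stratum N k"
  shows "slice_log N k lg (toward N k t s) i = lg t i (t (N+1, 0))"
  using assms stratum_top[of k N t] by (simp add: slice_log_def toward_def fun_upd_idem)

text \<open>Along a coordinate line \<open>f\<close> is continuous, because
  \<open>log_branches\<close> makes the value at the centre continuous in \<open>t\<close>, and it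
  is a logarithm of \<open>h\<close>. Its derivative follows from
  \<open>log_branch_has_derivative\<close>, including the case where the evaluation point itself
  moves.\<close>

lemma slice_log_deriv:
  assumes k: "k (N+1) \<ge> 1" and W: "openin (top_of_set (stratum N k)) W" and lg: "log_branches N W lg"
    and u: "u \<in> slice N k W S" and i: "i \<in> {1..N}" and x: "x \<in> slice_idx N k"
  shows "((\<lambda>s. slice_log N k lg (u(x := s)) i) has_field_derivative
    (if x = (N+1, 0) then 1 / (u (N+1, 0) - u (i, 0)) else if x = (i, 0) then - 1 / (u (N+1, 0) - u (i, 0)) else 0)) (at (u x))"
proof -
  let ?top = "(N+1, k (N+1))"
  obtain t s where us: "u = toward N k t s" "t \<in> W" using u by (auto simp: slice_def)
  have t0: "t ?top = 0" using openin_imp_subset[OF W] us(2) stratum_top[of k N t, OF k] by auto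
  have ne: "(N+1, 0) \<noteq> ?top" "(i, 0) \<noteq> ?top" using k i by auto
  show ?thesis
  proof (cases "x = ?top")
    case True
    have "slice_log N k lg (u(x := s)) i = slice_log N k lg u i" for s
      using ne(1) unfolding True slice_log_def by simp
    then show ?thesis using ne True by simp
  next
    case False
    have ux: "u x = t x" "u (N+1, 0) = t (N+1, 0)" "u (i, 0) = t (i, 0)"
      using False ne by (simp_all add: us(1) toward_def)
    define h where "h = (\<lambda>s. (t(x := s)) (N+1, 0) - (t(x := s)) (i, 0))"
    define f where "f = (\<lambda>s. lg (t(x := s)) i ((t(x := s)) (N+1, 0)))"
    have fe: "slice_log N k lg (u(x := s)) i = f s" for s
    proof -
      have "(u(x := s))(?top := 0) = t(x := s)"
        using False t0 by (auto simp: us(1) toward_def fun_eq_iff)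
      moreover have "(u(x := s)) (N+1, 0) = (t(x := s)) (N+1, 0)" using ux(2) by simp
      ultimately show ?thesis unfolding slice_log_def f_def by (simp only:)
    qed
    have "\<exists>e>0. \<forall>t'. (\<forall>y\<in>slice_idx N k - {?top}. dist (t' y) (t y) < e)
        \<longrightarrow> (\<forall>y. y \<notin> slice_idx N k - {?top} \<longrightarrow> t' y = t y) \<longrightarrow> t' \<in> W"
      using box_open_stratum[of k N, OF k W, unfolded box_open_def] us(2) by (rule bspec)
    then obtain e where e: "e > 0" "\<forall>t'. (\<forall>y\<in>slice_idx N k - {?top}. dist (t' y) (t y) < e)
        \<longrightarrow> (\<forall>y. y \<notin> slice_idx N k - {?top} \<longrightarrow> t' y = t y) \<longrightarrow> t' \<in> W"
      by (elim exE conjE)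
    have inW: "t(x := s) \<in> W" if "s \<in> ball (t x) e" for s
    proof (rule e(2)[THEN spec, THEN mp, THEN mp])
      show "\<forall>y\<in>slice_idx N k - {?top}. dist ((t(x := s)) y) (t y) < e" using that e(1) by (simp add: dist_commute)
      show "\<forall>y. y \<notin> slice_idx N k - {?top} \<longrightarrow> (t(x := s)) y = t y" using x False by auto
    qed
    have c1: "continuous_on (ball (t x) e) (\<lambda>s. t(x := s))"
    proof (rule continuous_on_coordinatewise_then_product)
      show "continuous_on (ball (t x) e) (\<lambda>s. (t(x := s)) y)" for y
        by (cases "y = x") simp_all
    qed
    have c2: "continuous_on W (\<lambda>t. lg t i (t (N+1, 0)))" using lg i by (simp add: log_branches_def)
    have "continuous_on (ball (t x) e) f"
      unfolding f_def by (rule continuous_on_compose2[OF c2 c1]) (use inW in blast)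
    then have cont: "isCont f (t x)" using e(1) by (simp add: continuous_on_eq_continuous_at)
    have "exp (f s) = h s" if "s \<in> ball (t x) e" for s
    proof -
      have "\<forall>\<^sub>F z in nhds ((t(x := s)) (N+1, 0)). lg (t(x := s)) i field_differentiable at z
          \<and> exp (lg (t(x := s)) i z) = z - (t(x := s)) (i, 0)"
        using lg i inW[OF that] unfolding log_branches_def by blast
      from eventually_nhds_x_imp_x[OF this] show ?thesis unfolding f_def h_def by (rule conjunct2)
    qed
    then have ex: "\<forall>\<^sub>F s in nhds (t x). exp (f s) = h s"
      using e(1) by (intro eventually_nhds_in_open[THEN eventually_mono, of "ball (t x) e"]) auto
    have iN: "(i, 0) \<noteq> (N+1, 0)" using i by auto
    have "(h has_field_derivative (if x = (N+1, 0) then 1 else 0) - (if x = (i, 0) then 1 else 0)) (at (t x))"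
      unfolding h_def by (intro DERIV_diff) (auto intro!: derivative_eq_intros)
    from log_branch_has_derivative[OF cont ex this]
    have "(f has_field_derivative ((if x = (N+1, 0) then 1 else 0) - (if x = (i, 0) then 1 else 0)) / h (t x)) (at (t x))" .
    moreover have "h (t x) = u (N+1, 0) - u (i, 0)" unfolding h_def ux fun_upd_triv ..
    moreover have "((if x = (N+1, 0) then 1 else 0) - (if x = (i, 0) then 1 else 0)) / c
       = (if x = (N+1, 0) then 1 / c else if x = (i, 0) then - 1 / c else 0)" for c :: complex
      using iN by auto
    ultimately show ?thesis unfolding fe ux(1) by (simp only:)
  qed
qed

text \<open>The value does not depend on \<open>s\<close>: the top coordinate enters only the last
  pole, and the contribution of that pole to \<open>lam_tilde_int\<close> vanishes because its polar
  parameters are 0 on the stratum.\<close>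

lemma (in hurwitz_data) r_rhs_toward:
  assumes kN: "k (N+1) \<ge> 2" and t: "t \<in> stratum N k"
  shows "r_rhs N k (slice_log N k lg) (toward N k t s) = lam_tilde_int N k lg (t (N+1, 0)) t + correction k t"
proof -
  let ?top = "(N+1, k (N+1))"
  let ?q = "\<lambda>i. vpar N k t (i, 1) * lg t i (t (N+1, 0))
          - (\<Sum>a=2..k i. vpar N k t (i, a) / (of_nat (a - 1) * (t (N+1, 0) - vpar N k t (i, 0)) ^ (a - 1)))"
  have k1: "k (N+1) \<ge> 1" using kN by simp
  have ne: "fst ?top \<noteq> 0" "?top \<noteq> (N+1, 0)" using kN by auto
  have "r_poly N k (toward N k t s) = t (N+1, 0) ^ (k 0 + 1) / (of_nat (k 0) * of_nat (k 0 + 1))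
      + (\<Sum>a=1..k 0 - 1. vpar N k t (0, a) * t (N+1, 0) ^ a / of_nat a)"
    unfolding toward_def r_poly_const[OF ne] unfolding r_poly_def
    by (intro arg_cong2[where f = "(+)"] refl sum.cong) (simp add: vpar_inf)
  moreover have "r_corr k (toward N k t s) = correction k t"
    unfolding toward_def r_corr_const[of ?top, OF ne(1)] unfolding r_corr_def by (rule correction_eq[of k, OF k0, symmetric])
  moreover have "r_polar N k (slice_log N k lg) i (toward N k t s) = ?q i" if i: "i \<in> {1..N}" for i
  proof -
    have ki1: "k i \<ge> 1" using i by (intro ki) simp
    have c: "cpsi k (toward N k t s) i = cpsi k t i" unfolding toward_def using i by (intro cpsi_const) simp
    have p: "toward N k t s (N+1, 0) = t (N+1, 0)" "toward N k t s (i, 0) = t (i, 0)"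
      using i kN by (simp_all add: toward_def)
    have v: "polar_coeff (k i) (cpsi k t i) a = vpar N k t (i, a)" if "a \<in> {1..k i}" for a
      using i that by (intro vpar_polar[symmetric]) simp
    have v0: "vpar N k t (i, 0) = t (i, 0)" using i by (intro vpar_center) simp
    have v1: "polar_coeff (k i) (cpsi k t i) 1 = vpar N k t (i, 1)" using ki1 by (intro v) simp
    show ?thesis
      unfolding r_polar_def slice_log_toward[of k N, OF k1 t] c p v0 v1
      by (intro arg_cong2[where f = "(-)"] refl sum.cong) (simp add: v)
  qed
  moreover have "?q (N+1) = 0"
  proof -
    have z: "t (N+1, a) = 0" if "a \<in> {1..k (N+1)}" for a using t that by (simp add: stratum_def)
    have "cpsi k t (N+1) $ m = 0" for m
    proof -
      have "t (N+1, k (N+1) + 1 - m) = 0" if "m \<in> {1..k (N+1)}" using that by (intro z) auto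
      then show ?thesis by (auto simp: cpsi_def)
    qed
    then have c0: "cpsi k t (N+1) = 0" by (intro fps_ext) simp
    have v0: "vpar N k t (N+1, a) = 0" if "a \<in> {1..k (N+1)}" for a
    proof -
      have "vpar N k t (N+1, a) = polar_coeff (k (N+1)) 0 a"
        unfolding c0[symmetric] by (rule vpar_polar) (use that in auto)
      then show ?thesis using that by (simp add: polar_coeff_def power_0_left)
    qed
    then have "vpar N k t (N+1, 1) = 0" "\<And>a. a \<in> {2..k (N+1)} \<Longrightarrow> vpar N k t (N+1, a) = 0" using kN by auto
    then show ?thesis using kN by simp
  qed
  ultimately show ?thesis
    by (simp add: r_rhs_def lam_tilde_int_def lam_int_def params_tilde_eq[OF t])
qed

lemma holo_deriv:
  assumes "holo N k U f" "t \<in> U" "x \<in> idx N k"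
  shows "((\<lambda>s. f (t(x := s))) has_field_derivative pd x f t) (at (t x))"
  using assms unfolding holo_def pd_def by (simp add: field_differentiable_derivI)

lemma finite_slice_idx: "finite (slice_idx N k)"
  by (rule finite_subset[OF _ finite_idx[of N k]]) (auto simp: slice_idx_def)

theorem theorem1p4:
  fixes N :: nat and k :: "nat \<Rightarrow> nat"
    and U W :: "point set" and S :: "complex set"
    and F :: "point \<Rightarrow> complex" and lg :: "point \<Rightarrow> nat \<Rightarrow> complex \<Rightarrow> complex"
  assumes "k 0 \<ge> 2" and "\<And>i. i \<in> {1..N+1} \<Longrightarrow> k i \<ge> 1" and "k (N+1) \<ge> 2"
    and "openin (top_of_set (flat_domain N k)) U" and "potential N k U F"
    and "openin (top_of_set (stratum N k)) W" and "connected W"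
    and "open S" and "connected S" and "0 \<notin> S" and "0 \<in> closure S"
    and "\<And>t s. t \<in> W \<Longrightarrow> s \<in> S \<Longrightarrow> toward N k t s \<in> U"
    and "log_branches N W lg"
  shows "\<exists>c0 c. \<forall>t\<in>W. restricts_to N k S (pd (N+1, 1) F) t
           (lam_tilde_int N k lg (t (N+1, 0)) t + correction k t
             + (c0 + (\<Sum>x\<in>idx N k. c x * t x)))"
proof -
  interpret hurwitz_data N k using assms(1,2) by unfold_locales
  define J where "J = slice_idx N k"
  define T where "T = slice N k W S"
  define H where "H = pd (N+1, 1) F"
  define l where "l = slice_log N k lg"
  have k1: "k (N+1) \<ge> 1" using assms(3) by simp
  have WS: "W \<subseteq> stratum N k" using assms(6) by (rule openin_imp_subset)
  have TU: "T \<subseteq> U" using assms(12) by (auto simp: T_def slice_def)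
  have JI: "J \<subseteq> idx N k" by (auto simp: J_def slice_idx_def)
  have w: "(N+1, 1) \<in> idx N k" using assms(3) by (auto simp: idx_def)
  have log_point: "log_point N k t l" if t: "t \<in> T" for t
  proof unfold_locales
    show "t \<in> flat_dom N k" using t TU openin_imp_subset[OF assms(4)] flat_domain_eq by auto
    show "k (N+1) \<ge> 2" by (rule assms(3))
    show "t (N+1, a) = 0" if "a \<in> {1..<k (N+1)}" for a
      using t WS that by (auto simp: T_def slice_def toward_def stratum_def)
    show "((\<lambda>s. l (t(x := s)) i) has_field_derivative
       (if x = (N+1, 0) then 1 / (t (N+1, 0) - t (i, 0)) else if x = (i, 0) then - 1 / (t (N+1, 0) - t (i, 0)) else 0)) (at (t x))"
      if "i \<in> {1..N}" "x \<in> slice_idx N k" for i x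
      unfolding l_def by (rule slice_log_deriv[of k N, OF k1 assms(6,13) t[unfolded T_def] that])
  qed
  \<comment> \<open>All coordinates outside \<open>J\<close> are 0 on \<open>T\<close>: those
    outside \<open>idx N k\<close> by membership in \<open>points N k\<close>, and the lower ones of
    the last pole by the slice.\<close>
  have off: "\<forall>t\<in>T. \<forall>t'\<in>T. \<forall>x. x \<notin> J \<longrightarrow> t' x = t x"
  proof -
    have "t x = 0" if t: "t \<in> T" and x: "x \<notin> J" for t x
    proof -
      interpret log_point N k t l by (rule log_point[OF t])
      show ?thesis
      proof (cases "x \<in> idx N k")
        case True
        then have f: "fst x = N+1" using x by (auto simp: J_def slice_idx_def idx_def)
        then have "snd x \<in> {1..<k (N+1)}" using True x by (cases x) (auto simp: J_def slice_idx_def idx_def)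
        then show ?thesis using slice[of "snd x"] f by (cases x) simp
      next
        case False
        then show ?thesis using local.t by (cases x) (auto simp: flat_dom_def points_def)
      qed
    qed
    then show ?thesis by (intro ballI allI impI) metis
  qed
  \<comment> \<open>The clauses of \<open>potential\<close> hold for every order of the three
    derivatives, so \<open>(N+1, 1)\<close> can be taken innermost and no exchange of derivatives
    occurs.\<close>
  have H: "holo N k U H" "\<And>y. y \<in> idx N k \<Longrightarrow> holo N k U (pd y H)"
    "\<And>x y t. x \<in> idx N k \<Longrightarrow> y \<in> idx N k \<Longrightarrow> t \<in> U \<Longrightarrow> pd x (pd y H) t = triple N k t x y (N+1, 1)"
    using assms(5) w unfolding potential_def H_def by blast+
  \<comment> \<open>The constants are common to the whole connected slice, hence independent of
    \<open>t\<close> in \<open>W\<close> and of \<open>s\<close>.\<close>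
  obtain c0 c where c: "\<And>t. t \<in> T \<Longrightarrow> H t - r_rhs N k l t = c0 + (\<Sum>y\<in>J. c y * t y)"
  proof (rule affine_of_zero_second_partials[where f = "\<lambda>t. H t - r_rhs N k l t"
        and g = "\<lambda>y t. pd y H t - dr_rhs N k l y t" and T = T and J = J])
    show "finite J" unfolding J_def by (rule finite_slice_idx)
    show "connected T" unfolding T_def by (rule connected_slice[OF assms(7,9)])
    show "box_open J T" unfolding J_def T_def by (rule box_open_slice[of k N, OF k1 assms(6,8)])
    show "\<forall>t\<in>T. \<forall>t'\<in>T. \<forall>x. x \<notin> J \<longrightarrow> t' x = t x" by (rule off)
    show "((\<lambda>s. H (t(y := s)) - r_rhs N k l (t(y := s))) has_field_derivative pd y H t - dr_rhs N k l y t) (at (t y))"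
      if "t \<in> T" "y \<in> J" for t y
      using that TU JI
      by (intro DERIV_diff holo_deriv[OF H(1)] log_point.r_rhs_deriv[OF log_point]) (auto simp: J_def)
    show "((\<lambda>s. pd y H (t(x := s)) - dr_rhs N k l y (t(x := s))) has_field_derivative 0) (at (t x))"
      if t: "t \<in> T" and x: "x \<in> J" and y: "y \<in> J" for t x y
    proof -
      have xy: "x \<in> idx N k" "y \<in> idx N k" "t \<in> U" using t x y JI TU by auto
      have "((\<lambda>s. pd y H (t(x := s)) - dr_rhs N k l y (t(x := s))) has_field_derivative
          pd x (pd y H) t - triple N k t x y (N+1, 1)) (at (t x))"
        by (intro DERIV_diff holo_deriv[OF H(2)] log_point.dr_rhs_deriv[OF log_point] xy t x[unfolded J_def] y[unfolded J_def])
      then show ?thesis using H(3)[OF xy] by simp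
    qed
  qed (rule that)
  \<comment> \<open>Extension by 0 turns the sum over the slice directions into one over all
    coordinates.\<close>
  define d where "d = (\<lambda>x. if x \<in> J then c x else 0)"
  have sumJ: "(\<Sum>x\<in>idx N k. d x * t x) = (\<Sum>x\<in>J. c x * t x)" for t :: point
    unfolding d_def using JI by (intro sum.mono_neutral_cong_right finite_idx) auto
  have "restricts_to N k S H t (lam_tilde_int N k lg (t (N+1, 0)) t + correction k t + (c0 + (\<Sum>x\<in>idx N k. d x * t x)))"
    if t: "t \<in> W" for t
  proof -
    have ts: "t \<in> stratum N k" using t WS by auto
    let ?R = "lam_tilde_int N k lg (t (N+1, 0)) t + correction k t"
    \<comment> \<open>By \<open>r_rhs_toward\<close> the summand \<open>?R\<close> is free of
      \<open>s\<close>, so on the slice over \<open>t\<close> only the affine function still varies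
      with \<open>s\<close>.\<close>
    have val: "?R + (c0 + (\<Sum>x\<in>J. c x * toward N k t s x)) = H (toward N k t s)" if "s \<in> S" for s
    proof -
      have "toward N k t s \<in> T" using t that by (auto simp: T_def slice_def)
      from c[OF this] show ?thesis unfolding l_def r_rhs_toward[OF assms(3) ts] by (simp add: algebra_simps)
    qed
    have "((\<lambda>s. toward N k t s x) \<longlongrightarrow> t x) (at 0 within S)" for x
      using tendsto_toward[of N k t x 0 S] by (simp only: toward_0[of k N t, OF k1 ts])
    then have "((\<lambda>s. ?R + (c0 + (\<Sum>x\<in>J. c x * toward N k t s x))) \<longlongrightarrow> ?R + (c0 + (\<Sum>x\<in>J. c x * t x))) (at 0 within S)"
      by (intro tendsto_add tendsto_const tendsto_sum tendsto_mult)
    moreover have "\<forall>\<^sub>F s in at 0 within S. ?R + (c0 + (\<Sum>x\<in>J. c x * toward N k t s x)) = H (toward N k t s)"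
      using val by (simp add: eventually_at_filter)
    ultimately show ?thesis unfolding restricts_to_def sumJ by (rule Lim_transform_eventually)
  qed
  then show ?thesis unfolding H_def by blast
qed

end
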